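(* For $D^2=67$ on $\mathbb{H}_2$, there are $300$ PGSs of type $(D,\beta)$ and $50$ PGSs of type $(D^*,\alpha)$ with $(D^* )^2=75$.
   Context: $\mathbb{A}_2=\{me_1+ne_2:m,n\in\mathbb{Z}\}\subset\mathbb{R}^2$, $e_1=(1,0)$, $e_2=(-1/2,\sqrt3/2)$; $me_1+ne_2$ is written $(m,n)$. $\mathbb{H}_2=\mathbb{A}_2\setminus\{m(1,2)+n(2,1):m,n\in\mathbb{Z}\}$ (honeycomb lattice). A $D$-admissible configuration (AC) on $\mathbb{H}_2$ is $\phi:\mathbb{H}_2\to\{0,1\}$ with distinct occupied sites ($\phi=1$) at Euclidean distance $\ge D$; it is identified with its set of occupied sites. A ground state is an AC $\varphi$ such that there do not exist a finite $\mathbb{V}\subset\mathbb{H}_2$ and a configuration on $\mathbb{V}$ with more occupied sites than $\varphi$ in $\mathbb{V}$ which together with $\varphi$ outside $\mathbb{V}$ is an AC. A PGS is a ground state invariant under shifts by two linearly independent vectors of $\mathbb{A}_2$. A PGS is of type $(D^*,\alpha)$ if it is a shift, by a vector of $\mathbb{A}_2$, of a $D^*$-sub-lattice of $\mathbb{A}_2$ (a sub-lattice having as fundamental parallelogram a rhombus made of two equilateral triangles of side $D^*$) that is contained in $\mathbb{H}_2$. A PGS is of type $(D,\beta)$, for $D^2=67=a^2+b^2+ab$ with $(a,b)=(2,7)$, if it is a set $\{O,C\}+\mathbb{Z}(B-O)+\mathbb{Z}(C-A)$, where $O,A,B,C\in\mathbb{H}_2$ are the vertices of a quadrilateral $OABC$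 with $|OA|=|OC|=D$, angle $AOC$ equal to $2\pi/3$, $|AB|^2=D^2+2a+b+1=79$, $|BC|^2=D^2-a+b+1=73$, and shorter diagonal $|OB|^2=D^2+a+2b+1=84$ (either orientation is allowed). *)

theory Defs
  imports "HOL-Analysis.Analysis"
begin

definition e1 :: "real^2" where
  "e1 = vector [1, 0]"

definition e2 :: "real^2" where
  "e2 = vector [- 1 / 2, sqrt 3 / 2]"

definition site :: "int \<Rightarrow> int \<Rightarrow> real^2" where
  "site m n = of_int m *\<^sub>R e1 + of_int n *\<^sub>R e2"

definition A2 :: "(real^2) set" where
  "A2 = {site m n | m n. True}"

definition H2 :: "(real^2) set" where
  "H2 = A2 - {of_int m *\<^sub>R site 1 2 + of_int n *\<^sub>R site 2 1 | m n. True}"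

(* A configuration is represented by its set of occupied sites. *)
definition admissible :: "real \<Rightarrow> (real^2) set \<Rightarrow> bool" where
  "admissible D \<phi> \<longleftrightarrow>
     \<phi> \<subseteq> H2 \<and> (\<forall>x\<in>\<phi>. \<forall>y\<in>\<phi>. x \<noteq> y \<longrightarrow> D \<le> dist x y)"

definition ground_state :: "real \<Rightarrow> (real^2) set \<Rightarrow> bool" where
  "ground_state D \<phi> \<longleftrightarrow>
     admissible D \<phi> \<and>
     \<not> (\<exists>V \<psi>. finite V \<and> V \<subseteq> H2 \<and> \<psi> \<subseteq> V \<and>
            card (\<phi> \<inter> V) < card \<psi> \<and> admissible D (\<psi> \<union> (\<phi> - V)))"

definition shift_invariant :: "real^2 \<Rightarrow> (real^2) set \<Rightarrow> bool" where
  "shift_invariant u \<phi> \<longleftrightarrow> (\<lambda>x. x + u) ` \<phi> = \<phi>"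

definition PGS :: "real \<Rightarrow> (real^2) set \<Rightarrow> bool" where
  "PGS D \<phi> \<longleftrightarrow>
     ground_state D \<phi> \<and>
     (\<exists>u\<in>A2. \<exists>v\<in>A2. u \<noteq> v \<and> independent {u, v} \<and>
        shift_invariant u \<phi> \<and> shift_invariant v \<phi>)"

definition int_span2 :: "real^2 \<Rightarrow> real^2 \<Rightarrow> (real^2) set" where
  "int_span2 u v = {of_int m *\<^sub>R u + of_int n *\<^sub>R v | m n. True}"

(* The rhombus 0, u, u + v, v consists of the triangles 0, u, v and u, v, u + v;
   both are equilateral of side d iff u, v and u - v all have length d. *)
definition equilateral_sublattice :: "real \<Rightarrow> (real^2) set \<Rightarrow> bool" where
  "equilateral_sublattice d L \<longleftrightarrow>
     (\<exists>u\<in>A2. \<exists>v\<in>A2. norm u = d \<and> norm v = d \<and> dist u v = d \<and> L = int_span2 u v)"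

(* It is the shifted copy, not the sub-lattice itself (which contains 0), that lies in H2. *)
definition alpha_type :: "real \<Rightarrow> (real^2) set \<Rightarrow> bool" where
  "alpha_type d \<phi> \<longleftrightarrow>
     (\<exists>L w. equilateral_sublattice d L \<and> w \<in> A2 \<and> \<phi> = (\<lambda>x. x + w) ` L \<and> \<phi> \<subseteq> H2)"

(* The unoriented angle at q, with values in [0, pi]. *)
definition vertex_angle :: "real^2 \<Rightarrow> real^2 \<Rightarrow> real^2 \<Rightarrow> real" where
  "vertex_angle p q r = arccos (((p - q) \<bullet> (r - q)) / (norm (p - q) * norm (r - q)))"

(* pO, pA, pB, pC are the vertices O, A, B, C in cyclic order, clockwise or
   counterclockwise.  That the diagonals OB and AC meet expresses that OABC is a
   (convex) quadrilateral; for a = 2, b = 7 the prescribed lengths and angle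
   force this, as well as |OB| < |AC|. *)
definition beta_quadrilateral ::
  "real \<Rightarrow> int \<Rightarrow> int \<Rightarrow> real^2 \<Rightarrow> real^2 \<Rightarrow> real^2 \<Rightarrow> real^2 \<Rightarrow> bool" where
  "beta_quadrilateral D a b pO pA pB pC \<longleftrightarrow>
     pO \<in> H2 \<and> pA \<in> H2 \<and> pB \<in> H2 \<and> pC \<in> H2 \<and>
     closed_segment pO pB \<inter> closed_segment pA pC \<noteq> {} \<and>
     dist pO pA = D \<and> dist pO pC = D \<and>
     vertex_angle pA pO pC = 2 * pi / 3 \<and>
     (dist pA pB)\<^sup>2 = D\<^sup>2 + of_int (2 * a + b + 1) \<and>
     (dist pB pC)\<^sup>2 = D\<^sup>2 + of_int (- a + b + 1) \<and>
     (dist pO pB)\<^sup>2 = D\<^sup>2 + of_int (a + 2 * b + 1) \<and>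
     dist pO pB < dist pA pC"

definition beta_type :: "real \<Rightarrow> int \<Rightarrow> int \<Rightarrow> (real^2) set \<Rightarrow> bool" where
  "beta_type D a b \<phi> \<longleftrightarrow>
     D\<^sup>2 = of_int (a\<^sup>2 + b\<^sup>2 + a * b) \<and>
     (\<exists>pO pA pB pC. beta_quadrilateral D a b pO pA pB pC \<and>
        \<phi> = {p + q | p q. p \<in> {pO, pC} \<and> q \<in> int_span2 (pB - pO) (pC - pA)})"

end

theory Submission
  imports Defs "HOL-Computational_Algebra.Polynomial"
begin

text \<open>
  Both kinds of configurations have one particle per 75 lattice cells, so they are ground states
  as soon as no admissible configuration is denser: a local improvement, repeated periodically,
  would give a denser packing.

  For the density bound take the Delaunay triangulation of a saturated packing (made generic by a
  small perturbation of the paraboloid).  By saturation every squared circumradius is at most 85.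
  With the area measured by the determinant, a triangle has on average to contribute at least 75.
  The only lattice triangles that contribute less have (determinant; squared sides)
  (67; 67, 67, 201), (73; 73, 73, 219), (74; 67, 73, 84) and (74; 67, 84, 229).  Each of them is
  compensated by its neighbour across the longest side.  For the sides 201, 219 and 229 this
  neighbour has determinant at least 114.  For the side 84 the end points have the same colour
  (coordinate sum modulo 3) and determinants satisfy congruences modulo 3: two triangles with
  apexes of the other colour have determinants summing to a multiple of 3, hence to at least 150,
  and a triangle in one colour has determinant at least 78, enough for all of its three sides.
  Angle sums show that there are at least two triangles per particle.

  The count itself is a finite computation: a configuration of type alpha is one of 50 cosets of a
  single sub-lattice, and one of type beta is given by one of 6 shapes and one of 50 residues.
\<close>

section \<open>Regular triangulations of finite lattice point sets\<close>

text \<open>The target 75 is the index of the alpha lattice and half the index 150 of a beta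
  lattice, which carries two orbits. The radius bound rests on sqrt 67 + 1 < 9.2 < sqrt 85: each
  point of the plane is within 1 of a honeycomb site, and near saturated points each site has a
  particle at squared distance below 67. Lattice points are often cocircular, so the cells of the
  exact paraboloid may fail to be triangles; the perturbation repairs this and loses no precision,
  because the in-circle determinant is an integer and moves by less than 1.

  All sets are finite. A packing is completed to a maximal one in a larger box, so saturation is
  available only near the original points. This separates the cells at original points, which are
  counted, from a larger family that also contains their neighbours. Global geometry enters through
  three facts: cells overlap in null sets, each side of a counted cell has a cell beyond it, and the
  angles around an original point sum to a positive multiple of 2 pi. The loss along the border is
  linear in the side of the box and is beaten by the repeated improvement.\<close>

declare split_paired_All [simp del] split_paired_Ex [simp del]

type_synonym pt = "int \<times> int"

text \<open>Squared Euclidean length in the basis \<open>e1\<close>, \<open>e2\<close>; the mixed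
  term is negative because these vectors enclose the angle 2 pi / 3.\<close>

definition qf :: "pt \<Rightarrow> int" where
  "qf p = (fst p)\<^sup>2 + (snd p)\<^sup>2 - fst p * snd p"

text \<open>The removed sub-lattice, spanned by (1, 2) and (2, 1), consists of the points with
  coordinate sum divisible by 3; see \<open>hole_iff\<close>.\<close>

definition hex :: "pt \<Rightarrow> bool" where
  "hex p \<longleftrightarrow> (fst p + snd p) mod 3 \<noteq> 0"

text \<open>Twice the signed area, in units of a lattice cell.\<close>

definition det2 :: "pt \<Rightarrow> pt \<Rightarrow> pt \<Rightarrow> int" where
  "det2 x y z = (fst y - fst x) * (snd z - snd x) - (snd y - snd x) * (fst z - fst x)"

definition ev :: "real \<times> real \<times> real \<Rightarrow> pt \<Rightarrow> real" where
  "ev l p = fst l * of_int (fst p) + fst (snd l) * of_int (snd p) + snd (snd l)"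

lemma det2_same [simp]: "det2 x x y = 0" "det2 x y x = 0" "det2 x y y = 0"
  by (simp_all add: det2_def algebra_simps)

lemma det2_rot: "det2 y z x = det2 x y z"
  by (simp add: det2_def algebra_simps)

lemma det2_swap: "det2 y x z = - det2 x y z"
  by (simp add: det2_def algebra_simps)

text \<open>Barycentric coordinates of \<open>w\<close> with the denominator cleared, so that
  everything except the values of \<open>l\<close> is an integer.\<close>

lemma ev_barycentric:
  "of_int (det2 x y z) * ev l w =
     of_int (det2 w y z) * ev l x + of_int (det2 x w z) * ev l y + of_int (det2 x y w) * ev l z"
  by (simp add: det2_def ev_def algebra_simps)

text \<open>Rotates the graph of \<open>l\<close> about the line above \<open>x\<close> and
  \<open>y\<close>: the added multiple of \<open>det2 x y p\<close> vanishes on that line.\<close>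

definition tilt :: "real \<times> real \<times> real \<Rightarrow> real \<Rightarrow> pt \<Rightarrow> pt \<Rightarrow> real \<times> real \<times> real" where
  "tilt l m x y = (fst l - m * of_int (snd y - snd x), fst (snd l) + m * of_int (fst y - fst x),
     snd (snd l) + m * of_int (snd y - snd x) * of_int (fst x) - m * of_int (fst y - fst x) * of_int (snd x))"

lemma ev_tilt: "ev (tilt l m x y) p = ev l p + m * of_int (det2 x y p)"
  by (simp add: tilt_def ev_def det2_def algebra_simps)

text \<open>An affine function that supports the lifted points from below in \<open>S\<close> exhibits \<open>S\<close> as a face of
  the lower convex hull of the lift.  The cells below are its facets, with vertices listed
  counterclockwise; for a lift close to \<open>qf\<close> they are the Delaunay triangles.\<close>

definition supports :: "pt set \<Rightarrow> (pt \<Rightarrow> real) \<Rightarrow> real \<times> real \<times> real \<Rightarrow> pt set \<Rightarrow> bool" where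
  "supports X h l S \<longleftrightarrow> S \<subseteq> X \<and> (\<forall>p\<in>S. ev l p = h p) \<and> (\<forall>p\<in>X - S. ev l p < h p)"

definition edge :: "pt set \<Rightarrow> (pt \<Rightarrow> real) \<Rightarrow> pt \<Rightarrow> pt \<Rightarrow> bool" where
  "edge X h x y \<longleftrightarrow> x \<noteq> y \<and> (\<exists>l. supports X h l {x, y})"

definition cell :: "pt set \<Rightarrow> (pt \<Rightarrow> real) \<Rightarrow> pt \<Rightarrow> pt \<Rightarrow> pt \<Rightarrow> bool" where
  "cell X h x y z \<longleftrightarrow> det2 x y z > 0 \<and> (\<exists>l. supports X h l {x, y, z})"

text \<open>No plane meets the lift in a fourth point besides three that are not collinear in the
  base; hence the lower facets are triangles.\<close>

definition generic :: "pt set \<Rightarrow> (pt \<Rightarrow> real) \<Rightarrow> bool" where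
  "generic X h \<longleftrightarrow> (\<forall>x\<in>X. \<forall>y\<in>X. \<forall>z\<in>X. \<forall>w\<in>X. det2 x y z \<noteq> 0 \<longrightarrow> w \<notin> {x, y, z} \<longrightarrow>
     \<not> (\<exists>l. \<forall>p\<in>{x, y, z, w}. ev l p = h p))"

lemma supports_le: "supports X h l S \<Longrightarrow> p \<in> X \<Longrightarrow> ev l p \<le> h p"
  by (metis DiffI less_eq_real_def order_refl supports_def)

lemma supports_eqD: "supports X h l S \<Longrightarrow> p \<in> X \<Longrightarrow> ev l p = h p \<Longrightarrow> p \<in> S"
  by (metis DiffI less_irrefl supports_def)

lemma edge_sym: "edge X h x y \<Longrightarrow> edge X h y x"
  by (auto simp: edge_def insert_commute)

lemma edge_in: "edge X h x y \<Longrightarrow> x \<in> X \<and> y \<in> X"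
  by (auto simp: edge_def supports_def)

lemma cell_in: "cell X h x y z \<Longrightarrow> x \<in> X \<and> y \<in> X \<and> z \<in> X"
  by (auto simp: cell_def supports_def)

lemma cell_rot: "cell X h x y z \<Longrightarrow> cell X h y z x"
  by (simp add: cell_def det2_rot insert_commute)

lemma cell_distinct: "cell X h x y z \<Longrightarrow> x \<noteq> y \<and> y \<noteq> z \<and> x \<noteq> z"
  by (auto simp: cell_def)

text \<open>Gift wrapping: the supporting plane is rotated about the edge until it first meets a
  lifted point on the left. Genericity makes this point unique.\<close>

lemma edge_cell:
  assumes fin: "finite X" and gen: "generic X h" and e: "edge X h x y"
    and w0: "w0 \<in> X" "det2 x y w0 > 0"
  shows "\<exists>z. cell X h x y z"
proof -
  obtain l where l: "supports X h l {x, y}" using e by (auto simp: edge_def)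
  let ?S = "{w \<in> X. det2 x y w > 0}"
  let ?f = "\<lambda>w. (h w - ev l w) / of_int (det2 x y w)"
  have S: "finite ?S" "?S \<noteq> {}" using fin w0 by auto
  have "Min (?f ` ?S) \<in> ?f ` ?S" using S by (intro Min_in) auto
  then obtain z where z: "z \<in> ?S" and zm: "Min (?f ` ?S) = ?f z" by blast
  have min: "?f z \<le> ?f w" if "w \<in> ?S" for w
    unfolding zm[symmetric] using S that by (intro Min_le) auto
  \<comment> \<open>The amount of rotation at which the plane first touches the lift over the left
    half-plane.\<close>
  define m where "m = ?f z"
  define l' where "l' = tilt l m x y"
  have zX: "z \<in> X" "det2 x y z > 0" using z by auto
  have "z \<noteq> x" "z \<noteq> y" using zX by auto
  hence "ev l z < h z" using l zX by (auto simp: supports_def)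
  hence m0: "m > 0" using zX by (simp add: m_def)
  have lz: "ev l' z = h z" using zX by (simp add: l'_def ev_tilt m_def)
  have lxy: "ev l' x = h x" "ev l' y = h y" using l by (auto simp: l'_def ev_tilt supports_def)
  have xX: "x \<in> X" "y \<in> X" using edge_in[OF e] by auto
  have "ev l' p < h p" if p: "p \<in> X" "p \<notin> {x, y, z}" for p
  proof (cases "det2 x y p > 0")
    case True
    hence "m \<le> ?f p" using min p by (auto simp: m_def)
    hence "m * of_int (det2 x y p) \<le> h p - ev l p" using True by (simp add: pos_le_divide_eq)
    hence le: "ev l' p \<le> h p" by (simp add: l'_def ev_tilt)
    moreover have "ev l' p \<noteq> h p"
    proof
      assume "ev l' p = h p"
      hence "\<forall>q\<in>{x, y, z, p}. ev l' q = h q" using lz lxy by auto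
      moreover have "det2 x y z \<noteq> 0" using zX by simp
      ultimately show False using gen xX zX p unfolding generic_def by blast
    qed
    ultimately show ?thesis by simp
  next
    case False
    hence "m * of_int (det2 x y p) \<le> 0" using m0 by (simp add: mult_le_0_iff)
    moreover have "ev l p < h p" using l p by (auto simp: supports_def)
    ultimately show ?thesis by (simp add: l'_def ev_tilt)
  qed
  hence "supports X h l' {x, y, z}" using lz lxy xX zX by (auto simp: supports_def)
  thus ?thesis using zX by (auto simp: cell_def)
qed

lemma finite_pos_lower_bound:
  fixes g :: "'a \<Rightarrow> real"
  assumes "finite F" "\<And>w. w \<in> F \<Longrightarrow> g w > 0"
  shows "\<exists>m>0. \<forall>w\<in>F. m \<le> g w"
  using assms
proof (induction F rule: finite_induct)
  case empty
  thus ?case by (auto intro: exI[of _ 1])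
next
  case (insert a F)
  then obtain m where "m > 0" "\<forall>w\<in>F. m \<le> g w" by auto
  thus ?case using insert.prems by (intro exI[of _ "min m (g a)"]) auto
qed

text \<open>Rotating the plane of a cell slightly the other way lowers it at \<open>z\<close>; as
  there are finitely many other points, it also stays below those.\<close>

lemma cell_edge:
  assumes fin: "finite X" and c: "cell X h x y z"
  shows "edge X h x y"
proof -
  obtain l where l: "supports X h l {x, y, z}" and d: "det2 x y z > 0"
    using c by (auto simp: cell_def)
  \<comment> \<open>The summand 1 keeps the denominator positive for points on the line through
    \<open>x\<close> and \<open>y\<close>.\<close>
  obtain m where m: "m > 0"
    "\<And>w. w \<in> X - {x, y, z} \<Longrightarrow> m \<le> (h w - ev l w) / (\<bar>of_int (det2 x y w)\<bar> + 1)"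
    using finite_pos_lower_bound[of "X - {x, y, z}" "\<lambda>w. (h w - ev l w) / (\<bar>of_int (det2 x y w)\<bar> + 1)"]
      fin l by (auto simp: supports_def)
  define l' where "l' = tilt l (- m) x y"
  have "ev l' p < h p" if p: "p \<in> X" "p \<notin> {x, y}" for p
  proof (cases "p = z")
    case True
    moreover have "ev l z = h z" using l by (auto simp: supports_def)
    ultimately show ?thesis using d m by (simp add: l'_def ev_tilt)
  next
    case False
    hence "m * (\<bar>of_int (det2 x y p)\<bar> + 1) \<le> h p - ev l p"
      using m(2)[of p] p by (simp add: pos_le_divide_eq add_nonneg_pos)
    moreover have "- (m * of_int (det2 x y p)) \<le> m * \<bar>of_int (det2 x y p)\<bar>"
      using m by (metis abs_ge_minus_self mult_left_mono mult_minus_right less_imp_le)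
    ultimately show ?thesis using m(1) by (simp add: l'_def ev_tilt algebra_simps)
  qed
  moreover have "ev l' x = h x" "ev l' y = h y" "x \<in> X" "y \<in> X"
    using l by (auto simp: l'_def ev_tilt supports_def)
  ultimately have "supports X h l' {x, y}" by (auto simp: supports_def)
  thus ?thesis using d by (auto simp: edge_def)
qed

text \<open>The two planes agree above \<open>x\<close> and \<open>y\<close>, so their difference is
  a multiple of \<open>det2 x y\<close>. It is nonnegative at \<open>z\<close> and nonpositive at
  \<open>z'\<close>, both on the left, hence zero; then the first plane touches the lift at
  \<open>z'\<close>.\<close>

lemma cell_unique:
  assumes c: "cell X h x y z" and c': "cell X h x y z'"
  shows "z = z'"
proof -
  obtain l where l: "supports X h l {x, y, z}" and d: "det2 x y z > 0"
    using c by (auto simp: cell_def)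
  obtain l' where l': "supports X h l' {x, y, z'}" and d': "det2 x y z' > 0"
    using c' by (auto simp: cell_def)
  have X: "z \<in> X" "z' \<in> X" using cell_in[OF c] cell_in[OF c'] by auto
  have e: "ev l' x = ev l x" "ev l' y = ev l y" "ev l z = h z" "ev l' z' = h z'"
    using l l' by (auto simp: supports_def)
  have "of_int (det2 x y z) * (ev l z' - ev l' z') = of_int (det2 x y z') * (ev l z - ev l' z)"
    using ev_barycentric[of x y z l z'] ev_barycentric[of x y z l' z'] e(1,2)
    by (simp add: algebra_simps)
  moreover have "ev l z' - ev l' z' \<le> 0" "0 \<le> ev l z - ev l' z"
    using supports_le[OF l X(2)] supports_le[OF l' X(1)] e by auto
  moreover have "of_int (det2 x y z') * (ev l z - ev l' z) \<ge> 0"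
    using calculation(3) d' by simp
  moreover have "of_int (det2 x y z) * (ev l z' - ev l' z') \<le> 0"
    using calculation(2) d by (simp add: mult_le_0_iff)
  ultimately have "of_int (det2 x y z) * (ev l z' - ev l' z') = 0" by linarith
  hence "ev l z' - ev l' z' = 0" using d by simp
  hence "z' \<in> {x, y, z}" using supports_eqD[OF l X(2)] e by simp
  thus ?thesis using d' by auto
qed

lemma cells_share_support:
  assumes c: "det2 x y z > 0" "supports X h l {x, y, z}"
    and c': "det2 x' y' z' > 0" "supports X h l' {x', y', z'}"
    and eq: "\<And>p. ev l p = ev l' p"
  shows "{x, y, z} = {x', y', z'}"
proof -
  have "S \<subseteq> T" if "supports X h l S" "supports X h l' T" "\<And>p. ev l p = ev l' p" for S T l l'
  proof
    fix p assume "p \<in> S"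
    hence "p \<in> X" "ev l' p = h p" using that by (auto simp: supports_def)
    thus "p \<in> T" using supports_eqD[OF that(2)] by blast
  qed
  from this[OF c(2) c'(2) eq] this[OF c'(2) c(2) eq[symmetric]] show ?thesis by blast
qed

section \<open>The exceptional triangles: arithmetic\<close>

text \<open>Residues that exclude most integers not represented by \<open>qf\<close>.\<close>

definition norm_like :: "int \<Rightarrow> bool" where
  "norm_like n \<longleftrightarrow> n mod 3 \<noteq> 2 \<and> n mod 9 \<noteq> 6 \<and> n mod 4 \<noteq> 2 \<and> n mod 16 \<noteq> 8"

text \<open>Values of \<open>qf\<close> are norms of Eisenstein integers. There 2 is inert, so it
  divides a nonzero norm to an even power; 3 is ramified, and the part of a norm prime to 3 is 1
  modulo 3. The proof only tests residues.\<close>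

lemma norm_like_qf: "norm_like (qf p)"
proof -
  define m n where "m = fst p" and "n = snd p"
  have q: "qf p = m * m + n * n - m * n" by (simp add: qf_def m_def n_def power2_eq_square)
  have eq: "(m * m + n * n - m * n) mod k =
     ((m mod k) * (m mod k) + (n mod k) * (n mod k) - (m mod k) * (n mod k)) mod k" for k :: int
  proof -
    define r s i j where "r = m mod k" "s = n mod k" "i = m div k" "j = n div k"
    have "m = r + k * i" "n = s + k * j" by (simp_all add: r_s_i_j_def)
    hence "m * m + n * n - m * n = (r * r + s * s - r * s) +
        k * (2 * r * i + k * i * i + 2 * s * j + k * j * j - r * j - s * i - k * i * j)"
      by (simp add: algebra_simps)
    thus ?thesis by (simp add: r_s_i_j_def(1,2))
  qed
  have chk: "\<forall>k\<in>set [3, 9, 4, 16]. \<forall>u\<in>set [0..15]. \<forall>v\<in>set [0..15]. u < k \<longrightarrow> v < k \<longrightarrow>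
      (u * u + v * v - u * v) mod k \<noteq> (if k = 3 then 2 else if k = 9 then 6 else if k = 4 then 2 else (8::int))"
    by code_simp
  have key: "(m * m + n * n - m * n) mod k \<noteq> (if k = 3 then 2 else if k = 9 then 6 else if k = 4 then 2 else 8)"
    if "k \<in> set [3, 9, 4, 16]" for k :: int
  proof -
    have "0 < k" "k \<le> 16" using that by auto
    hence "m mod k \<in> set [0..15]" "n mod k \<in> set [0..15]" "m mod k < k" "n mod k < k"
      using pos_mod_bound[of k m] pos_mod_bound[of k n] pos_mod_sign[of k m] pos_mod_sign[of k n]
      by (auto simp del: pos_mod_bound pos_mod_sign)
    thus ?thesis using chk that unfolding eq by blast
  qed
  show ?thesis unfolding norm_like_def q
    using key[of 3] key[of 9] key[of 4] key[of 16] by simp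
qed

section \<open>Integer square roots and the finite search\<close>

definition root_step :: "int \<Rightarrow> int \<Rightarrow> int \<Rightarrow> int" where
  "root_step n b r = (if (r + b) * (r + b) \<le> n then r + b else r)"

text \<open>Binary digits of the square root, highest first. Eight digits are enough for the roots
  below 256 that occur in \<open>small_triangle_types\<close>.\<close>

definition root8 :: "int \<Rightarrow> int" where
  "root8 n = root_step n 1 (root_step n 2 (root_step n 4 (root_step n 8 (root_step n 16
     (root_step n 32 (root_step n 64 (root_step n 128 0)))))))"

lemma root_step:
  assumes "0 \<le> r" "r \<le> p" "p < r + 2 * b" "0 < b"
  shows "0 \<le> root_step (p * p) b r \<and> root_step (p * p) b r \<le> p \<and> p < root_step (p * p) b r + b"
proof -
  have "(r + b) * (r + b) \<le> p * p \<longleftrightarrow> r + b \<le> p"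
    using assms by (simp add: abs_le_square_iff[symmetric] power2_eq_square[symmetric])
  thus ?thesis using assms by (auto simp: root_step_def)
qed

lemma root8:
  assumes "0 \<le> p" "p < 256"
  shows "root8 (p * p) = p"
proof -
  have 0: "0 \<le> (0::int) \<and> 0 \<le> p \<and> p < 0 + 256" using assms by simp
  have step: "0 \<le> root_step (p * p) b r \<and> root_step (p * p) b r \<le> p \<and> p < root_step (p * p) b r + b"
    if "0 \<le> r \<and> r \<le> p \<and> p < r + b'" "b' = 2 * b" "0 < b" for r b b'
    using root_step[of r p b] that by simp
  define r0 where "r0 = root_step (p * p) 128 0"
  have s0: "0 \<le> r0 \<and> r0 \<le> p \<and> p < r0 + 128" unfolding r0_def by (rule step[OF 0]) simp_all
  define r1 where "r1 = root_step (p * p) 64 r0"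
  have s1: "0 \<le> r1 \<and> r1 \<le> p \<and> p < r1 + 64" unfolding r1_def by (rule step[OF s0]) simp_all
  define r2 where "r2 = root_step (p * p) 32 r1"
  have s2: "0 \<le> r2 \<and> r2 \<le> p \<and> p < r2 + 32" unfolding r2_def by (rule step[OF s1]) simp_all
  define r3 where "r3 = root_step (p * p) 16 r2"
  have s3: "0 \<le> r3 \<and> r3 \<le> p \<and> p < r3 + 16" unfolding r3_def by (rule step[OF s2]) simp_all
  define r4 where "r4 = root_step (p * p) 8 r3"
  have s4: "0 \<le> r4 \<and> r4 \<le> p \<and> p < r4 + 8" unfolding r4_def by (rule step[OF s3]) simp_all
  define r5 where "r5 = root_step (p * p) 4 r4"
  have s5: "0 \<le> r5 \<and> r5 \<le> p \<and> p < r5 + 4" unfolding r5_def by (rule step[OF s4]) simp_all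
  define r6 where "r6 = root_step (p * p) 2 r5"
  have s6: "0 \<le> r6 \<and> r6 \<le> p \<and> p < r6 + 2" unfolding r6_def by (rule step[OF s5]) simp_all
  define r7 where "r7 = root_step (p * p) 1 r6"
  have s7: "0 \<le> r7 \<and> r7 \<le> p \<and> p < r7 + 1" unfolding r7_def by (rule step[OF s6]) simp_all
  have "r7 = p" using s7 by linarith
  thus ?thesis unfolding root8_def r7_def r6_def r5_def r4_def r3_def r2_def r1_def r0_def .
qed

definition small_types :: "(int \<times> int \<times> int \<times> int) list" where
  "small_types = [(67, 67, 67, 201), (73, 73, 73, 219), (74, 67, 73, 84), (74, 67, 84, 229)]"

text \<open>Every disjunct but the last discards a candidate: the sides are not in order, the
  squared circumradius exceeds 85, no two vertices have the same colour, or \<open>c\<close> is not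
  a norm.\<close>

definition side_ok :: "int \<Rightarrow> int \<Rightarrow> int \<Rightarrow> int \<Rightarrow> bool" where
  "side_ok t a b c \<longleftrightarrow> b < a \<or> c < b \<or> a * b * c > 255 * t * t \<or> a * b * c mod 3 \<noteq> 0 \<or> \<not> norm_like c \<or>
     (t, a, b, c) \<in> set small_types"

definition root_ok :: "int \<Rightarrow> int \<Rightarrow> int \<Rightarrow> int \<Rightarrow> int \<Rightarrow> bool" where
  "root_ok t a b n r \<longleftrightarrow> (if r * r = n then side_ok t a b (a + b - r) \<and> side_ok t a b (a + b + r) else True)"

definition disc_ok :: "int \<Rightarrow> int \<Rightarrow> int \<Rightarrow> int \<Rightarrow> bool" where
  "disc_ok t a b n = root_ok t a b n (root8 n)"

text \<open>Recursive functions instead of bounded quantifiers: \<open>code_simp\<close> would otherwise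
  unfold \<open>root8\<close> symbolically under the binder.\<close>

fun check_ts :: "int \<Rightarrow> int \<Rightarrow> int list \<Rightarrow> bool" where
  "check_ts a b [] = True"
| "check_ts a b (t # ts) = (disc_ok t a b (4 * a * b - 3 * t * t) \<and> check_ts a b ts)"

fun check_bs :: "int \<Rightarrow> int list \<Rightarrow> int list \<Rightarrow> bool" where
  "check_bs a [] ts = True"
| "check_bs a (b # bs) ts = ((if b < a then True else check_ts a b ts) \<and> check_bs a bs ts)"

fun check_as :: "int list \<Rightarrow> int list \<Rightarrow> int list \<Rightarrow> bool" where
  "check_as [] bs ts = True"
| "check_as (a # as) bs ts = (check_bs a bs ts \<and> check_as as bs ts)"

lemma check_ts: "check_ts a b ts \<Longrightarrow> t \<in> set ts \<Longrightarrow> disc_ok t a b (4 * a * b - 3 * t * t)"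
  by (induction a b ts rule: check_ts.induct) auto

lemma check_bs: "check_bs a bs ts \<Longrightarrow> b \<in> set bs \<Longrightarrow> a \<le> b \<Longrightarrow> check_ts a b ts"
  by (induction a bs ts rule: check_bs.induct) auto

lemma check_as: "check_as as bs ts \<Longrightarrow> a \<in> set as \<Longrightarrow> check_bs a bs ts"
  by (induction as bs ts rule: check_as.induct) auto

lemma small_triangle_search:
  "check_as [67, 73, 75, 76, 79, 81] [67, 73, 75, 76, 79, 81, 84, 85, 91, 93, 97, 99, 100] [35..74]"
  by code_simp

text \<open>Heron's formula is quadratic in \<open>c\<close>, so \<open>(t, a, b)\<close> leaves two
  candidates for \<open>c\<close> and only triples are enumerated. Triangles that are not obtuse are
  bounded by their area, obtuse ones by their circumradius.\<close>

lemma small_triangle_types: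
  fixes a b c t :: int
  assumes nl: "norm_like a" "norm_like b" "norm_like c" and ord: "67 \<le> a" "a \<le> b" "b \<le> c"
    and t: "0 < t" "t < 75" and her: "4 * a * b - (a + b - c)\<^sup>2 = 3 * t\<^sup>2"
    and R: "a * b * c \<le> 255 * t\<^sup>2" and m3: "a * b * c mod 3 = 0"
  shows "(t, a, b, c) \<in> {(67, 67, 67, 201), (73, 73, 73, 219), (74, 67, 73, 84), (74, 67, 84, 229)}"
proof -
  have t2: "t\<^sup>2 \<le> 5476" using power_mono[of t 74 2] t by simp
  have aa: "67 * 67 \<le> a * a" "67 * b \<le> a * b" "a * a \<le> a * b"
    using ord by (intro mult_mono; simp)+
  have bnd: "a \<le> 82 \<and> b \<le> 100 \<and> \<bar>a + b - c\<bar> < 256"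
  proof (cases "c \<le> a + b")
    case True
    \<comment> \<open>Here \<open>b \<le> c\<close> gives \<open>a + b - c \<le> a\<close>. The
      constant of the next line is 3 * 74^2.\<close>
    have "(a + b - c)\<^sup>2 \<le> a\<^sup>2" using True ord by (intro power_mono) auto
    hence 1: "4 * a * b - a * a \<le> 16428" using her t2 by (simp add: power2_eq_square)
    have "a \<le> 74"
    proof (rule ccontr)
      assume "\<not> a \<le> 74"
      hence "75 * 75 \<le> a * a" by (intro mult_mono) auto
      thus False using 1 aa by simp
    qed
    moreover have "a * a \<le> 74 * 74" using calculation ord by (intro mult_mono) auto
    moreover have "4 * a * b = 4 * (a * b)" by simp
    ultimately have "b \<le> 81" using 1 aa(2) by linarith
    thus ?thesis using \<open>a \<le> 74\<close> True ord by linarith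
  next
    case False
    define q where "q = c - a - b"
    have q: "q > 0" "c = a + b + q" using False by (auto simp: q_def)
    have q2: "q * q = 4 * a * b - 3 * t\<^sup>2" using her by (simp add: q(2) power2_eq_square)
    \<comment> \<open>4 * 67^2 - 3 * 74^2 = 1528 exceeds 39^2, so \<open>q\<close> is at least 40.
      Below, 1396380 = 255 * 74^2.\<close>
    hence "q * q \<ge> 1528" using aa t2 by simp
    have q40: "q \<ge> 40"
    proof (rule ccontr)
      assume "\<not> q \<ge> 40"
      hence "q * q \<le> 39 * 39" using q by (intro mult_mono) auto
      thus False using \<open>q * q \<ge> 1528\<close> by simp
    qed
    have ub: "(a * b) * (a + b + 40) \<le> 1396380"
    proof -
      have "(a * b) * (a + b + 40) \<le> (a * b) * c" using q q40 ord by (intro mult_left_mono) auto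
      thus ?thesis using R t2 by simp
    qed
    have a: "a \<le> 82"
    proof (rule ccontr)
      assume *: "\<not> a \<le> 82"
      hence "83 * 83 \<le> a * b" using ord by (intro mult_mono) auto
      hence "(83 * 83) * 206 \<le> (a * b) * (a + b + 40)" using * ord by (intro mult_mono) auto
      thus False using ub by simp
    qed
    have b: "b \<le> 100"
    proof (rule ccontr)
      assume *: "\<not> b \<le> 100"
      hence "67 * 101 \<le> a * b" using ord by (intro mult_mono) auto
      hence "(67 * 101) * 208 \<le> (a * b) * (a + b + 40)" using * ord by (intro mult_mono) auto
      thus False using ub by simp
    qed
    have "a * b \<le> 82 * 100" using a b ord by (intro mult_mono) auto
    have "q < 256"
    proof (rule ccontr)
      assume *: "\<not> q < 256"
      hence "256 * 256 \<le> q * q" by (intro mult_mono) auto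
      thus False using q2 \<open>a * b \<le> 82 * 100\<close> zero_le_power2[of t] by linarith
    qed
    thus ?thesis using a b q by auto
  qed
  have "a \<in> set [67..82]" "b \<in> set [67..100]" using bnd ord unfolding set_upto by auto
  moreover have "\<forall>n\<in>set [67..82]. norm_like n \<longrightarrow> n \<in> set [67, 73, 75, 76, 79, 81]"
    "\<forall>n\<in>set [67..100]. norm_like n \<longrightarrow> n \<in> set [67, 73, 75, 76, 79, 81, 84, 85, 91, 93, 97, 99, 100]"
    by code_simp+
  ultimately have ab: "a \<in> set [67, 73, 75, 76, 79, 81]"
    "b \<in> set [67, 73, 75, 76, 79, 81, 84, 85, 91, 93, 97, 99, 100]" using nl by blast+
  have "67 * 67 * 67 \<le> a * b * c" using ord by (intro mult_mono) auto
  \<comment> \<open>255 * 34^2 is still smaller than 67^3.\<close>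
  have "35 \<le> t"
  proof (rule ccontr)
    assume "\<not> 35 \<le> t"
    hence "t\<^sup>2 \<le> 34\<^sup>2" using t by (intro power_mono) auto
    thus False using R \<open>67 * 67 * 67 \<le> a * b * c\<close> by simp
  qed
  hence tt: "t \<in> set [35..74]" using t unfolding set_upto by auto
  define p where "p = \<bar>a + b - c\<bar>"
  have n: "4 * a * b - 3 * t * t = p * p" using her by (simp add: p_def power2_eq_square)
  have r: "root8 (4 * a * b - 3 * t * t) = p" unfolding n using bnd by (intro root8) (auto simp: p_def)
  have c: "c \<in> set [a + b - p, a + b + p]" by (auto simp: p_def)
  have "disc_ok t a b (p * p)"
    using check_ts[OF check_bs[OF check_as[OF small_triangle_search ab(1)] ab(2) ord(2)] tt] n by simp
  moreover have "root8 (p * p) = p" using r n by simp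
  ultimately have "side_ok t a b c"
    using c by (auto simp: disc_ok_def root_ok_def)
  thus ?thesis using R m3 nl ord
    by (auto simp: side_ok_def small_types_def power2_eq_square mult.assoc)
qed

text \<open>If \<open>c\<close> is the squared side opposite the angle g, then a + b - c = sqrt 3 *
  t * cot g, so \<open>t \<le> a + b - c\<close> says that g is at most 60 degrees. For a given sum
  the product \<open>a * b\<close> is least when one factor is 67; the circumradius bound then
  becomes a quadratic inequality in \<open>t\<close>.\<close>

lemma long_edge_neighbour:
  fixes a b c t :: int
  assumes "67 \<le> a" "67 \<le> b" "201 \<le> c" "t \<le> a + b - c" "0 < t" "a * b * c \<le> 255 * t\<^sup>2"
  shows "114 \<le> t"
proof (rule ccontr)
  assume "\<not> 114 \<le> t"
  hence "t * t \<le> 113 * t" using assms by (intro mult_right_mono) auto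
  moreover have "201 * (67 * (201 + t) - 4489) \<le> 255 * (t * t)"
  proof -
  have "0 \<le> (a - 67) * (b - 67)" using assms by auto
  hence ab: "67 * (a + b) - 4489 \<le> a * b" by (simp add: algebra_simps)
  hence "201 * (67 * (201 + t) - 4489) \<le> 201 * (a * b)" using assms by simp
  also have "\<dots> \<le> c * (a * b)" using assms by (intro mult_right_mono) auto
  also have "\<dots> \<le> 255 * (t * t)" using assms by (simp add: power2_eq_square mult_ac)
  finally show ?thesis .
  qed
  ultimately show False using \<open>\<not> 114 \<le> t\<close> by simp
qed

text \<open>Congruences modulo 3 leave determinant 75 possible for a triangle in one colour with a
  side 84, and such a triangle would have no surplus. Division by 3 makes the search small: 28 = 84
  / 3, 1875 = 75^2 / 3, and 1897 is the integer part of 255 * 75^2 / (9 * 84).\<close>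

lemma mono_edge_84:
  fixes a b :: int
  assumes "67 \<le> a" "67 \<le> b" "a mod 3 = 0" "b mod 3 = 0"
    and her: "4 * a * b - (a + b - 84)\<^sup>2 = 3 * 75\<^sup>2" and R: "a * b * 84 \<le> 255 * 75\<^sup>2"
  shows False
proof -
  obtain u v where uv: "a = 3 * u" "b = 3 * v" using assms by (metis mod_0_imp_dvd dvdE)
  have ge: "23 \<le> u" "23 \<le> v" using assms uv by auto
  have R': "u * v \<le> 1897" using R uv by simp
  have "u \<le> 82"
  proof (rule ccontr)
    assume "\<not> u \<le> 82"
    hence "83 * 23 \<le> u * v" using ge by (intro mult_mono) auto
    thus False using R' by simp
  qed
  moreover have "v \<le> 82"
  proof (rule ccontr)
    assume "\<not> v \<le> 82"
    hence "23 * 83 \<le> u * v" using ge by (intro mult_mono) auto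
    thus False using R' by simp
  qed
  ultimately have "u \<in> set [23..82]" "v \<in> set [23..82]" using ge by (simp_all only: set_upto atLeastAtMost_iff)
  moreover have "\<forall>u\<in>set [23..82]. \<forall>v\<in>set [23..82]. u * v \<le> 1897 \<longrightarrow> 4 * u * v - (u + v - 28) * (u + v - 28) \<noteq> (1875::int)"
    by code_simp
  moreover have "4 * u * v - (u + v - 28) * (u + v - 28) = 1875"
    using her uv by (simp add: power2_eq_square algebra_simps)
  ultimately show False using R' by blast
qed

section \<open>Circumcentres and saturation\<close>

definition emb :: "pt \<Rightarrow> complex" where
  "emb p = Complex (of_int (fst p) - of_int (snd p) / 2) (of_int (snd p) * sqrt 3 / 2)"

lemma cmod_hex: "(cmod (Complex (a - b / 2) (b * sqrt 3 / 2)))\<^sup>2 = a * a + b * b - a * b"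
proof -
  have "(b * sqrt 3 / 2)\<^sup>2 = 3 * b\<^sup>2 / 4" by (simp add: power_divide power_mult_distrib)
  thus ?thesis unfolding cmod_power2 complex.sel by (simp add: power2_eq_square field_simps)
qed

lemma cmod_emb_minus:
  "(cmod (emb p - Complex (m - n / 2) (n * sqrt 3 / 2)))\<^sup>2 =
     (of_int (fst p) - m) * (of_int (fst p) - m) + (of_int (snd p) - n) * (of_int (snd p) - n) - (of_int (fst p) - m) * (of_int (snd p) - n)"
proof -
  have "emb p - Complex (m - n / 2) (n * sqrt 3 / 2) =
      Complex ((of_int (fst p) - m) - (of_int (snd p) - n) / 2) ((of_int (snd p) - n) * sqrt 3 / 2)"
    by (simp add: emb_def complex_eq_iff field_simps)
  thus ?thesis by (simp only: cmod_hex)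
qed

lemma cmod_emb_diff: "(cmod (emb p - emb q))\<^sup>2 = of_int (qf (p - q))"
  using cmod_emb_minus[of p "fst q" "snd q"]
  by (simp only: emb_def qf_def power2_eq_square) simp

text \<open>The determinant of \<open>x y z\<close> times the power of \<open>w\<close> with respect to their circumcircle.\<close>

definition incircle :: "pt \<Rightarrow> pt \<Rightarrow> pt \<Rightarrow> pt \<Rightarrow> int" where
  "incircle x y z w = det2 x y z * qf (w - x) - qf (y - x) * det2 x w z - qf (z - x) * det2 x y w"

lemma incircle_lift:
  "incircle x y z w =
     det2 x y z * qf w - (det2 w y z * qf x + det2 x w z * qf y + det2 x y w * qf z)"
  by (cases x; cases y; cases z; cases w)
    (simp add: incircle_def det2_def qf_def algebra_simps power2_eq_square)

text \<open>The second property is the formula R^2 = a b c / (16 S^2) in squared sides, where the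
  area S satisfies 16 S^2 = 3 t^2 for the determinant t.\<close>

lemma circumcentre:
  assumes t: "det2 x y z > 0"
  obtains c where "\<And>w. of_int (det2 x y z) * ((cmod (emb w - c))\<^sup>2 - (cmod (emb x - c))\<^sup>2) = of_int (incircle x y z w)"
    and "(cmod (emb x - c))\<^sup>2 * (3 * (of_int (det2 x y z))\<^sup>2) = of_int (qf (y - z) * qf (z - x) * qf (x - y))"
proof -
  define u1 u2 v1 v2 where "u1 = fst y - fst x" "u2 = snd y - snd x" "v1 = fst z - fst x" "v2 = snd z - snd x"
  define T A B where "T = real_of_int (det2 x y z)" "A = real_of_int (qf (y - x))" "B = real_of_int (qf (z - x))"
  have T0: "T \<noteq> 0" using t by (simp add: T_A_B_def)
  \<comment> \<open>\<open>p1\<close>, \<open>p2\<close> are the coefficients of the linear form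
    sending w - x to twice its scalar product with c - x. Cramer's rule finds them from the values
    \<open>A\<close> at \<open>y\<close> and \<open>B\<close> at \<open>z\<close>;
    \<open>g1\<close>, \<open>g2\<close> are the lattice coordinates of c - x.\<close>
  define p1 p2 where "p1 = (A * v2 - B * u2) / T" "p2 = (u1 * B - v1 * A) / T"
  define g1 g2 where "g1 = (2 * p1 + p2) / 3" "g2 = (p1 + 2 * p2) / 3"
  define c where "c = Complex ((of_int (fst x) + g1) - (of_int (snd x) + g2) / 2) ((of_int (snd x) + g2) * sqrt 3 / 2)"
  have TT: "T = u1 * v2 - u2 * v1" by (simp add: T_A_B_def u1_u2_v1_v2_def det2_def)
  have Tp: "T * p1 = A * v2 - B * u2" "T * p2 = u1 * B - v1 * A" using T0 by (simp_all add: p1_p2_def)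
  have pg: "p1 = 2 * g1 - g2" "p2 = 2 * g2 - g1" by (simp_all add: g1_g2_def field_simps)
  have cw: "(cmod (emb w - c))\<^sup>2 - (cmod (emb x - c))\<^sup>2
      = of_int (qf (w - x)) - (of_int (fst w - fst x) * p1 + of_int (snd w - snd x) * p2)" for w
    unfolding pg c_def cmod_emb_minus by (simp add: qf_def algebra_simps power2_eq_square)
  have inc: "T * ((cmod (emb w - c))\<^sup>2 - (cmod (emb x - c))\<^sup>2) = of_int (incircle x y z w)" for w
  proof -
    have "T * ((cmod (emb w - c))\<^sup>2 - (cmod (emb x - c))\<^sup>2)
       = T * of_int (qf (w - x)) - (of_int (fst w - fst x) * (T * p1) + of_int (snd w - snd x) * (T * p2))"
      unfolding cw by (simp add: algebra_simps)
    also have "\<dots> = of_int (incircle x y z w)"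
      unfolding Tp by (simp add: incircle_def T_A_B_def u1_u2_v1_v2_def det2_def algebra_simps)
    finally show ?thesis .
  qed
  have "(cmod (emb x - c))\<^sup>2 = g1 * g1 + g2 * g2 - g1 * g2"
    unfolding c_def cmod_emb_minus by simp
  hence r2: "(cmod (emb x - c))\<^sup>2 * (3 * T\<^sup>2) = (T * p1) * (T * p1) + (T * p2) * (T * p2) + (T * p1) * (T * p2)"
    unfolding pg by (simp only:) (simp add: algebra_simps power2_eq_square)
  note r2
  also have "\<dots> = A * A * (v1 * v1 + v2 * v2 - v1 * v2) + B * B * (u1 * u1 + u2 * u2 - u1 * u2)
      + A * B * (u1 * v2 + u2 * v1 - 2 * u1 * v1 - 2 * u2 * v2)"
    unfolding Tp by (simp add: algebra_simps)
  also have "v1 * v1 + v2 * v2 - v1 * v2 = qf (z - x)"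
    by (simp_all add: T_A_B_def u1_u2_v1_v2_def qf_def power2_eq_square)
  also have "u1 * u1 + u2 * u2 - u1 * u2 = qf (y - x)"
    by (simp_all add: T_A_B_def u1_u2_v1_v2_def qf_def power2_eq_square)
  also have "real_of_int (u1 * v2 + u2 * v1 - 2 * u1 * v1 - 2 * u2 * v2) = of_int (qf (y - z)) - A - B"
    by (simp add: T_A_B_def u1_u2_v1_v2_def qf_def power2_eq_square algebra_simps)
  finally have "(cmod (emb x - c))\<^sup>2 * (3 * T\<^sup>2) = of_int (qf (y - z)) * A * B"
    by (simp add: T_A_B_def(2,3) algebra_simps)
  moreover have "qf (x - y) = qf (y - x)" by (simp add: qf_def power2_eq_square algebra_simps)
  ultimately show ?thesis using that[of c] inc by (simp add: T_A_B_def mult_ac)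
qed

text \<open>Heron's formula for 16 times the squared area; the factor 3 appears because a lattice
  cell has area sqrt 3 / 2.\<close>

lemma heron_det: "4 * qf (y - z) * qf (z - x) - (qf (y - z) + qf (z - x) - qf (x - y))\<^sup>2 = 3 * (det2 x y z)\<^sup>2"
  unfolding qf_def det2_def fst_diff snd_diff by algebra

text \<open>A local condition, as completion takes place in a finite box. The range 13 covers the
  sites at squared distance at most 121 that occur in \<open>saturated_hole\<close>.\<close>

definition saturated :: "pt set \<Rightarrow> pt \<Rightarrow> bool" where
  "saturated X x \<longleftrightarrow> (\<forall>s. hex s \<longrightarrow> \<bar>fst s - fst x\<bar> \<le> 13 \<longrightarrow> \<bar>snd s - snd x\<bar> \<le> 13 \<longrightarrow>
     (\<exists>w\<in>X. qf (w - s) < 67))"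

lemma qf_coord: "3 * (fst p)\<^sup>2 \<le> 4 * qf p" "3 * (snd p)\<^sup>2 \<le> 4 * qf p"
proof -
  have "4 * qf p = 3 * (fst p)\<^sup>2 + (2 * snd p - fst p)\<^sup>2"
    "4 * qf p = 3 * (snd p)\<^sup>2 + (2 * fst p - snd p)\<^sup>2"
    by (simp_all add: qf_def power2_eq_square algebra_simps)
  thus "3 * (fst p)\<^sup>2 \<le> 4 * qf p" "3 * (snd p)\<^sup>2 \<le> 4 * qf p"
    using zero_le_power2[of "2 * snd p - fst p"] zero_le_power2[of "2 * fst p - snd p"] by linarith+
qed

lemma unit_square_qf:
  fixes u v :: real
  assumes "0 \<le> u" "u \<le> 1" "0 \<le> v" "v \<le> 1"
  shows "u * u + v * v - u * v \<le> 1"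
proof -
  have "u * u + v * v - u * v \<le> max u v * max u v"
  proof (cases "u \<le> v")
    case True thus ?thesis using mult_left_mono[of u v u] assms by (simp add: max_def)
  next
    case False thus ?thesis using mult_left_mono[of v u v] assms by (simp add: max_def mult.commute)
  qed
  also have "\<dots> \<le> 1 * 1" using assms by (intro mult_mono) auto
  finally show ?thesis by simp
qed

text \<open>A lattice cell is a rhombus whose short diagonal joins \<open>(k, j)\<close> and
  \<open>(k + 1, j + 1)\<close>, so both ends are within 1 of all its points. Their coordinate sums
  differ by 2 and are not both divisible by 3.\<close>

lemma hex_within_one:
  obtains s where "hex s" "cmod (emb s - c) \<le> 1"
proof -
  define n where "n = Im c * 2 / sqrt 3"
  define m where "m = Re c + n / 2"
  define k j where "k = \<lfloor>m\<rfloor>" and "j = \<lfloor>n\<rfloor>"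
  define u v where "u = m - k" and "v = n - j"
  have uv: "0 \<le> u" "u \<le> 1" "0 \<le> v" "v \<le> 1"
    using floor_correct[of m] floor_correct[of n] unfolding u_def v_def k_def j_def by linarith+
  have c: "c = Complex (m - n / 2) (n * sqrt 3 / 2)" by (simp add: n_def m_def complex_eq_iff)
  have d: "(cmod (emb (a, b) - c))\<^sup>2 = (a - m) * (a - m) + (b - n) * (b - n) - (a - m) * (b - n)" for a b :: int
    unfolding c cmod_emb_minus by simp
  show ?thesis
  proof (cases "hex (k, j)")
    case True
    have "(cmod (emb (k, j) - c))\<^sup>2 = u * u + v * v - u * v"
      by (simp add: d u_def v_def algebra_simps)
    hence "(cmod (emb (k, j) - c))\<^sup>2 \<le> 1\<^sup>2" using unit_square_qf[OF uv] by simp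
    hence "cmod (emb (k, j) - c) \<le> 1" by (rule power2_le_imp_le) simp
    thus ?thesis using that[OF True] by simp
  next
    case False
    hence h: "hex (k + 1, j + 1)" unfolding hex_def fst_conv snd_conv by presburger
    have "(cmod (emb (k + 1, j + 1) - c))\<^sup>2 = (1 - u) * (1 - u) + (1 - v) * (1 - v) - (1 - u) * (1 - v)"
      by (simp add: d u_def v_def algebra_simps)
    hence "(cmod (emb (k + 1, j + 1) - c))\<^sup>2 \<le> 1\<^sup>2" using unit_square_qf[of "1 - u" "1 - v"] uv by simp
    hence "cmod (emb (k + 1, j + 1) - c) \<le> 1" by (rule power2_le_imp_le) simp
    thus ?thesis using that[OF h] by simp
  qed
qed

text \<open>The disc of radius sqrt 85 that touches the given circle at \<open>x\<close> from inside
  has its centre \<open>c'\<close> close enough to \<open>x\<close> for saturation to apply. A site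
  within 1 of \<open>c'\<close> has a particle within 8.2, and 9.2 < sqrt 85 puts that particle
  inside the smaller disc.\<close>

lemma saturated_hole:
  assumes sat: "saturated X x" and c: "85 \<le> (cmod (c - emb x))\<^sup>2"
  shows "\<exists>w\<in>X. cmod (emb w - c) < cmod (emb x - c)"
proof -
  define r where "r = cmod (c - emb x)"
  define q where "q = sqrt 85"
  have q: "q \<ge> 0" "q\<^sup>2 = 85" "q < 10" by (auto simp: q_def intro: real_less_lsqrt)
  have q9: "9.2 < q" unfolding q_def by (rule real_less_rsqrt) (simp add: power2_eq_square)
  have rq: "q \<le> r" using c unfolding q_def r_def by (simp add: real_le_lsqrt)
  hence r0: "r > 0" using q9 by simp
  define c' where "c' = emb x + complex_of_real (q / r) * (c - emb x)"
  have d1: "cmod (c' - emb x) = q" using q r0 by (simp only: c'_def add_diff_cancel_left' norm_mult norm_of_real flip: r_def) simp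
  have "c' - c = - complex_of_real (1 - q / r) * (c - emb x)" by (simp add: c'_def algebra_simps)
  hence "cmod (c' - c) = \<bar>1 - q / r\<bar> * r"
    by (metis norm_minus_cancel norm_mult norm_of_real r_def)
  also have "\<dots> = r - q" using rq r0 by (simp add: field_simps abs_if)
  finally have d2: "cmod (c' - c) = r - q" .
  obtain s where s: "hex s" "cmod (emb s - c') \<le> 1" using hex_within_one by blast
  have "cmod (emb s - emb x) \<le> 1 + q"
    using norm_triangle_ineq[of "emb s - c'" "c' - emb x"] s d1 by simp
  hence "(cmod (emb s - emb x))\<^sup>2 \<le> 11\<^sup>2" using q by (intro power_mono) auto
  hence "qf (s - x) \<le> 121" unfolding cmod_emb_diff by simp
  hence "3 * (fst (s - x))\<^sup>2 < 3 * 13\<^sup>2" "3 * (snd (s - x))\<^sup>2 < 3 * 13\<^sup>2"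
    using qf_coord[of "s - x"] by simp_all
  hence "\<bar>fst s - fst x\<bar> \<le> 13" "\<bar>snd s - snd x\<bar> \<le> 13"
    using abs_le_square_iff[of "fst s - fst x" 13] abs_le_square_iff[of "snd s - snd x" 13] by simp_all
  then obtain w where w: "w \<in> X" "qf (w - s) < 67" using sat s unfolding saturated_def by blast
  have "(cmod (emb w - emb s))\<^sup>2 < 8.2\<^sup>2" unfolding cmod_emb_diff using w by (simp add: power2_eq_square)
  hence "cmod (emb w - emb s) < 8.2" by (rule power2_less_imp_less) simp
  hence "cmod (emb w - c') < q"
    using norm_triangle_ineq[of "emb w - emb s" "emb s - c'"] s q9 by simp
  hence "cmod (emb w - c) < r"
    using norm_triangle_ineq[of "emb w - c'" "c' - c"] d2 by simp
  thus ?thesis using w by (auto simp: r_def norm_minus_commute)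
qed

definition packed :: "pt set \<Rightarrow> bool" where
  "packed X \<longleftrightarrow> (\<forall>x\<in>X. hex x) \<and> (\<forall>x\<in>X. \<forall>y\<in>X. x \<noteq> y \<longrightarrow> 67 \<le> qf (x - y))"

text \<open>The circle about \<open>c\<close> is tangent to the line \<open>x y\<close> at
  \<open>x\<close>, so its interior lies to the left of that line. Its squared radius is at least 4
  * 67, hence it contains a particle.\<close>

lemma saturated_left:
  assumes sat: "saturated X x" and d: "67 \<le> qf (x - y)"
  shows "\<exists>w\<in>X. det2 x y w > 0"
proof -
  define V where "V = emb y - emb x"
  have V: "(cmod V)\<^sup>2 \<ge> 67" using d cmod_emb_diff[of x y] by (simp add: V_def norm_minus_commute)
  define c where "c = emb x + 2 * \<i> * V"
  have "(cmod (c - emb x))\<^sup>2 = 4 * (cmod V)\<^sup>2" by (simp add: c_def norm_mult power_mult_distrib)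
  then obtain w where w: "w \<in> X" "cmod (emb w - c) < cmod (emb x - c)"
    using saturated_hole[OF sat, of c] V by auto
  have "(cmod (emb w - c))\<^sup>2 < (cmod (emb x - c))\<^sup>2" using w(2) by (intro power_strict_mono) auto
  moreover define W where "W = emb w - emb x"
  have "(cmod (emb w - c))\<^sup>2 = (cmod W)\<^sup>2 - 4 * (Re V * Im W - Im V * Re W) + (cmod (emb x - c))\<^sup>2"
  proof -
    have "emb w - c = W - 2 * \<i> * V" and "emb x - c = - (2 * \<i> * V)" by (simp_all add: c_def W_def)
    show ?thesis unfolding \<open>emb w - c = _\<close> \<open>emb x - c = _\<close>
      unfolding cmod_power2 by (simp add: power2_eq_square algebra_simps del: norm_minus_cancel norm_mult) 
  qed
  moreover have "Re V * Im W - Im V * Re W = sqrt 3 / 2 * of_int (det2 x y w)"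
    by (simp add: V_def W_def emb_def det2_def field_simps)
  ultimately have "(cmod W)\<^sup>2 < 2 * sqrt 3 * of_int (det2 x y w)" by simp
  hence "0 < 2 * sqrt 3 * real_of_int (det2 x y w)" using zero_le_power2 order.strict_trans1 by blast
  thus ?thesis using w by (auto simp: zero_less_mult_iff)
qed

section \<open>A generic perturbation of the norm\<close>

text \<open>Determinants of points with coordinates up to \<open>K\<close> are at most
  \<open>8 * (K * K)\<close>; the factor 100 keeps the sum of four error terms of this size times
  \<open>\<epsilon>\<close> below 1.\<close>

definition near_lift :: "pt set \<Rightarrow> (pt \<Rightarrow> real) \<Rightarrow> bool" where
  "near_lift X h \<longleftrightarrow> (\<exists>K \<epsilon>. 1 \<le> K \<and> 100 * of_int K * of_int K * \<epsilon> \<le> 1 \<and>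
     (\<forall>p\<in>X. \<bar>fst p\<bar> \<le> K \<and> \<bar>snd p\<bar> \<le> K \<and> 0 \<le> h p - of_int (qf p) \<and> h p - of_int (qf p) \<le> \<epsilon>))"

lemma det2_bound:
  assumes "\<And>p. p \<in> {x, y, z} \<Longrightarrow> \<bar>fst p\<bar> \<le> K \<and> \<bar>snd p\<bar> \<le> K"
  shows "\<bar>det2 x y z\<bar> \<le> 8 * (K * K)"
proof -
  have *: "\<bar>a * b\<bar> \<le> 4 * (K * K)" if "\<bar>a\<bar> \<le> 2 * K" "\<bar>b\<bar> \<le> 2 * K" for a b
    using mult_mono[OF that] that by (simp add: abs_mult)
  have "\<bar>fst y - fst x\<bar> \<le> 2 * K" "\<bar>snd z - snd x\<bar> \<le> 2 * K" "\<bar>snd y - snd x\<bar> \<le> 2 * K" "\<bar>fst z - fst x\<bar> \<le> 2 * K"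
    using assms[of x] assms[of y] assms[of z] unfolding abs_le_iff by auto
  from *[OF this(1,2)] *[OF this(3,4)]
  have "\<bar>(fst y - fst x) * (snd z - snd x)\<bar> \<le> 4 * (K * K)" "\<bar>(snd y - snd x) * (fst z - fst x)\<bar> \<le> 4 * (K * K)"
    by simp_all
  thus ?thesis unfolding det2_def abs_le_iff by auto
qed

text \<open>The empty circle property, exact in spite of the perturbation: the determinant is an
  integer and the support condition shows that it exceeds -1.\<close>

lemma cell_incircle:
  assumes nl: "near_lift X h" and c: "cell X h x y z" and w: "w \<in> X"
  shows "0 \<le> incircle x y z w"
proof -
  obtain K \<epsilon> where K: "1 \<le> K" "100 * of_int K * of_int K * \<epsilon> \<le> 1"
    and X: "\<And>p. p \<in> X \<Longrightarrow> \<bar>fst p\<bar> \<le> K \<and> \<bar>snd p\<bar> \<le> K"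
    and h: "\<And>p. p \<in> X \<Longrightarrow> 0 \<le> h p - of_int (qf p) \<and> h p - of_int (qf p) \<le> \<epsilon>"
    using nl unfolding near_lift_def by blast
  have xyz: "x \<in> X" "y \<in> X" "z \<in> X" using cell_in[OF c] by auto
  define \<eta> where "\<eta> p = h p - of_int (qf p)" for p
  define M where "M = 8 * real_of_int K * real_of_int K * \<epsilon>"
  have e0: "0 \<le> \<epsilon>" using h[OF w] by simp
  have d: "\<bar>of_int (det2 a b e) * \<eta> p\<bar> \<le> M" if "a \<in> X" "b \<in> X" "e \<in> X" "p \<in> X" for a b e p
  proof -
    have "\<bar>det2 a b e\<bar> \<le> 8 * (K * K)" using that X by (intro det2_bound) auto
    hence "\<bar>real_of_int (det2 a b e)\<bar> \<le> 8 * (of_int K * of_int K)"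
      by (metis of_int_abs of_int_le_iff of_int_mult of_int_numeral)
    moreover have "\<bar>\<eta> p\<bar> \<le> \<epsilon>" using h[OF that(4)] by (simp add: \<eta>_def)
    ultimately have "\<bar>real_of_int (det2 a b e)\<bar> * \<bar>\<eta> p\<bar> \<le> (8 * (of_int K * of_int K)) * \<epsilon>"
      using e0 by (intro mult_mono) auto
    thus ?thesis by (simp add: abs_mult M_def mult_ac)
  qed
  obtain l where l: "supports X h l {x, y, z}" and t: "det2 x y z > 0" using c by (auto simp: cell_def)
  have "of_int (det2 x y z) * ev l w \<le> of_int (det2 x y z) * h w"
    using supports_le[OF l w] t by simp
  hence "of_int (det2 w y z) * h x + of_int (det2 x w z) * h y + of_int (det2 x y w) * h z \<le> of_int (det2 x y z) * h w"
    using ev_barycentric[of x y z l w] l by (simp add: supports_def)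
  moreover have "h p = of_int (qf p) + \<eta> p" for p by (simp add: \<eta>_def)
  ultimately have "0 \<le> real_of_int (incircle x y z w) + (of_int (det2 x y z) * \<eta> w
      - of_int (det2 w y z) * \<eta> x - of_int (det2 x w z) * \<eta> y - of_int (det2 x y w) * \<eta> z)"
    unfolding incircle_lift by (simp add: algebra_simps)
  moreover have "100 * M \<le> 8" using K by (simp add: M_def mult_ac)
  ultimately have "real_of_int (incircle x y z w) > -1"
    using d[of x y z w] d[of w y z x] d[of x w z y] d[of x y w z] xyz w by (simp add: abs_le_iff)
  thus ?thesis by linarith
qed

text \<open>A larger circumcircle would contain a particle by \<open>saturated_hole\<close>, against
  the empty circle property. The constant is 3 * 85.\<close>

lemma cell_radius:
  assumes nl: "near_lift X h" and c: "cell X h x y z" and sat: "saturated X x"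
  shows "qf (y - z) * qf (z - x) * qf (x - y) \<le> 255 * (det2 x y z)\<^sup>2"
proof -
  have t: "det2 x y z > 0" using c by (simp add: cell_def)
  obtain c where c': "\<And>w. of_int (det2 x y z) * ((cmod (emb w - c))\<^sup>2 - (cmod (emb x - c))\<^sup>2) = of_int (incircle x y z w)"
    and r: "(cmod (emb x - c))\<^sup>2 * (3 * (of_int (det2 x y z))\<^sup>2) = of_int (qf (y - z) * qf (z - x) * qf (x - y))"
    by (rule circumcentre[OF t]) blast
  have "(cmod (emb x - c))\<^sup>2 \<le> 85"
  proof (rule ccontr)
    assume "\<not> ?thesis"
    hence "85 \<le> (cmod (c - emb x))\<^sup>2" by (simp add: norm_minus_commute)
    from saturated_hole[OF sat this] obtain w where w: "w \<in> X" "cmod (emb w - c) < cmod (emb x - c)"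
      by blast
    have "(cmod (emb w - c))\<^sup>2 < (cmod (emb x - c))\<^sup>2" using w(2) by (intro power_strict_mono) auto
    hence "real_of_int (incircle x y z w) < 0" unfolding c'[symmetric] using t by (simp add: mult_less_0_iff)
    thus False using cell_incircle[OF nl c w(1)] by simp
  qed
  hence "(cmod (emb x - c))\<^sup>2 * (3 * (real_of_int (det2 x y z))\<^sup>2) \<le> 85 * (3 * (of_int (det2 x y z))\<^sup>2)"
    by (intro mult_right_mono) auto
  hence "real_of_int (qf (y - z) * qf (z - x) * qf (x - y)) \<le> of_int (255 * (det2 x y z)\<^sup>2)" unfolding r by simp
  thus ?thesis by (simp only: of_int_le_iff)
qed

text \<open>Twice the scalar product in lattice coordinates, so that it is an integer; see
  \<open>pos_inner\<close>.\<close>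

definition bil :: "pt \<Rightarrow> pt \<Rightarrow> int" where
  "bil p q = 2 * fst p * fst q + 2 * snd p * snd q - fst p * snd q - snd p * fst q"

text \<open>If \<open>y\<close> is nearest to \<open>x\<close>, the disc with diameter
  \<open>x y\<close> contains no further point, and the power of every other point is at least 67 /
  2. This margin absorbs the perturbation. The lemma supplies a first edge at a vertex.\<close>

lemma nearest_edge:
  assumes fin: "finite X" and nl: "near_lift X h" and pk: "packed X" and x: "x \<in> X" "\<exists>w\<in>X. w \<noteq> x"
  shows "\<exists>y. edge X h x y"
proof -
  obtain K \<epsilon> where K: "1 \<le> K" "100 * of_int K * of_int K * \<epsilon> \<le> 1"
    and X: "\<And>p. p \<in> X \<Longrightarrow> \<bar>fst p\<bar> \<le> K \<and> \<bar>snd p\<bar> \<le> K"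
    and h: "\<And>p. p \<in> X \<Longrightarrow> 0 \<le> h p - of_int (qf p) \<and> h p - of_int (qf p) \<le> \<epsilon>"
    using nl unfolding near_lift_def by blast
  let ?f = "\<lambda>w. qf (w - x)"
  have S: "finite (X - {x})" "X - {x} \<noteq> {}" using fin x by auto
  have "Min (?f ` (X - {x})) \<in> ?f ` (X - {x})" using S by (intro Min_in) auto
  then obtain y where y: "y \<in> X - {x}" and ym: "Min (?f ` (X - {x})) = ?f y" by blast
  have min: "qf (y - x) \<le> qf (w - x)" if "w \<in> X - {x}" for w
    unfolding ym[symmetric] using S that by (intro Min_le) auto
  define \<eta> where "\<eta> p = h p - of_int (qf p)" for p
  define N where "N = real_of_int (2 * qf (y - x))"
  define d where "d = y - x"
  define \<kappa> where "\<kappa> = (\<eta> y - \<eta> x) / N"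
  have N67: "N \<ge> 134" using pk x y by (auto simp: N_def packed_def)
  have bqf: "2 * qf p = bil p p" for p by (simp add: qf_def bil_def power2_eq_square)
  \<comment> \<open>Up to the terms with \<open>\<eta>\<close> and \<open>\<kappa>\<close>,
    \<open>l\<close> is \<open>qf p\<close> minus the power of \<open>p\<close> with respect to the
    circle with diameter \<open>x y\<close>. These terms correct the values at \<open>x\<close> and
    \<open>y\<close> to those of \<open>h\<close>.\<close>
  define l :: "real \<times> real \<times> real" where
    "l = (of_int (2 * fst (x + y) - snd (x + y)) / 2 + \<kappa> * of_int (2 * fst d - snd d),
          of_int (2 * snd (x + y) - fst (x + y)) / 2 + \<kappa> * of_int (2 * snd d - fst d),
          - of_int (bil x y) / 2 + \<eta> x - \<kappa> * of_int (bil x d))"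
  have el: "ev l p = of_int (qf p) - of_int (bil (p - x) (p - y)) / 2 + \<eta> x + \<kappa> * of_int (bil (p - x) d)" for p
    by (simp add: ev_def l_def bil_def qf_def power2_eq_square field_simps)
  have exy: "ev l x = h x" "ev l y = h y"
  proof -
    show "ev l x = h x" by (simp add: el bil_def \<eta>_def)
    have "bil (y - x) d = 2 * qf (y - x)" by (simp add: bqf d_def)
    hence "\<kappa> * of_int (bil (y - x) d) = \<eta> y - \<eta> x" using N67 by (simp add: \<kappa>_def N_def)
    thus "ev l y = h y" by (simp add: el bil_def \<eta>_def)
  qed
  have "ev l w < h w" if w: "w \<in> X" "w \<noteq> x" "w \<noteq> y" for w
  proof -
    have "bil (w - x) (w - y) = qf (w - x) - qf (y - x) + qf (w - y)"
      by (simp add: bil_def qf_def power2_eq_square algebra_simps)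
    moreover have "67 \<le> qf (w - y)" using pk w y by (auto simp: packed_def)
    ultimately have 1: "67 \<le> bil (w - x) (w - y)" using min[of w] w by simp
    have *: "\<bar>a * b\<bar> \<le> 4 * (K * K)" if "\<bar>a\<bar> \<le> 2 * K" "\<bar>b\<bar> \<le> 2 * K" for a b
      using mult_mono[OF that] that by (simp add: abs_mult)
    have "\<bar>fst (w - x)\<bar> \<le> 2 * K" "\<bar>snd (w - x)\<bar> \<le> 2 * K" "\<bar>fst d\<bar> \<le> 2 * K" "\<bar>snd d\<bar> \<le> 2 * K"
      using X[OF w(1)] X[OF x(1)] X[of y] y unfolding abs_le_iff d_def by auto
    hence "\<bar>bil (w - x) d\<bar> \<le> 24 * (K * K)"
      using *[of "fst (w - x)" "fst d"] *[of "snd (w - x)" "snd d"] *[of "fst (w - x)" "snd d"] *[of "snd (w - x)" "fst d"]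
      unfolding bil_def abs_le_iff mult.assoc by auto
    hence 2: "\<bar>real_of_int (bil (w - x) d)\<bar> \<le> 24 * (of_int K * of_int K)"
      by (metis of_int_abs of_int_le_iff of_int_mult of_int_numeral)
    have e: "\<bar>\<eta> y - \<eta> x\<bar> \<le> \<epsilon>" "\<eta> x \<le> \<epsilon>" "0 \<le> \<epsilon>" "0 \<le> \<eta> w" using h[of x] h[of y] h[of w] x y w by (auto simp: \<eta>_def)
    have "\<bar>\<kappa>\<bar> \<le> \<epsilon>"
    proof -
      have "\<bar>\<eta> y - \<eta> x\<bar> / N \<le> \<epsilon> / 1" using e N67 by (intro frac_le) auto
      thus ?thesis using N67 by (simp add: \<kappa>_def)
    qed
    hence "\<bar>\<kappa>\<bar> * \<bar>real_of_int (bil (w - x) d)\<bar> \<le> \<epsilon> * (24 * (of_int K * of_int K))"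
      using 2 e by (intro mult_mono) auto
    hence 3: "\<kappa> * of_int (bil (w - x) d) \<le> 1" using K(2) by (simp add: abs_mult[symmetric] abs_le_iff mult_ac)
    have "1 * 1 \<le> real_of_int K * of_int K" using K(1) by (intro mult_mono) auto
    hence "\<epsilon> * 1 \<le> \<epsilon> * (real_of_int K * of_int K)" using e by (intro mult_left_mono) auto
    hence "\<epsilon> \<le> 1" using K(2) by (simp add: mult_ac)
    moreover have "h w = of_int (qf w) + \<eta> w" by (simp add: \<eta>_def)
    moreover have "67 \<le> real_of_int (bil (w - x) (w - y))" using 1 by linarith
    ultimately show ?thesis unfolding el using 3 e by linarith
  qed
  hence "supports X h l {x, y}" using exy x y by (auto simp: supports_def)
  thus ?thesis using y by (auto simp: edge_def)
qed

text \<open>Points are raised by \<open>\<epsilon>\<close> times distinct powers of a parameter.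
  Each forbidden coplanarity then is a polynomial equation in the parameter; the power belonging to
  \<open>w\<close> occurs only once in it, so the polynomial is nonzero. Finitely many roots are
  avoided.\<close>

lemma exists_generic_near_lift:
  assumes fin: "finite (X :: pt set)"
  obtains h where "near_lift X h" "generic X h"
proof -
  obtain i :: "pt \<Rightarrow> nat" where inj: "inj_on i X" using finite_imp_inj_to_nat_seg[OF fin] by blast
  define K where "K = (\<Sum>p\<in>X. \<bar>fst p\<bar> + \<bar>snd p\<bar>) + 1"
  have K1: "1 \<le> K" unfolding K_def by (simp add: sum_nonneg)
  have XK: "\<bar>fst p\<bar> \<le> K \<and> \<bar>snd p\<bar> \<le> K" if "p \<in> X" for p
    using member_le_sum[OF that, of "\<lambda>p. \<bar>fst p\<bar> + \<bar>snd p\<bar>"] fin by (auto simp: K_def)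
  define \<epsilon> where "\<epsilon> = 1 / (100 * real_of_int K * of_int K)"
  have e0: "\<epsilon> > 0" "100 * real_of_int K * of_int K * \<epsilon> \<le> 1" using K1 by (simp_all add: \<epsilon>_def)
  \<comment> \<open>The exponents start at 1, which leaves the constant term to the in-circle
    determinant of the unperturbed points.\<close>
  define P where "P = (\<lambda>(x, y, z, w). [:of_int (incircle x y z w):]
      + (smult (\<epsilon> * of_int (det2 x y z)) (monom 1 (Suc (i w)))
      - smult (\<epsilon> * of_int (det2 w y z)) (monom 1 (Suc (i x)))
      - smult (\<epsilon> * of_int (det2 x w z)) (monom 1 (Suc (i y)))
      - smult (\<epsilon> * of_int (det2 x y w)) (monom (1::real) (Suc (i z)))))"
  define Q where "Q = {(x, y, z, w). x \<in> X \<and> y \<in> X \<and> z \<in> X \<and> w \<in> X \<and> det2 x y z \<noteq> 0 \<and> w \<notin> {x, y, z}}"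
  have finQ: "finite Q"
    by (rule finite_subset[of _ "X \<times> X \<times> X \<times> X"]) (use fin in \<open>auto simp: Q_def\<close>)
  have P0: "P q \<noteq> 0" if "q \<in> Q" for q
  proof -
    obtain x y z w where q: "q = (x, y, z, w)" by (cases q)
    have "i w \<noteq> i x" "i w \<noteq> i y" "i w \<noteq> i z" "det2 x y z \<noteq> 0"
      using that inj unfolding q Q_def inj_on_def by auto
    hence "coeff (P q) (Suc (i w)) \<noteq> 0" using e0 by (simp add: q P_def)
    thus ?thesis by auto
  qed
  have "finite (\<Union>q\<in>Q. {\<tau>. poly (P q) \<tau> = 0})" using finQ P0 by (intro finite_UN_I poly_roots_finite) auto
  moreover have "infinite {0<..<1::real}" by (simp add: infinite_Ioo)
  ultimately obtain \<tau> where \<tau>: "\<tau> \<in> {0<..<1}" "\<tau> \<notin> (\<Union>q\<in>Q. {\<tau>. poly (P q) \<tau> = 0})"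
    by (meson finite_subset subsetI)
  define h where "h p = of_int (qf p) + \<epsilon> * \<tau> ^ Suc (i p)" for p
  have "near_lift X h" unfolding near_lift_def
  proof (intro exI conjI ballI)
    fix p assume p: "p \<in> X"
    have "\<tau> ^ Suc (i p) \<le> 1" using \<tau>(1) by (intro power_le_one) auto
    thus "h p - of_int (qf p) \<le> \<epsilon>" "0 \<le> h p - of_int (qf p)" using e0 \<tau>(1) by (auto simp: h_def mult_left_le)
  qed (use K1 e0 XK in auto)
  moreover have "generic X h" unfolding generic_def
  proof (intro ballI impI notI)
    fix x y z w assume a: "x \<in> X" "y \<in> X" "z \<in> X" "w \<in> X" "det2 x y z \<noteq> 0" "w \<notin> {x, y, z}"
      "\<exists>l. \<forall>p\<in>{x, y, z, w}. ev l p = h p"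
    then obtain l where l: "ev l x = h x" "ev l y = h y" "ev l z = h z" "ev l w = h w" by blast
    have "of_int (det2 x y z) * h w = of_int (det2 w y z) * h x + of_int (det2 x w z) * h y + of_int (det2 x y w) * h z"
      using ev_barycentric[of x y z l w] l by simp
    hence "poly (P (x, y, z, w)) \<tau> = 0"
      unfolding P_def by (simp add: h_def incircle_lift poly_monom algebra_simps)
    moreover have "(x, y, z, w) \<in> Q" using a by (auto simp: Q_def)
    ultimately show False using \<tau>(2) by blast
  qed
  ultimately show ?thesis by (rule that)
qed

section \<open>Discharging\<close>

text \<open>Divided by both determinants, the right side is sqrt 3 times the sum of the cotangents
  of the angles at \<open>z\<close> and \<open>w\<close>. Its sign thus expresses the Delaunay
  condition that these angles sum to at most 180 degrees.\<close>

lemma incircle_power: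
  "2 * incircle x y z w =
     (qf (y - z) + qf (z - x) - qf (x - y)) * det2 y x w + (qf (x - w) + qf (w - y) - qf (x - y)) * det2 x y z"
  unfolding incircle_def qf_def det2_def fst_diff snd_diff by algebra

abbreviation colour :: "pt \<Rightarrow> int" where
  "colour p \<equiv> (fst p + snd p) mod 3"

lemma qf_minus: "qf (p - q) = qf (q - p)"
  by (simp add: qf_def power2_eq_square algebra_simps)

lemma qf_mod3: "qf (p - q) mod 3 = 0 \<longleftrightarrow> colour p = colour q"
proof -
  define m n where "m = fst p - fst q" and "n = snd p - snd q"
  have "qf (p - q) = (m + n) * (m + n) - 3 * (m * n)"
    by (simp add: qf_def m_def n_def power2_eq_square algebra_simps)
  hence "qf (p - q) mod 3 = 0 \<longleftrightarrow> 3 dvd (m + n) * (m + n)" by (simp add: mod_eq_0_iff_dvd dvd_diff_left_iff)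
  also have "\<dots> \<longleftrightarrow> 3 dvd (m + n)" by (simp add: prime_dvd_mult_iff)
  also have "m + n = (fst p + snd p) - (fst q + snd q)" by (simp add: m_def n_def)
  also have "3 dvd \<dots> \<longleftrightarrow> colour p = colour q" by (simp add: mod_eq_dvd_iff)
  finally show ?thesis .
qed

lemma colour_coincidence:
  assumes "hex x" "hex y" "hex z"
  shows "qf (y - z) * qf (z - x) * qf (x - y) mod 3 = 0"
proof -
  have "colour p = 1 \<or> colour p = 2" if "hex p" for p
    using that unfolding hex_def by presburger
  hence "colour y = colour z \<or> colour z = colour x \<or> colour x = colour y" using assms by metis
  hence "qf (y - z) mod 3 = 0 \<or> qf (z - x) mod 3 = 0 \<or> qf (x - y) mod 3 = 0" by (simp only: qf_mod3)
  thus ?thesis by (auto simp: mod_eq_0_iff_dvd)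
qed

lemma det2_mod3:
  assumes "colour x = colour y"
  obtains k where "det2 x y z = (fst y - fst x) * ((fst z + snd z) - (fst x + snd x)) + 3 * k"
proof -
  have "3 dvd (fst y + snd y) - (fst x + snd x)" using assms by (metis mod_eq_dvd_iff)
  then obtain k where k: "(fst y + snd y) - (fst x + snd x) = 3 * k" by blast
  hence s: "snd y - snd x = 3 * k - (fst y - fst x)" by linarith
  have "det2 x y z = (fst y - fst x) * ((fst z + snd z) - (fst x + snd x)) + 3 * (- k * (fst z - fst x))"
    unfolding det2_def s by (simp add: algebra_simps)
  thus ?thesis by (rule that)
qed

lemma det2_mono_mod3:
  assumes "colour x = colour y" "colour z = colour x"
  shows "det2 x y z mod 3 = 0"
proof -
  obtain k where k: "det2 x y z = (fst y - fst x) * ((fst z + snd z) - (fst x + snd x)) + 3 * k"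
    using det2_mod3[OF assms(1)] .
  have "3 dvd (fst z + snd z) - (fst x + snd x)" using assms(2) by (metis mod_eq_dvd_iff)
  thus ?thesis unfolding k by (simp add: mod_eq_0_iff_dvd)
qed

lemma det2_pair_mod3:
  assumes "colour x = colour y" "colour z = colour w"
  shows "(det2 x y z + det2 y x w) mod 3 = 0"
proof -
  obtain k where k: "det2 x y z = (fst y - fst x) * ((fst z + snd z) - (fst x + snd x)) + 3 * k"
    using det2_mod3[OF assms(1)] .
  obtain j where j: "det2 x y w = (fst y - fst x) * ((fst w + snd w) - (fst x + snd x)) + 3 * j"
    using det2_mod3[OF assms(1)] .
  have "det2 x y z + det2 y x w = (fst y - fst x) * ((fst z + snd z) - (fst w + snd w)) + 3 * (k - j)"
    unfolding det2_swap[of y x w] k j by (simp add: algebra_simps)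
  moreover have "3 dvd (fst z + snd z) - (fst w + snd w)" using assms(2) by (metis mod_eq_dvd_iff)
  ultimately show ?thesis by (simp add: mod_eq_0_iff_dvd)
qed

text \<open>By Heron's formula the condition \<open>qf (y - z) * qf (z - x) * qf (x - y) \<le> 255 * (det2 x y z)\<^sup>2\<close>
  says that the squared circumradius is at most 85.\<close>

definition small_triangle :: "pt \<Rightarrow> pt \<Rightarrow> pt \<Rightarrow> bool" where
  "small_triangle x y z \<longleftrightarrow> hex x \<and> hex y \<and> hex z \<and> 67 \<le> qf (x - y) \<and> 67 \<le> qf (y - z) \<and> 67 \<le> qf (z - x) \<and>
     0 < det2 x y z \<and> qf (y - z) * qf (z - x) * qf (x - y) \<le> 255 * (det2 x y z)\<^sup>2"

lemma small_triangle_rot: "small_triangle x y z \<Longrightarrow> small_triangle y z x"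
  by (auto simp: small_triangle_def det2_rot mult_ac)

lemma bad_types:
  assumes s: "small_triangle x y z" and t: "det2 x y z < 75"
    and le: "qf (y - z) \<le> qf (x - y)" "qf (z - x) \<le> qf (x - y)"
  shows "(det2 x y z, qf (y - z), qf (z - x), qf (x - y)) \<in>
    {(67, 67, 67, 201), (73, 73, 73, 219), (74, 67, 73, 84), (74, 73, 67, 84), (74, 67, 84, 229), (74, 84, 67, 229)}"
proof (cases "qf (y - z) \<le> qf (z - x)")
  case True
  have "(det2 x y z, qf (y - z), qf (z - x), qf (x - y)) \<in>
    {(67, 67, 67, 201), (73, 73, 73, 219), (74, 67, 73, 84), (74, 67, 84, 229)}"
    by (rule small_triangle_types)
      (use s t le True heron_det[of y z x] colour_coincidence[of x y z] in \<open>auto simp: small_triangle_def norm_like_qf\<close>)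
  thus ?thesis by auto
next
  case False
  have "(det2 x y z, qf (z - x), qf (y - z), qf (x - y)) \<in>
    {(67, 67, 67, 201), (73, 73, 73, 219), (74, 67, 73, 84), (74, 67, 84, 229)}"
    by (rule small_triangle_types)
      (use s t le False heron_det[of y z x] colour_coincidence[of x y z] in
        \<open>auto simp: small_triangle_def norm_like_qf mult_ac add_ac\<close>)
  thus ?thesis by auto
qed

text \<open>Applied to a side with \<open>qf (x - y) = 84\<close>, where 74 remains as the only
  determinant below 75.\<close>

lemma bad_dets:
  assumes s: "small_triangle x y z" and t: "det2 x y z < 75"
  shows "det2 x y z = 67 \<and> qf (x - y) \<noteq> 84 \<or> det2 x y z = 73 \<and> qf (x - y) \<noteq> 84 \<or> det2 x y z = 74"
proof -
  consider "qf (y - z) \<le> qf (x - y)" "qf (z - x) \<le> qf (x - y)"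
    | "qf (x - y) \<le> qf (y - z)" "qf (z - x) \<le> qf (y - z)"
    | "qf (x - y) \<le> qf (z - x)" "qf (y - z) \<le> qf (z - x)" by linarith
  thus ?thesis
  proof cases
    case 1 thus ?thesis using bad_types[OF s t] by auto
  next
    case 2
    have "det2 y z x < 75" using t by (simp add: det2_rot)
    from bad_types[OF small_triangle_rot[OF s] this] 2 show ?thesis by (auto simp: det2_rot)
  next
    case 3
    have "det2 z x y < 75" using t by (simp add: det2_rot)
    from bad_types[OF small_triangle_rot[OF small_triangle_rot[OF s]] this] 3
    show ?thesis by (auto simp: det2_rot)
  qed
qed

text \<open>The strict inequalities book the shortfall on a single side. Every type in
  \<open>bad_types\<close> has a strictly longest side, so nothing is lost.\<close>

definition deficit :: "pt \<Rightarrow> pt \<Rightarrow> pt \<Rightarrow> int" where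
  "deficit x y z = (if det2 x y z < 75 \<and> qf (y - z) < qf (x - y) \<and> qf (z - x) < qf (x - y)
     then 75 - det2 x y z else 0)"

lemma deficit_sum:
  assumes s: "small_triangle x y z" and t: "det2 x y z < 75"
  shows "deficit x y z + deficit y z x + deficit z x y = 75 - det2 x y z"
proof -
  have main: "deficit x y z + deficit y z x + deficit z x y = 75 - det2 x y z"
    if s: "small_triangle x y z" and t: "det2 x y z < 75"
      and m: "qf (y - z) \<le> qf (x - y)" "qf (z - x) \<le> qf (x - y)" for x y z
    using bad_types[OF s t m] by (auto simp: deficit_def det2_rot)
  consider "qf (y - z) \<le> qf (x - y)" "qf (z - x) \<le> qf (x - y)"
    | "qf (x - y) \<le> qf (y - z)" "qf (z - x) \<le> qf (y - z)"
    | "qf (x - y) \<le> qf (z - x)" "qf (y - z) \<le> qf (z - x)" by linarith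
  thus ?thesis
  proof cases
    case 1 thus ?thesis using main[OF s t] by auto
  next
    case 2
    have "det2 y z x < 75" using t by (simp add: det2_rot)
    from main[OF small_triangle_rot[OF s] this] 2 show ?thesis by (auto simp: det2_rot)
  next
    case 3
    have "det2 z x y < 75" using t by (simp add: det2_rot)
    from main[OF small_triangle_rot[OF small_triangle_rot[OF s]] this] 3
    show ?thesis by (auto simp: det2_rot)
  qed
qed

lemma deficit_nonneg: "0 \<le> deficit x y z"
  by (simp add: deficit_def)

text \<open>In the types with longest side 201, 219 or 229 the angle opposite that side is at least
  120 degrees. The Delaunay condition therefore limits the angle of the neighbour to 60 degrees,
  which is the situation of \<open>long_edge_neighbour\<close>. The bound 8 is 75 - 67.\<close>

lemma neighbour_of_deficit:
  assumes T: "small_triangle x y z" and d: "deficit x y z \<noteq> 0"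
    and N: "small_triangle y x w" and inc: "0 \<le> incircle x y z w"
  shows "deficit x y z \<le> 8 \<and> 114 \<le> det2 y x w \<or>
    deficit x y z = 1 \<and> 76 \<le> det2 y x w \<and> colour x = colour y \<and> (colour w = colour x \<longrightarrow> 78 \<le> det2 y x w)"
proof -
  have t: "det2 x y z < 75" and le: "qf (y - z) \<le> qf (x - y)" "qf (z - x) \<le> qf (x - y)"
    and dd: "deficit x y z = 75 - det2 x y z"
    using d by (auto simp: deficit_def split: if_splits)
  have hexes: "hex x" "hex y" "hex z" "hex w" using T N by (auto simp: small_triangle_def)
  have c12: "colour p = 1 \<or> colour p = 2" if "hex p" for p
    using that unfolding hex_def by presburger
  define tN where "tN = det2 y x w"
  define a b c where "a = qf (x - w)" and "b = qf (w - y)" and "c = qf (x - y)"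
  have N': "67 \<le> a" "67 \<le> b" "0 < tN" "a * b * c \<le> 255 * tN\<^sup>2" "4 * a * b - (a + b - c)\<^sup>2 = 3 * tN\<^sup>2"
    using N heron_det[of x w y] by (auto simp: small_triangle_def a_def b_def c_def tN_def qf_minus[of y x] det2_rot)
  have pw: "0 \<le> (qf (y - z) + qf (z - x) - c) * tN + (a + b - c) * det2 x y z"
    using inc incircle_power[of x y z w] by (simp add: a_def b_def c_def tN_def)
  note cases = bad_types[OF T t le, folded c_def]
  show ?thesis
  proof (cases "c = 84")
    case False
    have "201 \<le> c" using cases False by auto
    \<comment> \<open>All types other than 84 satisfy
      \<open>qf (y - z) + qf (z - x) - c \<le> - det2 x y z\<close>, with equality in the first two;
      inserting this in \<open>pw\<close> and cancelling the determinant gives the claim.\<close>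
    moreover have "tN \<le> a + b - c" using cases pw False N' by auto
    ultimately have "114 \<le> tN" using long_edge_neighbour[of a b c tN] N' by simp
    moreover have "deficit x y z \<le> 8" using dd cases by auto
    ultimately show ?thesis by (simp add: tN_def)
  next
    case True
    have t74: "det2 x y z = 74" and e: "qf (z - x) = 67 \<or> qf (z - x) = 73" using cases True by auto
    have xy: "colour x = colour y" using True qf_mod3[of x y] by (simp add: c_def)
    have zx: "colour z \<noteq> colour x" using e qf_mod3[of z x] by auto
    have bad: "tN = 74" if "tN < 75"
      using bad_dets[OF N] that True by (auto simp: tN_def c_def qf_minus[of y x])
    show ?thesis
    proof (cases "colour w = colour x")
      case mono: True
      have m: "tN mod 3 = 0" using det2_mono_mod3[of y x w] xy mono by (simp add: tN_def)
      have "tN \<noteq> 75"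
      proof
        assume "tN = 75"
        moreover have "a mod 3 = 0" "b mod 3 = 0" using xy mono by (simp_all only: a_def b_def qf_mod3)
        ultimately show False using mono_edge_84[of a b] N' True by auto
      qed
      moreover have "tN \<noteq> 76" "tN \<noteq> 77" "tN \<noteq> 74" using m by auto
      ultimately have "78 \<le> tN" using bad by linarith
      thus ?thesis using dd t74 xy by (simp add: tN_def)
    next
      case False
      have "colour z = colour w" using zx False c12 hexes by metis
      hence "(74 + tN) mod 3 = 0" using det2_pair_mod3[OF xy, of z w] t74 by (simp add: tN_def)
      hence "tN \<noteq> 74" "tN \<noteq> 75" by auto
      hence "76 \<le> tN" using bad by linarith
      thus ?thesis using dd t74 xy False by (simp add: tN_def)
    qed
  qed
qed

text \<open>A charge of 1 comes through a side with end points of one colour, so two such charges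
  force the triangle to be of a single colour.\<close>

lemma surplus_covers:
  assumes N: "small_triangle x y z"
    and cases: "\<And>u v w d. (u, v, w, d) \<in> {(x, y, z, d1), (y, z, x, d2), (z, x, y, d3)} \<Longrightarrow> d = 0 \<or>
      d \<le> 8 \<and> 114 \<le> det2 x y z \<or>
      d = 1 \<and> 76 \<le> det2 x y z \<and> colour v = colour u \<and> (colour w = colour v \<longrightarrow> 78 \<le> det2 x y z)"
    and nn: "0 \<le> d1" "0 \<le> d2" "0 \<le> d3"
  shows "if det2 x y z < 75 then d1 = 0 \<and> d2 = 0 \<and> d3 = 0 else d1 + d2 + d3 \<le> det2 x y z - 75"
proof (cases "114 \<le> det2 x y z")
  case True
  have "d1 \<le> 8" using cases[of x y z d1] by auto
  moreover have "d2 \<le> 8" using cases[of y z x d2] by auto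
  moreover have "d3 \<le> 8" using cases[of z x y d3] by auto
  \<comment> \<open>Three charges of at most 8 are well within the surplus 114 - 75 = 39.\<close>
  ultimately show ?thesis using True by simp
next
  case False
  have 1: "d1 = 0 \<or> d1 = 1 \<and> 76 \<le> det2 x y z \<and> colour y = colour x \<and> (colour z = colour y \<longrightarrow> 78 \<le> det2 x y z)"
    using cases[of x y z d1] False by blast
  have 2: "d2 = 0 \<or> d2 = 1 \<and> 76 \<le> det2 x y z \<and> colour z = colour y \<and> (colour x = colour z \<longrightarrow> 78 \<le> det2 x y z)"
    using cases[of y z x d2] False by blast
  have 3: "d3 = 0 \<or> d3 = 1 \<and> 76 \<le> det2 x y z \<and> colour x = colour z \<and> (colour y = colour x \<longrightarrow> 78 \<le> det2 x y z)"
    using cases[of z x y d3] False by blast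
  show ?thesis using 1 2 3
    by (elim disjE conjE; simp only:; simp)
qed

text \<open>A side is at most the diameter of the circumcircle, and 340 = 4 * 85.\<close>

lemma small_edge:
  assumes "small_triangle x y z"
  shows "qf (x - y) \<le> 340"
proof -
  define a b c where "a = qf (y - z)" and "b = qf (z - x)" and "c = qf (x - y)"
  have "67 \<le> a" "67 \<le> b" "a * b * c \<le> 255 * (det2 x y z)\<^sup>2" using assms by (auto simp: small_triangle_def a_def b_def c_def)
  moreover have "3 * (det2 x y z)\<^sup>2 = 4 * (a * b) - (a + b - c)\<^sup>2" using heron_det[of y z x] by (simp add: a_def b_def c_def)
  hence "3 * (det2 x y z)\<^sup>2 \<le> 4 * (a * b)" using zero_le_power2[of "a + b - c"] by linarith
  ultimately have "(a * b) * c \<le> (a * b) * 340" by linarith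
  moreover have "0 < a * b" using \<open>67 \<le> a\<close> \<open>67 \<le> b\<close> by simp
  ultimately show ?thesis unfolding c_def[symmetric] by (rule mult_left_le_imp_le)
qed

section \<open>Ordered triangles up to rotation\<close>

fun rot :: "pt \<times> pt \<times> pt \<Rightarrow> pt \<times> pt \<times> pt" where
  "rot (x, y, z) = (y, z, x)"

text \<open>Cells are ordered triples, so a geometric triangle is counted three times. In exchange,
  sums over sides become sums of a function of the first two vertices.\<close>

definition rot_closed :: "(pt \<times> pt \<times> pt) set \<Rightarrow> bool" where
  "rot_closed C \<longleftrightarrow> (\<forall>x y z. (x, y, z) \<in> C \<longrightarrow> (y, z, x) \<in> C)"

lemma rot_bij:
  assumes "rot_closed C"
  shows "bij_betw rot C C"
proof -
  have "inj_on rot C" by (auto simp: inj_on_def)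
  moreover have "rot ` C = C"
  proof
    show "rot ` C \<subseteq> C" using assms by (auto simp: rot_closed_def)
    show "C \<subseteq> rot ` C"
    proof
      fix c assume c: "c \<in> C"
      obtain x y z where xyz: "c = (x, y, z)" by (cases c)
      hence "(z, x, y) \<in> C" using c assms unfolding rot_closed_def by blast
      moreover have "c = rot (z, x, y)" using xyz by simp
      ultimately show "c \<in> rot ` C" by blast
    qed
  qed
  ultimately show ?thesis by (simp add: bij_betw_def)
qed

lemma sum_rot:
  fixes f :: "pt \<Rightarrow> pt \<Rightarrow> pt \<Rightarrow> 'a :: comm_monoid_add"
  assumes "rot_closed C"
  shows "(\<Sum>(x, y, z)\<in>C. f y z x) = (\<Sum>(x, y, z)\<in>C. f x y z)"
proof -
  have "(\<Sum>(x, y, z)\<in>C. f x y z) = (\<Sum>c\<in>C. (\<lambda>(x, y, z). f x y z) (rot c))"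
    by (rule sum.reindex_bij_betw[OF rot_bij[OF assms], symmetric])
  also have "\<dots> = (\<Sum>(x, y, z)\<in>C. f y z x)" by (intro sum.cong) auto
  finally show ?thesis by simp
qed

lemma sum_rot3:
  fixes f :: "pt \<Rightarrow> pt \<Rightarrow> pt \<Rightarrow> 'a :: comm_semiring_1"
  assumes "rot_closed C"
  shows "(\<Sum>(x, y, z)\<in>C. f x y z + f y z x + f z x y) = 3 * (\<Sum>(x, y, z)\<in>C. f x y z)"
proof -
  have "(\<Sum>(x, y, z)\<in>C. f z x y) = (\<Sum>(x, y, z)\<in>C. f y z x)"
    by (rule sum_rot[OF assms, symmetric, of "\<lambda>x y z. f y z x", symmetric])
  also note sum_rot[OF assms, of f]
  finally have 2: "(\<Sum>(x, y, z)\<in>C. f z x y) = (\<Sum>(x, y, z)\<in>C. f x y z)" .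
  have "(\<Sum>(x, y, z)\<in>C. f x y z + f y z x + f z x y)
     = (\<Sum>(x, y, z)\<in>C. f x y z) + (\<Sum>(x, y, z)\<in>C. f y z x) + (\<Sum>(x, y, z)\<in>C. f z x y)"
    by (simp add: split_beta sum.distrib)
  also have "\<dots> = 3 * (\<Sum>(x, y, z)\<in>C. f x y z)" unfolding sum_rot[OF assms, of f] 2
    by (simp only: numeral.simps distrib_right mult_1_left)
  finally show ?thesis .
qed

text \<open>\<open>P0\<close> contains the points to be counted and \<open>X\<close> is the
  completed packing. Saturation reaches as far as the largest circumdiameter from \<open>P0\<close>,
  so it holds at every vertex of a cell that touches \<open>P0\<close>.\<close>

locale delaunay =
  fixes X :: "pt set" and h :: "pt \<Rightarrow> real" and P0 :: "pt set"
  assumes fin: "finite X" and gen: "generic X h" and nl: "near_lift X h" and pk: "packed X"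
    and P0X: "P0 \<subseteq> X"
    and sat: "\<And>p q. p \<in> P0 \<Longrightarrow> q \<in> X \<Longrightarrow> qf (p - q) \<le> 340 \<Longrightarrow> saturated X q"
begin

text \<open>\<open>C0\<close> holds the cells that must contribute 75 on average. \<open>C1\<close>
  holds all cells with the circumradius bound; besides \<open>C0\<close> it contains the neighbours
  that receive charges from it.\<close>

definition C1 where "C1 = {(x, y, z). cell X h x y z \<and> small_triangle x y z}"
definition C0 where "C0 = {(x, y, z). cell X h x y z \<and> (x \<in> P0 \<or> y \<in> P0 \<or> z \<in> P0)}"

lemma C1_iff: "(x, y, z) \<in> C1 \<longleftrightarrow> cell X h x y z \<and> small_triangle x y z"
  by (simp add: C1_def)

lemma C0_iff: "(x, y, z) \<in> C0 \<longleftrightarrow> cell X h x y z \<and> (x \<in> P0 \<or> y \<in> P0 \<or> z \<in> P0)"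
  by (simp add: C0_def)

lemma cell_small:
  assumes c: "cell X h x y z" and "saturated X x"
  shows "small_triangle x y z"
proof -
  have "0 < det2 x y z" using c by (simp add: cell_def)
  thus ?thesis using cell_radius[OF nl assms] cell_in[OF c] cell_distinct[OF c] pk
    unfolding small_triangle_def packed_def by auto
qed

lemma sat0: "p \<in> P0 \<Longrightarrow> saturated X p"
  using sat[of p p] P0X by (auto simp: qf_def)

lemma C0_small:
  assumes "(x, y, z) \<in> C0"
  shows "small_triangle x y z"
proof -
  have c: "cell X h x y z" using assms by (simp add: C0_iff)
  consider "x \<in> P0" | "y \<in> P0" | "z \<in> P0" using assms by (auto simp: C0_iff)
  thus ?thesis
  proof cases
    case 1 thus ?thesis using cell_small[OF c sat0] by simp
  next
    case 2
    have "small_triangle y z x" using cell_small[OF cell_rot[OF c] sat0[OF 2]] .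
    thus ?thesis using small_triangle_rot by blast
  next
    case 3
    have "small_triangle z x y" using cell_small[OF cell_rot[OF cell_rot[OF c]] sat0[OF 3]] .
    thus ?thesis using small_triangle_rot by blast
  qed
qed

lemma C0_sub: "C0 \<subseteq> C1"
  using C0_small by (auto simp: C0_def C1_def)

lemma rot_closed_C0: "rot_closed C0"
  unfolding rot_closed_def C0_iff using cell_rot by blast

lemma rot_closed_C1: "rot_closed C1"
  unfolding rot_closed_def C1_iff using cell_rot small_triangle_rot by blast

lemma finite_C1: "finite C1"
  by (rule finite_subset[of _ "X \<times> X \<times> X"]) (use fin cell_in in \<open>auto simp: C1_def\<close>)

lemma finite_C0: "finite C0"
  using finite_C1 C0_sub finite_subset by blast

lemma C0_saturated:
  assumes c: "(x, y, z) \<in> C0"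
  shows "saturated X x"
proof -
  have s: "small_triangle x y z" using C0_small[OF c] .
  have X: "x \<in> X" using c cell_in unfolding C0_iff by blast
  have "qf (x - y) \<le> 340" "qf (z - x) \<le> 340"
    using small_edge[OF s] small_edge[OF small_triangle_rot[OF small_triangle_rot[OF s]]] by auto
  thus ?thesis using c sat0[of x] sat[OF _ X, of y] sat[OF _ X, of z] by (auto simp: C0_iff qf_minus[of y x])
qed

text \<open>The end point \<open>y\<close> is saturated even when it lies outside \<open>P0\<close>.
  This gives a point beyond the side, hence a cell there, and one saturated vertex suffices for the
  circumradius bound.\<close>

lemma twin_exists:
  assumes c: "(x, y, z) \<in> C0"
  shows "\<exists>w. (y, x, w) \<in> C1"
proof -
  have cell: "cell X h x y z" using c by (simp add: C0_iff)
  have c': "(y, z, x) \<in> C0" using c rot_closed_C0 unfolding rot_closed_def by blast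
  have sy: "saturated X y" using C0_saturated[OF c'] .
  have "67 \<le> qf (y - x)" using C0_small[OF c] by (simp add: small_triangle_def qf_minus[of y x])
  then obtain w0 where "w0 \<in> X" "det2 y x w0 > 0" using saturated_left[OF sy] by blast
  with edge_cell[OF fin gen edge_sym[OF cell_edge[OF fin cell]]]
  obtain w where "cell X h y x w" by blast
  thus ?thesis using cell_small[OF _ sy] unfolding C1_iff by blast
qed

text \<open>At most one cell lies on the other side of \<open>x y\<close>, so this sum has at most one term.\<close>

definition charge :: "pt \<Rightarrow> pt \<Rightarrow> int" where
  "charge x y = (\<Sum>w\<in>{w. (y, x, w) \<in> C0}. deficit y x w)"

lemma charge_eq:
  assumes "(y, x, w) \<in> C0"
  shows "charge x y = deficit y x w"
proof -
  have "{w. (y, x, w) \<in> C0} = {w}" using assms cell_unique unfolding C0_iff by blast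
  thus ?thesis by (simp add: charge_def)
qed

lemma charge_cases: "charge x y = 0 \<or> (\<exists>w. (y, x, w) \<in> C0 \<and> charge x y = deficit y x w)"
proof (cases "\<exists>w. (y, x, w) \<in> C0")
  case True
  thus ?thesis using charge_eq by blast
next
  case False
  hence "{w. (y, x, w) \<in> C0} = {}" by blast
  thus ?thesis unfolding charge_def by simp
qed

lemma charge_nonneg: "0 \<le> charge x y"
  using charge_cases[of x y] deficit_nonneg by (metis order_refl)

lemma charge_bound:
  assumes c: "(x, y, z) \<in> C1"
  shows "charge x y = 0 \<or> charge x y \<le> 8 \<and> 114 \<le> det2 x y z \<or>
    charge x y = 1 \<and> 76 \<le> det2 x y z \<and> colour y = colour x \<and> (colour z = colour y \<longrightarrow> 78 \<le> det2 x y z)"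
proof (cases "charge x y = 0")
  case False
  then obtain w where w: "(y, x, w) \<in> C0" "charge x y = deficit y x w" using charge_cases by blast
  have "z \<in> X" using c cell_in unfolding C1_iff by blast
  hence "0 \<le> incircle y x w z" using cell_incircle[OF nl] w(1) unfolding C0_iff by blast
  from neighbour_of_deficit[OF C0_small[OF w(1)] _ _ this] False w c
  show ?thesis by (auto simp: C1_iff)
qed simp

text \<open>A cell below 75 pays no charge, and its own deficits fill the gap to 75; from 75 on, the
  surplus covers the charges.\<close>

lemma cell_balance:
  assumes c: "(x, y, z) \<in> C1"
  shows "(if (x, y, z) \<in> C0 then 75 else 0) + (charge x y + charge y z + charge z x)
    \<le> det2 x y z + (if (x, y, z) \<in> C0 then deficit x y z + deficit y z x + deficit z x y else 0)"
proof -
  have s: "small_triangle x y z" using c by (simp add: C1_iff)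
  have c2: "(y, z, x) \<in> C1" "(z, x, y) \<in> C1" using c rot_closed_C1 unfolding rot_closed_def by blast+
  have "if det2 x y z < 75 then charge x y = 0 \<and> charge y z = 0 \<and> charge z x = 0
     else charge x y + charge y z + charge z x \<le> det2 x y z - 75"
    by (rule surplus_covers[OF s])
      (use charge_bound[OF c] charge_bound[OF c2(1)] charge_bound[OF c2(2)] charge_nonneg in \<open>auto simp: det2_rot\<close>)
  moreover have "0 < det2 x y z" using s by (simp add: small_triangle_def)
  ultimately show ?thesis
    using deficit_sum[OF s] deficit_nonneg[of x y z] deficit_nonneg[of y z x] deficit_nonneg[of z x y]
    by (auto split: if_splits)
qed

text \<open>Each counted cell is sent to the cell beyond its first side. This is injective because
  the side and its orientation determine the cell, and the charge there equals the deficit.\<close>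

lemma deficit_le_charge: "(\<Sum>(x, y, z)\<in>C0. deficit x y z) \<le> (\<Sum>(x, y, z)\<in>C1. charge x y)"
proof -
  have "\<forall>c\<in>C0. \<exists>w. (fst (snd c), fst c, w) \<in> C1" using twin_exists by (metis prod.collapse)
  then obtain g where g: "\<And>c. c \<in> C0 \<Longrightarrow> (fst (snd c), fst c, g c) \<in> C1" by metis
  define G where "G c = (fst (snd c), fst c, g c)" for c :: "pt \<times> pt \<times> pt"
  have inj: "inj_on G C0"
  proof (rule inj_onI)
    fix c d assume "c \<in> C0" "d \<in> C0" "G c = G d"
    moreover obtain x y z x' y' z' where cd: "c = (x, y, z)" "d = (x', y', z')" by (cases c; cases d) blast
    ultimately have "cell X h x y z" "cell X h x y z'" "x = x'" "y = y'" by (simp_all add: G_def C0_iff)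
    thus "c = d" using cell_unique[of X h x y z z'] cd by simp
  qed
  have "(\<Sum>(x, y, z)\<in>C0. deficit x y z) = (\<Sum>c\<in>C0. (\<lambda>(x, y, z). charge x y) (G c))"
    by (rule sum.cong) (auto simp: G_def charge_eq)
  also have "\<dots> = (\<Sum>(x, y, z)\<in>G ` C0. charge x y)" using sum.reindex[OF inj, of "\<lambda>(x, y, z). charge x y"] by simp
  also have "\<dots> \<le> (\<Sum>(x, y, z)\<in>C1. charge x y)"
    by (rule sum_mono2[OF finite_C1]) (use g in \<open>auto simp: G_def charge_nonneg\<close>)
  finally show ?thesis .
qed

text \<open>In the sum of \<open>cell_balance\<close> over \<open>C1\<close> the rotations give both
  charges and deficits the factor 3, and by \<open>deficit_le_charge\<close> the deficits cancel
  against the charges.\<close>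

lemma discharging: "75 * int (card C0) \<le> (\<Sum>(x, y, z)\<in>C1. det2 x y z)"
proof -
  have "(\<Sum>(x, y, z)\<in>C1. (if (x, y, z) \<in> C0 then 75 else 0) + (charge x y + charge y z + charge z x))
    \<le> (\<Sum>(x, y, z)\<in>C1. det2 x y z + (if (x, y, z) \<in> C0 then deficit x y z + deficit y z x + deficit z x y else 0))"
    by (intro sum_mono) (simp only: split_paired_all prod.case cell_balance)
  moreover have "(\<Sum>(x, y, z)\<in>C1. (if (x, y, z) \<in> C0 then 75 else 0) + (charge x y + charge y z + charge z x))
    = 75 * int (card C0) + 3 * (\<Sum>(x, y, z)\<in>C1. charge x y)"
  proof -
    have "(\<Sum>(x, y, z)\<in>C1. (if (x, y, z) \<in> C0 then 75 else 0)) = (\<Sum>c\<in>C1. if c \<in> C0 then 75 else (0::int))"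
      by (intro sum.cong) auto
    also have "\<dots> = (\<Sum>c\<in>C0. 75)" using C0_sub finite_C1 by (simp add: sum.If_cases Int_absorb1)
    finally show ?thesis using sum_rot3[OF rot_closed_C1, of "\<lambda>x y z. charge x y"]
      by (simp add: split_beta sum.distrib)
  qed
  moreover have "(\<Sum>(x, y, z)\<in>C1. det2 x y z + (if (x, y, z) \<in> C0 then deficit x y z + deficit y z x + deficit z x y else 0))
    = (\<Sum>(x, y, z)\<in>C1. det2 x y z) + 3 * (\<Sum>(x, y, z)\<in>C0. deficit x y z)"
  proof -
    have "(\<Sum>(x, y, z)\<in>C1. (if (x, y, z) \<in> C0 then deficit x y z + deficit y z x + deficit z x y else 0))
       = (\<Sum>c\<in>C1. if c \<in> C0 then (\<lambda>(x, y, z). deficit x y z + deficit y z x + deficit z x y) c else 0)"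
      by (intro sum.cong) auto
    also have "\<dots> = (\<Sum>(x, y, z)\<in>C0. deficit x y z + deficit y z x + deficit z x y)"
      using C0_sub finite_C1 by (simp add: sum.If_cases Int_absorb1)
    finally show ?thesis using sum_rot3[OF rot_closed_C0, of deficit]
      by (simp add: split_beta sum.distrib)
  qed
  ultimately show ?thesis using deficit_le_charge by linarith
qed

end

section \<open>Angle sums\<close>

definition zpt :: "pt \<Rightarrow> complex" where
  "zpt p = Complex (of_int (fst p)) (of_int (snd p))"

definition dirq :: "pt \<Rightarrow> pt \<Rightarrow> pt \<Rightarrow> complex" where
  "dirq x y z = (zpt z - zpt x) / (zpt y - zpt x)"

text \<open>The angle at \<open>x\<close> in the coordinate plane, where the lattice is \<open>\<int>\<^sup>2\<close>.  Angle sums are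
  unaffected by this linear change of coordinates.\<close>

definition angle_at :: "pt \<Rightarrow> pt \<Rightarrow> pt \<Rightarrow> real" where
  "angle_at x y z = Arg (dirq x y z)"

lemma zpt_eq: "zpt p = zpt q \<longleftrightarrow> p = q"
  by (auto simp: zpt_def prod_eq_iff)

lemma dirq_Im:
  assumes "det2 x y z > 0"
  shows "Im (dirq x y z) > 0"
proof -
  have "Im (dirq x y z) = of_int (det2 x y z) / (cmod (zpt y - zpt x))\<^sup>2"
    by (simp add: dirq_def zpt_def det2_def Im_divide cmod_power2 algebra_simps)
  moreover have "zpt y - zpt x \<noteq> 0" using assms zpt_eq[of y x] by auto
  ultimately show ?thesis using assms by simp
qed

lemma angle_bounds:
  assumes "det2 x y z > 0"
  shows "0 < angle_at x y z" "angle_at x y z < pi"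
  using Arg_lt_pi[of "dirq x y z"] dirq_Im[OF assms] by (auto simp: angle_at_def)

lemma cis_angle:
  assumes "det2 x y z > 0"
  shows "cis (angle_at x y z) = sgn (dirq x y z)"
proof -
  have "dirq x y z \<noteq> 0" using dirq_Im[OF assms] by auto
  thus ?thesis by (simp add: angle_at_def cis_Arg)
qed

text \<open>The product of the three direction quotients is -1, so the sum is an odd multiple of pi;
  it lies strictly between 0 and 3 pi.\<close>

lemma triangle_angle_sum:
  assumes t: "det2 x y z > 0"
  shows "angle_at x y z + angle_at y z x + angle_at z x y = pi"
proof -
  let ?s = "angle_at x y z + angle_at y z x + angle_at z x y"
  have t2: "det2 y z x > 0" "det2 z x y > 0" using t by (simp_all add: det2_rot)
  have ne: "zpt x \<noteq> zpt y" "zpt y \<noteq> zpt z" "zpt z \<noteq> zpt x" using t zpt_eq by auto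
  have "dirq x y z * dirq y z x * dirq z x y = -1"
    using ne unfolding dirq_def by (simp add: divide_simps) (simp add: algebra_simps)
  moreover have "cis ?s = sgn (dirq x y z * dirq y z x * dirq z x y)"
    by (simp only: cis_mult[symmetric] cis_angle[OF t] cis_angle[OF t2(1)] cis_angle[OF t2(2)] sgn_mult)
  ultimately have "cis ?s = - 1" by simp
  hence "cos ?s = - 1" by (metis cis.sel(1) one_complex.sel(1) uminus_complex.sel(1))
  then obtain n :: int where n: "?s = (2 * of_int n + 1) * pi" using cos_eq_minus1 by blast
  have "0 < ?s" "?s < 3 * pi" using angle_bounds[OF t] angle_bounds[OF t2(1)] angle_bounds[OF t2(2)] by linarith+
  hence "0 < 2 * real_of_int n + 1" "2 * real_of_int n + 1 < 3" unfolding n by (auto simp: zero_less_mult_iff)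
  hence "n = 0" by linarith
  thus ?thesis using n by simp
qed

lemma cis_sum: "finite A \<Longrightarrow> cis (sum f A) = (\<Prod>a\<in>A. cis (f a))"
  by (induction A rule: finite_induct) (simp_all add: cis_mult[symmetric])

context delaunay
begin

text \<open>Passing from an edge at \<open>x\<close> to the other edge of the cell on its left
  permutes the edges at \<open>x\<close>. The product of the direction quotients along this
  permutation cancels to 1, so the positive angle sum is a multiple of 2 pi.\<close>

lemma vertex_angle_sum:
  assumes x: "x \<in> P0"
  shows "2 * pi \<le> (\<Sum>(y, z)\<in>{(y, z). cell X h x y z}. angle_at x y z)"
proof -
  have sx: "saturated X x" using sat0[OF x] .
  have xX: "x \<in> X" using x P0X by blast
  define N where "N = {y. edge X h x y}"
  have finN: "finite N" by (rule finite_subset[OF _ fin]) (use edge_in[of X h x] in \<open>auto simp: N_def\<close>)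
  \<comment> \<open>A hole of radius 10 is used only to find a second point of
    \<open>X\<close>.\<close>
  have "(cmod ((emb x + 10) - emb x))\<^sup>2 \<ge> 85" by simp
  from saturated_hole[OF sx this] obtain w where w: "w \<in> X" "cmod (emb w - (emb x + 10)) < cmod (emb x - (emb x + 10))"
    by blast
  hence "w \<noteq> x" by auto
  hence "N \<noteq> {}" using nearest_edge[OF fin nl pk xX] w by (auto simp: N_def)
  have ex: "\<exists>z. cell X h x y z" if "y \<in> N" for y
  proof -
    have e: "edge X h x y" using that by (simp add: N_def)
    hence "y \<in> X" "x \<noteq> y" using edge_in by (auto simp: edge_def)
    hence "67 \<le> qf (x - y)" using pk xX by (auto simp: packed_def)
    then obtain w0 where "w0 \<in> X" "det2 x y w0 > 0" using saturated_left[OF sx] by blast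
    thus ?thesis using edge_cell[OF fin gen e] by blast
  qed
  then obtain nx where nx: "\<And>y. y \<in> N \<Longrightarrow> cell X h x y (nx y)" by metis
  have nxN: "nx ` N \<subseteq> N"
  proof
    fix z assume "z \<in> nx ` N"
    then obtain y where "cell X h x y z" using nx by blast
    hence "edge X h z x" using cell_edge[OF fin cell_rot[OF cell_rot]] by blast
    thus "z \<in> N" using edge_sym by (auto simp: N_def)
  qed
  have inj: "inj_on nx N"
  proof (rule inj_onI)
    fix y y' assume "y \<in> N" "y' \<in> N" "nx y = nx y'"
    hence "cell X h (nx y) x y" "cell X h (nx y) x y'" using nx cell_rot by metis+
    thus "y = y'" by (rule cell_unique)
  qed
  have bij: "bij_betw nx N N" using inj nxN finN by (simp add: bij_betw_def endo_inj_surj)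
  have cells: "{(y, z). cell X h x y z} = (\<lambda>y. (y, nx y)) ` N" (is "?L = ?R")
  proof
    show "?R \<subseteq> ?L" using nx by auto
    show "?L \<subseteq> ?R"
    proof
      fix c assume "c \<in> ?L"
      then obtain y z where c: "c = (y, z)" "cell X h x y z" by blast
      hence y: "y \<in> N" using cell_edge[OF fin] by (simp add: N_def)
      hence "z = nx y" using cell_unique[OF c(2) nx] by blast
      thus "c \<in> ?R" using c y by blast
    qed
  qed
  have inj2: "inj_on (\<lambda>y. (y, nx y)) N" by (auto simp: inj_on_def)
  have eq: "(\<Sum>(y, z)\<in>{(y, z). cell X h x y z}. angle_at x y z) = (\<Sum>y\<in>N. angle_at x y (nx y))"
    unfolding cells sum.reindex[OF inj2] by simp
  have d: "det2 x y (nx y) > 0" if "y \<in> N" for y using nx[OF that] by (simp add: cell_def)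
  have pos: "0 < (\<Sum>y\<in>N. angle_at x y (nx y))"
    by (rule sum_pos[OF finN \<open>N \<noteq> {}\<close>]) (use angle_bounds d in blast)
  have ne: "zpt y - zpt x \<noteq> 0" if "y \<in> N" for y using that zpt_eq by (auto simp: N_def edge_def)
  have "cis (\<Sum>y\<in>N. angle_at x y (nx y)) = (\<Prod>y\<in>N. sgn (dirq x y (nx y)))"
    unfolding cis_sum[OF finN] by (intro prod.cong refl cis_angle d)
  also have "\<dots> = (\<Prod>y\<in>N. sgn (zpt (nx y) - zpt x) / sgn (zpt y - zpt x))"
    by (simp add: dirq_def sgn_divide)
  also have "\<dots> = (\<Prod>y\<in>N. sgn (zpt (nx y) - zpt x)) / (\<Prod>y\<in>N. sgn (zpt y - zpt x))"
    by (rule prod_dividef)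
  also have "(\<Prod>y\<in>N. sgn (zpt (nx y) - zpt x)) = (\<Prod>y\<in>N. sgn (zpt y - zpt x))"
    using prod.reindex_bij_betw[OF bij, of "\<lambda>y. sgn (zpt y - zpt x)"] by simp
  also have "(\<Prod>y\<in>N. sgn (zpt y - zpt x)) / (\<Prod>y\<in>N. sgn (zpt y - zpt x)) = 1"
    using finN ne by (simp add: sgn_zero_iff)
  finally have "cos (\<Sum>y\<in>N. angle_at x y (nx y)) = 1" by (metis cis.sel(1) one_complex.sel(1))
  then obtain n :: int where n: "(\<Sum>y\<in>N. angle_at x y (nx y)) = of_int n * 2 * pi"
    using cos_one_2pi_int by blast
  hence "0 < real_of_int n" using pos by (simp add: zero_less_mult_iff)
  hence "1 \<le> n" by simp
  hence "1 \<le> real_of_int n" by simp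
  hence "1 * (2 * pi) \<le> of_int n * (2 * pi)" by (intro mult_right_mono) auto
  thus ?thesis unfolding eq n by simp
qed

text \<open>Angles of at least 2 pi at each point of \<open>P0\<close>, against pi per triangle,
  give two triangles per point; the factor 6 counts their three rotations.\<close>

lemma card_cells: "6 * card P0 \<le> card C0"
proof -
  have nn: "0 \<le> angle_at x y z" if "(x, y, z) \<in> C0" for x y z
    using that angle_bounds(1)[of x y z] by (auto simp: C0_iff cell_def)
  have finP: "finite P0" using P0X fin finite_subset by blast
  have fincell: "finite {(y, z). cell X h x y z}" for x
    by (rule finite_subset[of _ "X \<times> X"]) (use fin cell_in[of X h x] in auto)
  have "2 * pi * card P0 \<le> (\<Sum>x\<in>P0. \<Sum>(y, z)\<in>{(y, z). cell X h x y z}. angle_at x y z)"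
    using sum_mono[of P0 "\<lambda>x. 2 * pi", OF vertex_angle_sum] by (simp add: mult_ac)
  also have "\<dots> = (\<Sum>(x, y, z)\<in>(SIGMA x:P0. {(y, z). cell X h x y z}). angle_at x y z)"
    using sum.Sigma[OF finP, of "\<lambda>x. {(y, z). cell X h x y z}" "\<lambda>x (y, z). angle_at x y z"] fincell
    by (simp add: split_beta)
  also have "\<dots> \<le> (\<Sum>(x, y, z)\<in>C0. angle_at x y z)"
    by (rule sum_mono2[OF finite_C0]) (use nn in \<open>auto simp: C0_iff\<close>)
  finally have "3 * (2 * pi * card P0) \<le> 3 * (\<Sum>(x, y, z)\<in>C0. angle_at x y z)" by simp
  also have "\<dots> = (\<Sum>(x, y, z)\<in>C0. angle_at x y z + angle_at y z x + angle_at z x y)"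
    by (rule sum_rot3[OF rot_closed_C0, symmetric])
  also have "\<dots> = (\<Sum>c\<in>C0. pi)"
    by (intro sum.cong refl) (auto simp: C0_def cell_def triangle_angle_sum)
  finally have "pi * (6 * real (card P0)) \<le> pi * real (card C0)" by (simp add: mult_ac)
  hence "6 * real (card P0) \<le> real (card C0)" by simp
  thus ?thesis by linarith
qed

end

section \<open>Area and density\<close>

text \<open>Coordinates with respect to \<open>e1\<close> and \<open>e2\<close>: areas become half
  determinants.\<close>

definition vpt :: "pt \<Rightarrow> real^2" where
  "vpt p = vector [of_int (fst p), of_int (snd p)]"

definition evr :: "real \<times> real \<times> real \<Rightarrow> real^2 \<Rightarrow> real" where
  "evr l v = fst l * v $ 1 + fst (snd l) * v $ 2 + snd (snd l)"

definition tri :: "pt \<times> pt \<times> pt \<Rightarrow> (real^2) set" where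
  "tri = (\<lambda>(x, y, z). convex hull {vpt x, vpt y, vpt z})"

lemma evr_vpt: "evr l (vpt p) = ev l p"
  by (simp add: evr_def ev_def vpt_def)

lemma evr_convex:
  assumes "u + v + w = 1"
  shows "evr l (u *\<^sub>R a + v *\<^sub>R b + w *\<^sub>R c) = u * evr l a + v * evr l b + w * evr l c"
proof -
  have "snd (snd l) = (u + v + w) * snd (snd l)" using assms by simp
  thus ?thesis by (simp add: evr_def algebra_simps)
qed

lemma measure_tri: "measure lebesgue (tri (x, y, z)) = \<bar>of_int (det2 x y z)\<bar> / 2"
proof -
  have "compact (tri (x, y, z))" unfolding tri_def prod.case by (intro compact_convex_hull finite_imp_compact) simp
  hence "tri (x, y, z) \<in> sets borel" by (intro borel_closed compact_imp_closed)
  hence "measure lebesgue (tri (x, y, z)) = measure lborel (tri (x, y, z))" by simp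
  also have "\<dots> = \<bar>of_int (det2 x y z)\<bar> / 2"
    unfolding tri_def prod.case content_triangle by (simp add: vpt_def det2_def abs_minus_commute mult_ac)
  finally show ?thesis .
qed

lemma tri_lmeasurable: "tri c \<in> lmeasurable"
  unfolding tri_def split_beta by (intro lmeasurable_compact compact_convex_hull finite_imp_compact) simp

text \<open>The plane of a cell meets the lift at the vertices, where every supporting plane is at
  most as high; convexity extends the comparison to the triangle.\<close>

lemma tri_support_le:
  assumes l: "supports X h l {x, y, z}" and l': "supports X h l' {x', y', z'}"
    and v: "v \<in> tri (x, y, z)"
  shows "evr l' v \<le> evr l v"
proof -
  obtain a b c where abc: "0 \<le> a" "0 \<le> b" "0 \<le> c" "a + b + c = 1" "v = a *\<^sub>R vpt x + b *\<^sub>R vpt y + c *\<^sub>R vpt z"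
    using v by (auto simp: tri_def convex_hull_3)
  have X: "x \<in> X" "y \<in> X" "z \<in> X" using l by (auto simp: supports_def)
  have eq: "ev l x = h x" "ev l y = h y" "ev l z = h z" using l by (auto simp: supports_def)
  have "a * ev l' x + b * ev l' y + c * ev l' z \<le> a * ev l x + b * ev l y + c * ev l z"
    unfolding eq using abc supports_le[OF l' X(1)] supports_le[OF l' X(2)] supports_le[OF l' X(3)]
    by (intro add_mono mult_left_mono)
  thus ?thesis using abc by (simp add: evr_convex evr_vpt)
qed

text \<open>By \<open>tri_support_le\<close> in both directions the two affine functions agree on
  the overlap. They differ, so they agree at most along a line.\<close>

lemma cells_overlap_negligible:
  assumes c: "cell X h x y z" and c': "cell X h x' y' z'" and ne: "{x, y, z} \<noteq> {x', y', z'}"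
  shows "negligible (tri (x, y, z) \<inter> tri (x', y', z'))"
proof -
  obtain l where l: "supports X h l {x, y, z}" and d: "det2 x y z > 0" using c by (auto simp: cell_def)
  obtain l' where l': "supports X h l' {x', y', z'}" and d': "det2 x' y' z' > 0" using c' by (auto simp: cell_def)
  have "l \<noteq> l'" using cells_share_support[OF d l d' l'] ne by blast
  define a b where "a = (vector [fst l - fst l', fst (snd l) - fst (snd l')] :: real^2)"
    and "b = snd (snd l') - snd (snd l)"
  have "a \<noteq> 0 \<or> b \<noteq> 0"
  proof (rule ccontr)
    assume "\<not> ?thesis"
    hence "a $ 1 = 0" "a $ 2 = 0" "b = 0" by auto
    hence "l = l'" by (simp add: a_def b_def prod_eq_iff)
    thus False using \<open>l \<noteq> l'\<close> by simp
  qed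
  moreover have "tri (x, y, z) \<inter> tri (x', y', z') \<subseteq> {v. a \<bullet> v = b}"
  proof
    fix v assume v: "v \<in> tri (x, y, z) \<inter> tri (x', y', z')"
    hence "evr l v = evr l' v" using tri_support_le[OF l l'] tri_support_le[OF l' l] by (meson IntD1 IntD2 order_antisym)
    thus "v \<in> {v. a \<bullet> v = b}"
      by (simp add: evr_def a_def b_def inner_vec_def sum_2 algebra_simps)
  qed
  ultimately show ?thesis using negligible_hyperplane negligible_subset by blast
qed

context delaunay
begin

text \<open>Of the rotations of a triangle, \<open>D\<close> keeps the one beginning with the vertex
  of least index. The triangles in \<open>D\<close> fit into the box up to null sets; 6 is the
  factor 2 between determinant and area times three rotations.\<close>

lemma total_area:
  assumes box: "\<And>p. p \<in> X \<Longrightarrow> lo \<le> fst p \<and> fst p \<le> hi \<and> lo \<le> snd p \<and> snd p \<le> hi" and lh: "lo \<le> hi"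
  shows "(\<Sum>(x, y, z)\<in>C1. det2 x y z) \<le> 6 * ((hi - lo) * (hi - lo))"
proof -
  obtain i :: "pt \<Rightarrow> nat" where inj: "inj_on i X" using finite_imp_inj_to_nat_seg[OF fin] by blast
  define D where "D = {(x, y, z) \<in> C1. i x < i y \<and> i x < i z}"
  have DC: "D \<subseteq> C1" by (auto simp: D_def)
  have finD: "finite D" using DC finite_C1 finite_subset by blast
  have D_eq: "c = c'" if cD: "c \<in> D" and cD': "c' \<in> D" and eq: "{x, y, z} = {x', y', z'}"
    and c: "c = (x, y, z)" "c' = (x', y', z')" for c c' x y z x' y' z'
  proof -
    have a: "i x < i y" "i x < i z" "det2 x y z > 0" "i x' < i y'" "i x' < i z'" "det2 x' y' z' > 0"
      using cD cD' c by (auto simp: D_def C1_iff cell_def)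
    have "x' \<in> {x, y, z}" "x \<in> {x', y', z'}" using eq by auto
    hence xx: "x' = x" using a by auto
    have "y' \<noteq> x" "z' \<noteq> x" "y \<noteq> x" "z \<noteq> x" using a xx by auto
    moreover have "y \<noteq> z" "y' \<noteq> z'" using a by auto
    moreover have "y \<in> {x', y', z'}" "z \<in> {x', y', z'}" using eq by blast+
    ultimately have "y = y' \<and> z = z' \<or> y = z' \<and> z = y'" using xx by auto
    moreover have "\<not> (y = z' \<and> z = y')"
    proof
      assume "y = z' \<and> z = y'"
      hence "det2 x' y' z' = - det2 x y z" using xx by (simp add: det2_def algebra_simps)
      thus False using a by simp
    qed
    ultimately show ?thesis using c xx by blast
  qed
  have "measure lebesgue (\<Union>(tri ` D)) = (\<Sum>c\<in>D. measure lebesgue (tri c))"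
  proof (rule measure_negligible_finite_Union_image[OF finD tri_lmeasurable])
    show "pairwise (\<lambda>c c'. negligible (tri c \<inter> tri c')) D"
    proof (rule pairwiseI)
      fix c c' assume cc: "c \<in> D" "c' \<in> D" "c \<noteq> c'"
      obtain x y z where c: "c = (x, y, z)" by (cases c)
      obtain x' y' z' where c': "c' = (x', y', z')" by (cases c')
      have "cell X h x y z" "cell X h x' y' z'" using cc DC c c' C1_iff by blast+
      moreover have "{x, y, z} \<noteq> {x', y', z'}" using D_eq[OF cc(1,2) _ c c'] cc(3) by blast
      ultimately show "negligible (tri c \<inter> tri c')" unfolding c c' by (rule cells_overlap_negligible)
    qed
  qed
  moreover have "measure lebesgue (\<Union>(tri ` D)) \<le> (hi - lo) * (hi - lo)"
  proof -
    define B where "B = cbox (vector [of_int lo, of_int lo]) (vector [of_int hi, of_int hi] :: real^2)"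
    have tB: "tri c \<subseteq> B" if "c \<in> D" for c
    proof -
      obtain x y z where c: "c = (x, y, z)" by (cases c)
      hence "cell X h x y z" using that DC C1_iff by blast
      hence "vpt ` {x, y, z} \<subseteq> B" using box cell_in[of X h x y z]
        by (auto simp: B_def vpt_def mem_box_cart forall_2)
      hence "{vpt x, vpt y, vpt z} \<subseteq> B" by simp
      thus ?thesis unfolding c tri_def prod.case by (rule hull_minimal) (simp add: B_def convex_box)
    qed
    have "\<Union>(tri ` D) \<subseteq> B" using tB by blast
    moreover have "\<Union>(tri ` D) \<in> lmeasurable" using finD tri_lmeasurable by (intro fmeasurable.finite_UN) auto
    ultimately have "measure lebesgue (\<Union>(tri ` D)) \<le> measure lebesgue B"
      by (intro measure_mono_fmeasurable) (auto simp: B_def fmeasurableD)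
    also have "measure lebesgue B = (hi - lo) * (hi - lo)"
    proof -
      have "B \<noteq> {}" using lh by (simp add: B_def interval_ne_empty_cart forall_2)
      thus ?thesis unfolding B_def by (simp add: content_cbox_cart UNIV_2)
    qed
    finally show ?thesis .
  qed
  moreover have "(\<Sum>c\<in>D. measure lebesgue (tri c)) = (\<Sum>(x, y, z)\<in>D. real_of_int (det2 x y z) / 2)"
    by (intro sum.cong) (auto simp: D_def C1_iff cell_def measure_tri)
  ultimately have "(\<Sum>(x, y, z)\<in>D. real_of_int (det2 x y z) / 2) \<le> (hi - lo) * (hi - lo)" by linarith
  hence "real_of_int (\<Sum>(x, y, z)\<in>D. det2 x y z) \<le> of_int (2 * ((hi - lo) * (hi - lo)))"
    by (simp add: split_beta sum_divide_distrib[symmetric])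
  hence D2: "(\<Sum>(x, y, z)\<in>D. det2 x y z) \<le> 2 * ((hi - lo) * (hi - lo))" by linarith
  define f where "f x y z = (if i x < i y \<and> i x < i z then det2 x y z else 0)" for x y z
  have "(\<Sum>(x, y, z)\<in>C1. det2 x y z) = (\<Sum>(x, y, z)\<in>C1. f x y z + f y z x + f z x y)"
  proof (rule sum.cong[OF refl])
    fix c assume c: "c \<in> C1"
    obtain x y z where xyz: "c = (x, y, z)" by (cases c)
    hence "cell X h x y z" using c C1_iff by blast
    hence "i x \<noteq> i y" "i y \<noteq> i z" "i x \<noteq> i z"
      using cell_in[of X h x y z] cell_distinct[of X h x y z] inj by (auto simp: inj_on_def)
    thus "(case c of (x, y, z) \<Rightarrow> det2 x y z) = (case c of (x, y, z) \<Rightarrow> f x y z + f y z x + f z x y)"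
      unfolding xyz f_def by (auto simp: det2_rot)
  qed
  also have "\<dots> = 3 * (\<Sum>(x, y, z)\<in>C1. f x y z)" by (rule sum_rot3[OF rot_closed_C1])
  also have "(\<Sum>(x, y, z)\<in>C1. f x y z) = (\<Sum>(x, y, z)\<in>D. det2 x y z)"
  proof -
    have "(\<Sum>(x, y, z)\<in>C1. f x y z) = (\<Sum>(x, y, z)\<in>D. f x y z)"
      by (rule sum.mono_neutral_right[OF finite_C1 DC]) (auto simp: D_def f_def split: if_splits)
    also have "\<dots> = (\<Sum>(x, y, z)\<in>D. det2 x y z)" by (intro sum.cong) (auto simp: D_def f_def)
    finally show ?thesis .
  qed
  finally show ?thesis using D2 by linarith
qed

lemma local_density:
  assumes box: "\<And>p. p \<in> X \<Longrightarrow> lo \<le> fst p \<and> fst p \<le> hi \<and> lo \<le> snd p \<and> snd p \<le> hi" and lh: "lo \<le> hi"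
  shows "75 * int (card P0) \<le> (hi - lo) * (hi - lo)"
  using total_area[OF assms] discharging card_cells by linarith

end

text \<open>A maximal packing containing \<open>Y\<close> in the box widened by 40 is saturated near
  \<open>Y\<close>: squared distance 340 means coordinates within 22, and the sites tested lie at
  most 13 further out.\<close>

lemma packed_density:
  assumes pk: "packed Y" and Y: "\<And>p. p \<in> Y \<Longrightarrow> 0 \<le> fst p \<and> fst p \<le> M \<and> 0 \<le> snd p \<and> snd p \<le> M" and M: "0 \<le> M"
  shows "75 * int (card Y) \<le> (M + 80) * (M + 80)"
proof -
  define B where "B = {-40..M+40} \<times> {-40..M+40}"
  have finB: "finite B" by (simp add: B_def)
  define F where "F = {X. X \<subseteq> B \<and> Y \<subseteq> X \<and> packed X}"
  have "finite F" unfolding F_def using finB by (auto intro: finite_subset[of _ "Pow B"])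
  moreover have "Y \<in> F" using pk Y by (force simp: F_def B_def)
  ultimately obtain X where XF: "X \<in> F" and max: "\<And>Z. Z \<in> F \<Longrightarrow> X \<subseteq> Z \<Longrightarrow> X = Z"
    using finite_has_maximal[of F] by blast
  have X: "X \<subseteq> B" "Y \<subseteq> X" "packed X" using XF by (auto simp: F_def)
  have finX: "finite X" using X finB finite_subset by blast
  have sat: "saturated X q" if p: "p \<in> Y" and q: "q \<in> X" and pq: "qf (p - q) \<le> 340" for p q
    unfolding saturated_def
  proof (intro allI impI)
    fix s assume s: "hex s" "\<bar>fst s - fst q\<bar> \<le> 13" "\<bar>snd s - snd q\<bar> \<le> 13"
    have "3 * (fst (p - q))\<^sup>2 < 3 * 22\<^sup>2" "3 * (snd (p - q))\<^sup>2 < 3 * 22\<^sup>2"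
      using qf_coord[of "p - q"] pq by simp_all
    hence "\<bar>fst p - fst q\<bar> \<le> 22" "\<bar>snd p - snd q\<bar> \<le> 22"
      using abs_le_square_iff[of "fst p - fst q" 22] abs_le_square_iff[of "snd p - snd q" 22] by simp_all
    hence sB: "s \<in> B" using s Y[OF p] by (cases s) (auto simp: B_def abs_le_iff)
    show "\<exists>w\<in>X. qf (w - s) < 67"
    proof (rule ccontr)
      assume no: "\<not> ?thesis"
      hence "s \<notin> X" by (force simp: qf_def)
      moreover have "insert s X \<in> F"
        using X sB s no by (auto simp: F_def packed_def qf_minus[of s] not_less)
      ultimately show False using max by blast
    qed
  qed
  obtain h where h: "near_lift X h" "generic X h" using exists_generic_near_lift[OF finX] .
  interpret delaunay X h Y
    using finX h X sat by unfold_locales auto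
  have "75 * int (card Y) \<le> ((M + 40) - (-40)) * ((M + 40) - (-40))"
    by (rule local_density) (use X M in \<open>auto simp: B_def\<close>)
  thus ?thesis by (simp add: add.commute)
qed

section \<open>Periodic packings admit no local improvement\<close>

definition red :: "int \<Rightarrow> pt \<Rightarrow> pt" where
  "red N p = (fst p mod N, snd p mod N)"

definition grid :: "int \<Rightarrow> pt set" where
  "grid N = {0..<N} \<times> {0..<N}"

definition periodic :: "int \<Rightarrow> pt set \<Rightarrow> bool" where
  "periodic N S \<longleftrightarrow> (\<forall>p i j. (fst p + i * N, snd p + j * N) \<in> S \<longleftrightarrow> p \<in> S)"

lemma finite_grid: "finite (grid N)"
  by (simp add: grid_def)

lemma red_periodic:
  assumes "periodic N S"
  shows "red N p \<in> S \<longleftrightarrow> p \<in> S"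
proof -
  have "(fst (red N p) + (fst p div N) * N, snd (red N p) + (snd p div N) * N) = p"
    by (simp add: red_def prod_eq_iff)
  thus ?thesis using assms unfolding periodic_def by metis
qed

lemma periodic_mult:
  assumes "periodic N S"
  shows "periodic (k * N) S"
  unfolding periodic_def
proof (intro allI)
  fix p i j
  have "(fst p + (i * k) * N, snd p + (j * k) * N) \<in> S \<longleftrightarrow> p \<in> S" using assms unfolding periodic_def by blast
  thus "(fst p + i * (k * N), snd p + j * (k * N)) \<in> S \<longleftrightarrow> p \<in> S" by (simp add: mult.assoc)
qed

lemma tile_card:
  assumes N: "0 < N" and k: "0 \<le> k" and S: "S \<subseteq> grid N"
  shows "int (card {p \<in> grid (k * N). red N p \<in> S}) = k * k * int (card S)"
proof -
  define g where "g = (\<lambda>((i, j), s :: pt). (i * N + fst s, j * N + snd s))"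
  have "bij_betw g (({0..<k} \<times> {0..<k}) \<times> S) {p \<in> grid (k * N). red N p \<in> S}"
  proof (rule bij_betw_byWitness[where f' = "\<lambda>p. ((fst p div N, snd p div N), red N p)"])
    have s: "0 \<le> fst s" "fst s < N" "0 \<le> snd s" "snd s < N" if "s \<in> S" for s
      using S that by (auto simp: grid_def)
    show "\<forall>a\<in>({0..<k} \<times> {0..<k}) \<times> S. ((fst (g a) div N, snd (g a) div N), red N (g a)) = a"
      using s N by (auto simp: g_def red_def prod_eq_iff div_pos_pos_trivial mod_pos_pos_trivial)
    show "\<forall>p\<in>{p \<in> grid (k * N). red N p \<in> S}. g ((fst p div N, snd p div N), red N p) = p"
      by (auto simp: g_def red_def)
    have lt: "i * N + u < k * N" "0 \<le> i * N + u" if "i < k" "0 \<le> i" "0 \<le> u" "u < N" for i u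
    proof -
      have "(i + 1) * N \<le> k * N" using that N by (intro mult_right_mono) auto
      thus "i * N + u < k * N" using that by (simp add: algebra_simps)
      show "0 \<le> i * N + u" using that N by simp
    qed
    show "g ` (({0..<k} \<times> {0..<k}) \<times> S) \<subseteq> {p \<in> grid (k * N). red N p \<in> S}"
      using s N lt by (auto simp: g_def red_def grid_def mod_pos_pos_trivial)
    show "(\<lambda>p. ((fst p div N, snd p div N), red N p)) ` {p \<in> grid (k * N). red N p \<in> S} \<subseteq> ({0..<k} \<times> {0..<k}) \<times> S"
    proof -
      have "u div N < k" if "u < k * N" for u
      proof (rule ccontr)
        assume "\<not> ?thesis"
        hence "k * N \<le> (u div N) * N" using N by (intro mult_right_mono) auto
        thus False using that pos_mod_sign[OF N, of u] div_mult_mod_eq[of u N] by linarith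
      qed
      thus ?thesis using N by (auto simp: grid_def pos_imp_zdiv_nonneg_iff)
    qed
  qed
  hence "card {p \<in> grid (k * N). red N p \<in> S} = card (({0..<k} \<times> {0..<k}) \<times> S)"
    by (rule bij_betw_same_card[symmetric])
  thus ?thesis using k by (simp add: card_cartesian_product)
qed

text \<open>By \<open>qf_lt_67\<close> conflicting points differ by at most 9 in each coordinate, so
  a conflict between different blocks involves no point lying deeper than that inside its
  block.\<close>

lemma block_boundary:
  fixes a b M :: int
  assumes "\<bar>a - b\<bar> \<le> 9" "a div M \<noteq> b div M" "10 \<le> a mod M" "a mod M < M - 10"
  shows False
proof -
  have "a = (a div M) * M + a mod M" by simp
  hence "b = (a mod M + (b - a)) + (a div M) * M" by linarith
  define c where "c = a mod M + (b - a)"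
  have c: "0 \<le> c" "c < M" using assms unfolding c_def abs_le_iff by linarith+
  have "b = c + (a div M) * M" using \<open>b = _\<close> by (simp only: c_def)
  hence "b div M = (c + (a div M) * M) div M" by (rule arg_cong)
  also have "\<dots> = a div M + c div M" using c by (intro div_mult_self1) simp
  also have "c div M = 0" using c by (rule div_pos_pos_trivial)
  finally show False using assms by simp
qed

lemma qf_lt_67: "qf d < 67 \<Longrightarrow> \<bar>fst d\<bar> \<le> 9 \<and> \<bar>snd d\<bar> \<le> 9"
proof -
  assume "qf d < 67"
  hence "(fst d)\<^sup>2 < 10\<^sup>2" "(snd d)\<^sup>2 < 10\<^sup>2" using qf_coord[of d] by simp_all
  thus ?thesis using power2_less_imp_less[of "\<bar>fst d\<bar>" 10] power2_less_imp_less[of "\<bar>snd d\<bar>" 10] by simp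
qed

lemma hex_periodic: "hex (fst p + i * (3 * N), snd p + j * (3 * N)) \<longleftrightarrow> hex p"
proof -
  have "fst p + i * (3 * N) + (snd p + j * (3 * N)) = (fst p + snd p) + 3 * (i * N + j * N)" by (simp add: algebra_simps)
  thus ?thesis unfolding hex_def fst_conv snd_conv by (metis mod_mult_self2)
qed

text \<open>A local modification of a periodic packing with more points could be repeated periodically,
  giving a packing that is too dense.\<close>

lemma no_local_improvement:
  assumes N: "0 < N" "3 dvd N" and pk: "packed \<phi>" and per: "periodic N \<phi>"
    and dens: "N * N \<le> 75 * int (card (\<phi> \<inter> grid N))"
    and V: "finite V" "\<psi> \<subseteq> V" and pk': "packed (\<psi> \<union> (\<phi> - V))"
  shows "card \<psi> \<le> card (\<phi> \<inter> V)"
proof (rule ccontr)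
  assume "\<not> ?thesis"
  hence more: "card (\<phi> \<inter> V) + 1 \<le> card \<psi>" by simp
  define r where "r = (\<Sum>p\<in>V. \<bar>fst p\<bar> + \<bar>snd p\<bar>)"
  have r: "\<bar>fst p\<bar> \<le> r \<and> \<bar>snd p\<bar> \<le> r" if "p \<in> V" for p
    using member_le_sum[OF that, of "\<lambda>p. \<bar>fst p\<bar> + \<bar>snd p\<bar>"] V by (auto simp: r_def)
  have r0: "0 \<le> r" unfolding r_def by (simp add: sum_nonneg)
  \<comment> \<open>\<open>H\<close> is a multiple of the period, so the shift by \<open>H\<close>
    preserves \<open>\<phi>\<close>. It moves \<open>V\<close> into the interior of the block of
    side \<open>2 * H\<close>, at distance about 20 from the border.\<close>
  define h H M where "h = r + 20" and "H = h * N" and "M = 2 * H"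
  have "h * 1 \<le> h * N" using N r0 by (intro mult_left_mono) (auto simp: h_def)
  hence H: "r + 20 \<le> H" by (simp add: H_def h_def)
  have M0: "0 < M" using H r0 by (simp add: M_def)
  have perM: "periodic M \<phi>" using periodic_mult[OF per, of "2 * h"] by (simp add: M_def H_def mult.assoc)
  have perH: "(fst p - H, snd p - H) \<in> \<phi> \<longleftrightarrow> p \<in> \<phi>" for p
    using periodic_mult[OF per, of h, folded H_def] unfolding periodic_def
    by (metis add_uminus_conv_diff mult_minus1)
  define sh :: "pt \<Rightarrow> pt" where "sh p = (fst p + H, snd p + H)" for p
  have injsh: "inj sh" by (auto simp: inj_def sh_def prod_eq_iff)
  define \<xi> where "\<xi> = sh ` \<psi> \<union> (\<phi> - sh ` V)"
  have shV: "20 \<le> fst p \<and> fst p < M - 19 \<and> 20 \<le> snd p \<and> snd p < M - 19" if "p \<in> sh ` V" for p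
    using that r H by (fastforce simp: sh_def M_def)
  have sh\<phi>: "sh p \<in> \<phi> \<longleftrightarrow> p \<in> \<phi>" for p using perH[of "sh p"] by (simp add: sh_def)
  obtain N' where N': "N = 3 * N'" using N by blast
  have hexM: "hex (fst p + i * M, snd p + j * M) \<longleftrightarrow> hex p" for p i j
    using hex_periodic[of p i "2 * h * N'" j] by (simp add: M_def H_def N' mult_ac)
  have hexH: "hex (sh p) \<longleftrightarrow> hex p" for p
    using hex_periodic[of p 1 "h * N'" 1] by (simp add: sh_def H_def N' mult_ac)
  have \<xi>_in: "p \<in> \<xi> \<Longrightarrow> \<exists>p'. p = sh p' \<and> p' \<in> \<psi> \<union> (\<phi> - V)" for p
  proof -
    assume "p \<in> \<xi>"
    moreover have "p = sh (fst p - H, snd p - H)" by (simp add: sh_def)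
    ultimately show ?thesis unfolding \<xi>_def using sh\<phi> by (metis DiffD1 DiffD2 DiffI UnE UnI1 UnI2 image_iff)
  qed
  have pk\<xi>: "packed \<xi>" unfolding packed_def
  proof (intro conjI ballI impI)
    fix p assume "p \<in> \<xi>" thus "hex p" using \<xi>_in[of p] pk' hexH unfolding packed_def by metis
  next
    fix p q assume "p \<in> \<xi>" "q \<in> \<xi>" "p \<noteq> q"
    then obtain p' q' where "p = sh p'" "q = sh q'" "p' \<in> \<psi> \<union> (\<phi> - V)" "q' \<in> \<psi> \<union> (\<phi> - V)" "p' \<noteq> q'"
      using \<xi>_in by metis
    moreover have "sh p' - sh q' = p' - q'" by (simp add: sh_def prod_eq_iff)
    ultimately show "67 \<le> qf (p - q)" using pk' unfolding packed_def by metis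
  qed
  define X where "X = {p. red M p \<in> \<xi>}"
  have redM: "p = (fst (red M p) + (fst p div M) * M, snd (red M p) + (snd p div M) * M)" for p
    by (simp add: red_def prod_eq_iff)
  \<comment> \<open>A point close to another block lies where nothing was modified, so conflicts
    across borders are conflicts inside the packing \<open>\<phi>\<close>.\<close>
  have far: "red M p \<in> \<phi>" if p: "red M p \<in> \<xi>"
    and d: "fst p div M \<noteq> fst q div M \<or> snd p div M \<noteq> snd q div M" "\<bar>fst (p - q)\<bar> \<le> 9" "\<bar>snd (p - q)\<bar> \<le> 9" for p q
  proof (rule ccontr)
    assume "red M p \<notin> \<phi>"
    hence "red M p \<in> sh ` V" using p V unfolding \<xi>_def by blast
    note rV = this
    have *: "10 \<le> fst p mod M" "fst p mod M < M - 10" "10 \<le> snd p mod M" "snd p mod M < M - 10"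
      using shV[OF rV] by (auto simp: red_def)
    show False using d(1)
    proof
      assume "fst p div M \<noteq> fst q div M"
      thus False using block_boundary[of "fst p" "fst q" M] * d by simp
    next
      assume "snd p div M \<noteq> snd q div M"
      thus False using block_boundary[of "snd p" "snd q" M] * d by simp
    qed
  qed
  have pkX: "packed X" unfolding packed_def
  proof (intro conjI ballI impI)
    fix p assume "p \<in> X"
    hence "hex (red M p)" using pk\<xi> by (auto simp: X_def packed_def)
    thus "hex p" using hexM redM by metis
  next
    fix p q assume pq: "p \<in> X" "q \<in> X" "p \<noteq> q"
    show "67 \<le> qf (p - q)"
    proof (rule ccontr)
      assume small: "\<not> ?thesis"
      hence s: "\<bar>fst (p - q)\<bar> \<le> 9" "\<bar>snd (p - q)\<bar> \<le> 9" using qf_lt_67[of "p - q"] by auto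
      show False
      proof (cases "fst p div M = fst q div M \<and> snd p div M = snd q div M")
        case True
        have "red M p - red M q = p - q"
          using True by (simp add: red_def prod_eq_iff minus_div_mult_eq_mod[symmetric])
        moreover have "red M p \<noteq> red M q" using calculation pq(3) by auto
        ultimately show False using pk\<xi> pq small unfolding X_def packed_def by (metis mem_Collect_eq)
      next
        case False
        have "\<bar>fst (q - p)\<bar> \<le> 9" "\<bar>snd (q - p)\<bar> \<le> 9" using s by (simp_all add: abs_minus_commute)
        hence "red M p \<in> \<phi>" "red M q \<in> \<phi>"
          using far[of p q] far[of q p] False s pq by (auto simp: X_def)
        hence "p \<in> \<phi>" "q \<in> \<phi>" using red_periodic[OF perM] by auto
        thus False using pk pq small unfolding packed_def by blast
      qed
    qed
  qed
  define S where "S = \<xi> \<inter> grid M"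
  \<comment> \<open>The local improvement adds at least one particle to each block.\<close>
  have cS: "M * M + 75 \<le> 75 * int (card S)"
  proof -
    have "int (card {p \<in> grid (2 * h * N). red N p \<in> \<phi> \<inter> grid N}) = (2 * h) * (2 * h) * int (card (\<phi> \<inter> grid N))"
      using N r0 by (intro tile_card) (auto simp: h_def)
    moreover have "{p \<in> grid (2 * h * N). red N p \<in> \<phi> \<inter> grid N} = \<phi> \<inter> grid M"
      using red_periodic[OF per] N by (auto simp: M_def H_def mult.assoc grid_def red_def)
    ultimately have "(2 * h) * (2 * h) * (N * N) \<le> 75 * int (card (\<phi> \<inter> grid M))"
      using mult_left_mono[OF dens, of "(2 * h) * (2 * h)"] by simp
    hence 1: "M * M \<le> 75 * int (card (\<phi> \<inter> grid M))" by (simp add: M_def H_def mult_ac)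
    have fin: "finite (sh ` V)" using V by simp
    have shVbox: "sh ` V \<subseteq> grid M"
    proof
      fix p assume "p \<in> sh ` V"
      from shV[OF this] show "p \<in> grid M" by (cases p) (auto simp: grid_def)
    qed
    have "S = sh ` \<psi> \<union> (\<phi> \<inter> grid M - sh ` V)" using shVbox V by (auto simp: S_def \<xi>_def)
    moreover have "sh ` \<psi> \<inter> (\<phi> \<inter> grid M - sh ` V) = {}" using V by blast
    moreover have "finite (sh ` \<psi>)" using V finite_subset by blast
    moreover have "finite (\<phi> \<inter> grid M - sh ` V)" using finite_grid by blast
    ultimately have "card S = card (sh ` \<psi>) + card (\<phi> \<inter> grid M - sh ` V)" by (simp add: card_Un_disjoint)
    moreover have "card (sh ` \<psi>) = card \<psi>" using injsh by (simp add: card_image inj_on_def inj_def)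
    moreover have "card (\<phi> \<inter> grid M) - card (sh ` V \<inter> \<phi>) \<le> card (\<phi> \<inter> grid M - sh ` V)"
    proof -
      have "\<phi> \<inter> grid M - sh ` V = (\<phi> \<inter> grid M) - (sh ` V \<inter> \<phi>)" by blast
      thus ?thesis using diff_card_le_card_Diff[of "sh ` V \<inter> \<phi>" "\<phi> \<inter> grid M"] fin by simp
    qed
    moreover have "sh ` V \<inter> \<phi> = sh ` (\<phi> \<inter> V)" using sh\<phi> by blast
    moreover have "card (sh ` (\<phi> \<inter> V)) = card (\<phi> \<inter> V)" using injsh by (simp add: card_image inj_on_def inj_def)
    ultimately have "card (\<phi> \<inter> grid M) + 1 \<le> card S" using more by simp
    thus ?thesis using 1 by linarith
  qed
  \<comment> \<open>The gain \<open>75 * (k * k)\<close> has to exceed the border terms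
    \<open>158 * (k * M) + 6241\<close>; the summand \<open>3 * M\<close> handles the first and 100
    the second.\<close>
  define k where "k = 3 * M + 100"
  have "75 * int (card {p \<in> grid (k * M). red M p \<in> S}) \<le> (k * M - 1 + 80) * (k * M - 1 + 80)"
  proof (rule packed_density)
    show "packed {p \<in> grid (k * M). red M p \<in> S}" using pkX unfolding packed_def X_def S_def by blast
    show "0 \<le> k * M - 1" using M0 by (simp add: k_def)
  qed (auto simp: grid_def)
  moreover have "int (card {p \<in> grid (k * M). red M p \<in> S}) = k * k * int (card S)"
    using M0 by (intro tile_card) (auto simp: k_def S_def)
  moreover have "k * k * (M * M + 75) \<le> k * k * (75 * int (card S))" using cS by (intro mult_left_mono) auto
  ultimately have "k * k * (M * M + 75) \<le> (k * M - 1 + 80) * (k * M - 1 + 80)" by simp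
  hence "75 * (k * k) \<le> 158 * (k * M) + 6241" by (simp add: algebra_simps)
  moreover have "k * k = 3 * (k * M) + 100 * k" by (simp add: k_def algebra_simps)
  moreover have "0 \<le> k * M" "100 \<le> k" using M0 by (simp_all add: k_def)
  ultimately show False by linarith
qed

section \<open>Transfer to the plane\<close>

definition pos :: "pt \<Rightarrow> real^2" where
  "pos p = site (fst p) (snd p)"

lemma pos_nth: "pos p $ 1 = of_int (fst p) - of_int (snd p) / 2" "pos p $ 2 = of_int (snd p) * sqrt 3 / 2"
  by (simp_all add: pos_def site_def e1_def e2_def)

lemma pos_add: "pos (p + q) = pos p + pos q"
  by (simp add: vec_eq_iff forall_2 pos_nth algebra_simps add_divide_distrib)

lemma pos_minus: "pos (p - q) = pos p - pos q"
  by (metis add_diff_cancel_right' diff_add_cancel pos_add)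

lemma pos_scale: "of_int m *\<^sub>R pos p = pos (m * fst p, m * snd p)"
  by (simp add: vec_eq_iff forall_2 pos_nth algebra_simps)

lemma pos_inj: "pos p = pos q \<longleftrightarrow> p = q"
  by (auto simp: vec_eq_iff forall_2 pos_nth prod_eq_iff)

lemma inj_pos: "inj pos"
  by (simp add: inj_def pos_inj)

lemma pos_inner: "2 * (pos p \<bullet> pos q) = of_int (bil p q)"
  by (simp add: inner_vec_def sum_2 pos_nth bil_def field_simps)

lemma pos_norm: "(norm (pos p))\<^sup>2 = of_int (qf p)"
  using pos_inner[of p p] by (simp add: dot_square_norm bil_def qf_def power2_eq_square algebra_simps)

lemma pos_dist: "(dist (pos p) (pos q))\<^sup>2 = of_int (qf (p - q))"
  by (simp add: dist_norm pos_minus[symmetric] pos_norm)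

lemma pos_dist_sqrt: "dist (pos p) (pos q) = sqrt d \<longleftrightarrow> of_int (qf (p - q)) = d" if "0 \<le> d"
proof -
  have "dist (pos p) (pos q) = sqrt d \<longleftrightarrow> (dist (pos p) (pos q))\<^sup>2 = (sqrt d)\<^sup>2"
    using that by (simp only: power2_eq_iff_nonneg zero_le_dist real_sqrt_ge_zero)
  thus ?thesis using that by (simp add: pos_dist)
qed

lemma A2_eq: "A2 = range pos"
proof
  show "A2 \<subseteq> range pos"
  proof
    fix x assume "x \<in> A2"
    then obtain m n where "x = site m n" by (auto simp: A2_def)
    hence "x = pos (m, n)" by (simp add: pos_def)
    thus "x \<in> range pos" by blast
  qed
  show "range pos \<subseteq> A2" by (auto simp: A2_def pos_def)
qed

lemma hole_iff: "(\<exists>m n. pos p = of_int m *\<^sub>R site 1 2 + of_int n *\<^sub>R site 2 1) \<longleftrightarrow> \<not> hex p"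
proof -
  have e: "of_int m *\<^sub>R site 1 2 + of_int n *\<^sub>R site 2 1 = pos (m + 2 * n, 2 * m + n)" for m n
    using pos_scale[of m "(1, 2)"] pos_scale[of n "(2, 1)"] pos_add[of "(m, 2 * m)" "(2 * n, n)"]
    by (simp add: pos_def mult.commute)
  have "(\<exists>m n. p = (m + 2 * n, 2 * m + n)) \<longleftrightarrow> (fst p + snd p) mod 3 = 0"
  proof
    assume "(fst p + snd p) mod 3 = 0"
    then obtain k where k: "fst p + snd p = 3 * k" by (metis mod_0_imp_dvd dvdE)
    show "\<exists>m n. p = (m + 2 * n, 2 * m + n)"
      by (rule exI[of _ "snd p - k"], rule exI[of _ "fst p - k"]) (use k in \<open>simp add: prod_eq_iff\<close>)
  qed auto
  thus ?thesis unfolding e pos_inj hex_def by simp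
qed

lemma H2_eq: "H2 = pos ` {p. hex p}"
proof -
  define S where "S = {of_int m *\<^sub>R site 1 2 + of_int n *\<^sub>R site 2 1 | m n. True}"
  have "pos p \<in> S \<longleftrightarrow> \<not> hex p" for p using hole_iff[of p] by (auto simp: S_def)
  hence "range pos - S = pos ` {p. hex p}" by blast
  thus ?thesis by (simp add: H2_def A2_eq S_def)
qed

lemma admissible_pos: "admissible (sqrt 67) (pos ` X) \<longleftrightarrow> packed X"
proof -
  have "sqrt 67 \<le> dist (pos p) (pos q) \<longleftrightarrow> 67 \<le> qf (p - q)" for p q
  proof -
    have "sqrt 67 \<le> dist (pos p) (pos q) \<longleftrightarrow> 67 \<le> (dist (pos p) (pos q))\<^sup>2"
      using real_sqrt_le_iff[of 67 "(dist (pos p) (pos q))\<^sup>2"] by simp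
    thus ?thesis unfolding pos_dist by simp
  qed
  moreover have "pos ` X \<subseteq> H2 \<longleftrightarrow> (\<forall>x\<in>X. hex x)"
    unfolding H2_eq by (simp add: image_subset_iff image_iff pos_inj)
  ultimately show ?thesis unfolding admissible_def packed_def by (auto simp: pos_inj)
qed

lemma ground_state_pos:
  assumes N: "0 < N" "3 dvd N" and pk: "packed \<phi>" and per: "periodic N \<phi>"
    and dens: "N * N \<le> 75 * int (card (\<phi> \<inter> grid N))"
  shows "ground_state (sqrt 67) (pos ` \<phi>)"
  unfolding ground_state_def
proof (intro conjI notI)
  show "admissible (sqrt 67) (pos ` \<phi>)" using pk by (simp add: admissible_pos)
  assume "\<exists>V \<psi>. finite V \<and> V \<subseteq> H2 \<and> \<psi> \<subseteq> V \<and> card (pos ` \<phi> \<inter> V) < card \<psi> \<and>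
     admissible (sqrt 67) (\<psi> \<union> (pos ` \<phi> - V))"
  then obtain V \<psi> where V: "finite V" "V \<subseteq> H2" "\<psi> \<subseteq> V" and c: "card (pos ` \<phi> \<inter> V) < card \<psi>"
    and a: "admissible (sqrt 67) (\<psi> \<union> (pos ` \<phi> - V))" by blast
  define V' \<psi>' where "V' = pos -` V" and "\<psi>' = pos -` \<psi>"
  have eq: "V = pos ` V'" "\<psi> = pos ` \<psi>'" using V unfolding H2_eq V'_def \<psi>'_def by blast+
  have fin: "finite V'" unfolding V'_def using V(1) inj_pos by (simp add: finite_vimageI)
  have sub: "\<psi>' \<subseteq> V'" using V(3) by (auto simp: V'_def \<psi>'_def)
  have "\<psi> \<union> (pos ` \<phi> - V) = pos ` (\<psi>' \<union> (\<phi> - V'))" unfolding eq using inj_pos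
    by (simp add: image_Un image_set_diff)
  hence "packed (\<psi>' \<union> (\<phi> - V'))" using a by (simp add: admissible_pos)
  from no_local_improvement[OF N pk per dens fin sub this] have "card \<psi>' \<le> card (\<phi> \<inter> V')" .
  moreover have "card \<psi> = card \<psi>'" unfolding eq by (rule card_image) (use inj_pos in \<open>auto intro: inj_on_subset\<close>)
  moreover have "pos ` \<phi> \<inter> V = pos ` (\<phi> \<inter> V')" unfolding eq using inj_pos by (simp add: image_Int)
  hence "card (pos ` \<phi> \<inter> V) = card (\<phi> \<inter> V')" by (simp add: card_image inj_on_subset[OF inj_pos])
  ultimately show False using c by simp
qed

lemma shift_invariant_pos:
  assumes "\<And>p. p + u \<in> \<phi> \<longleftrightarrow> p \<in> \<phi>"
  shows "shift_invariant (pos u) (pos ` \<phi>)"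
proof -
  have "(\<lambda>p. p + u) ` \<phi> = \<phi>"
  proof
    show "(\<lambda>p. p + u) ` \<phi> \<subseteq> \<phi>" using assms by blast
    show "\<phi> \<subseteq> (\<lambda>p. p + u) ` \<phi>"
    proof
      fix p assume "p \<in> \<phi>"
      hence "p - u \<in> \<phi>" using assms[of "p - u"] by simp
      thus "p \<in> (\<lambda>p. p + u) ` \<phi>" by (auto intro: image_eqI[of _ _ "p - u"])
    qed
  qed
  moreover have "(\<lambda>x. x + pos u) ` pos ` \<phi> = pos ` (\<lambda>p. p + u) ` \<phi>" by (simp add: image_image pos_add)
  ultimately show ?thesis unfolding shift_invariant_def by simp
qed

lemma PGS_pos:
  assumes N: "0 < N" "3 dvd N" and pk: "packed \<phi>" and per: "periodic N \<phi>"
    and dens: "N * N \<le> 75 * int (card (\<phi> \<inter> grid N))"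
  shows "PGS (sqrt 67) (pos ` \<phi>)"
proof -
  let ?u = "(N, 0)" and ?v = "(0, N)"
  have A: "pos ?u \<in> A2" "pos ?v \<in> A2" by (auto simp: A2_eq)
  have ne: "pos ?u \<noteq> pos ?v" using N by (simp add: pos_inj)
  have inv: "(fst p + i * N, snd p + j * N) \<in> \<phi> \<longleftrightarrow> p \<in> \<phi>" for p i j using per by (simp add: periodic_def)
  have "p + ?u \<in> \<phi> \<longleftrightarrow> p \<in> \<phi>" for p using inv[of p 1 0] by (simp add: plus_prod_def)
  hence su: "shift_invariant (pos ?u) (pos ` \<phi>)" by (rule shift_invariant_pos)
  have "p + ?v \<in> \<phi> \<longleftrightarrow> p \<in> \<phi>" for p using inv[of p 0 1] by (simp add: plus_prod_def)
  hence sv: "shift_invariant (pos ?v) (pos ` \<phi>)" by (rule shift_invariant_pos)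
  have "pos ?v \<noteq> 0" using N pos_nth[of ?v] by (auto simp: vec_eq_iff forall_2)
  moreover have "pos ?u \<notin> span {pos ?v}"
  proof
    assume "pos ?u \<in> span {pos ?v}"
    then obtain k where k: "pos ?u = k *\<^sub>R pos ?v" by (auto simp: span_singleton)
    have "k = 0" using arg_cong[OF k, of "\<lambda>x. x $ 2"] N by (simp add: pos_nth)
    thus False using arg_cong[OF k, of "\<lambda>x. x $ 1"] N by (simp add: pos_nth)
  qed
  ultimately have "independent {pos ?u, pos ?v}" by (simp add: independent_insert)
  thus ?thesis unfolding PGS_def using ground_state_pos[OF assms] A ne su sv by blast
qed

lemma int_span2_pos:
  "int_span2 (pos u) (pos v) = pos ` {p. \<exists>m n. p = (m * fst u + n * fst v, m * snd u + n * snd v)}"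
proof -
  have "of_int m *\<^sub>R pos u + of_int n *\<^sub>R pos v = pos (m * fst u + n * fst v, m * snd u + n * snd v)" for m n
    unfolding pos_scale pos_add[symmetric] by simp
  thus ?thesis unfolding int_span2_def by auto
qed

text \<open>Cramer's rule: an integer lattice of determinant \<open>D\<close> is cut out by two congruences modulo \<open>D\<close>.\<close>

lemma lattice_iff:
  fixes u v p :: pt
  assumes D: "fst u * snd v - snd u * fst v = D" "D \<noteq> 0"
  shows "(\<exists>m n. p = (m * fst u + n * fst v, m * snd u + n * snd v)) \<longleftrightarrow>
    D dvd fst p * snd v - snd p * fst v \<and> D dvd fst u * snd p - snd u * fst p" (is "?L \<longleftrightarrow> ?R")
proof
  assume ?L
  then obtain m n where p: "p = (m * fst u + n * fst v, m * snd u + n * snd v)" by blast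
  have "fst p * snd v - snd p * fst v = m * D" "fst u * snd p - snd u * fst p = n * D"
    unfolding p D(1)[symmetric] by (simp_all add: algebra_simps)
  thus ?R by simp
next
  assume ?R
  then obtain m n where mn: "fst p * snd v - snd p * fst v = D * m" "fst u * snd p - snd u * fst p = D * n"
    by (auto elim!: dvdE)
  have "D * fst p = (fst p * snd v - snd p * fst v) * fst u + (fst u * snd p - snd u * fst p) * fst v"
    "D * snd p = (fst p * snd v - snd p * fst v) * snd u + (fst u * snd p - snd u * fst p) * snd v"
    by (simp_all add: D(1)[symmetric] algebra_simps)
  hence "D * fst p = D * (m * fst u + n * fst v)" "D * snd p = D * (m * snd u + n * snd v)"
    unfolding mn by (simp_all add: algebra_simps)
  hence "p = (m * fst u + n * fst v, m * snd u + n * snd v)" using D(2) by (simp add: prod_eq_iff)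
  thus ?L by blast
qed

section \<open>Counting the configurations of type alpha\<close>

definition alpha_conf :: "int \<times> int \<Rightarrow> pt set" where
  "alpha_conf = (\<lambda>(i, s). {p. fst p mod 5 = i \<and> (fst p + snd p) mod 15 = s})"

definition alpha_index :: "(int \<times> int) set" where
  "alpha_index = {0, 1, 2, 3, 4} \<times> {1, 2, 4, 5, 7, 8, 10, 11, 13, 14}"

text \<open>This is 5 times the sub-lattice removed from \<open>A2\<close>, of index 75.\<close>

definition sub5 :: "pt \<Rightarrow> bool" where
  "sub5 p \<longleftrightarrow> 5 dvd fst p \<and> 15 dvd fst p + snd p"

lemma alpha_conf_iff: "p \<in> alpha_conf (i, s) \<longleftrightarrow> fst p mod 5 = i \<and> (fst p + snd p) mod 15 = s"
  by (simp add: alpha_conf_def)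

lemma alpha_conf_coset: "p \<in> alpha_conf (fst w mod 5, (fst w + snd w) mod 15) \<longleftrightarrow> sub5 (p - w)"
proof -
  have "(fst p + snd p) - (fst w + snd w) = fst (p - w) + snd (p - w)" by simp
  thus ?thesis unfolding alpha_conf_iff sub5_def mod_eq_dvd_iff by (simp add: algebra_simps)
qed

lemma alpha_index_mod3: "(i, s) \<in> alpha_index \<Longrightarrow> s mod 3 \<noteq> 0"
  by (auto simp: alpha_index_def)

lemma alpha_index_bounds:
  assumes "(i, s) \<in> alpha_index"
  shows "0 \<le> i" "i < 5" "0 \<le> s" "s < 15"
proof -
  have i: "\<forall>i\<in>{0, 1, 2, 3, 4}. 0 \<le> i \<and> i < (5 :: int)"
    and s: "\<forall>s\<in>{1, 2, 4, 5, 7, 8, 10, 11, 13, 14}. 0 \<le> s \<and> s < (15 :: int)" by simp_all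
  have "i \<in> {0, 1, 2, 3, 4}" "s \<in> {1, 2, 4, 5, 7, 8, 10, 11, 13, 14}"
    using assms by (simp_all only: alpha_index_def mem_Sigma_iff)
  from bspec[OF i this(1)] bspec[OF s this(2)] show "0 \<le> i" "i < 5" "0 \<le> s" "s < 15" by simp_all
qed

lemma alpha_conf_hex:
  assumes "(i, s) \<in> alpha_index" "p \<in> alpha_conf (i, s)"
  shows "hex p"
proof -
  have "(fst p + snd p) mod 3 = (fst p + snd p) mod 15 mod 3" by (simp add: mod_mod_cancel)
  thus ?thesis using assms alpha_index_mod3 by (auto simp: hex_def alpha_conf_iff)
qed

lemma coord_mem: "\<bar>x\<bar> \<le> n \<Longrightarrow> x \<in> set [- n..n]" for x :: int
  by (simp add: abs_le_iff)

lemma sub5_norm: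
  assumes "sub5 d" "d \<noteq> 0"
  shows "67 \<le> qf d"
proof (rule ccontr)
  assume "\<not> ?thesis"
  hence q: "qf d < 67" by simp
  hence "fst d \<in> set [-9..9]" "snd d \<in> set [-9..9]" using qf_lt_67[OF q] by (simp_all only: coord_mem)
  moreover have "\<forall>x\<in>set [-9..9]. \<forall>y\<in>set [-9..9]. 5 dvd x \<longrightarrow> 15 dvd x + y \<longrightarrow>
      x = 0 \<and> y = 0 \<or> 67 \<le> x * x + y * y - x * (y :: int)" by code_simp
  ultimately have "fst d = 0 \<and> snd d = 0 \<or> 67 \<le> qf d"
    using assms(1) unfolding sub5_def qf_def power2_eq_square by blast
  thus False using q assms(2) by (simp add: prod_eq_iff)
qed

lemma alpha_conf_packed:
  assumes "c \<in> alpha_index"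
  shows "packed (alpha_conf c)"
proof -
  obtain i s where c: "c = (i, s)" by (cases c)
  show ?thesis unfolding packed_def c
  proof (intro conjI ballI impI)
    fix p assume "p \<in> alpha_conf (i, s)" thus "hex p" using alpha_conf_hex assms c by blast
  next
    fix p q assume pq: "p \<in> alpha_conf (i, s)" "q \<in> alpha_conf (i, s)" "p \<noteq> q"
    have "sub5 (p - q)" using pq alpha_conf_coset[of p q] by (simp add: alpha_conf_iff)
    thus "67 \<le> qf (p - q)" using pq by (intro sub5_norm) simp_all
  qed
qed

lemma alpha_conf_PGS:
  assumes "c \<in> alpha_index"
  shows "PGS (sqrt 67) (pos ` alpha_conf c)"
proof (rule PGS_pos[of 15])
  obtain i s where c: "c = (i, s)" by (cases c)
  have bd: "0 \<le> i" "i < 5" "0 \<le> s" "s < 15" using alpha_index_bounds[of i s] assms c by blast+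
  show "packed (alpha_conf c)" by (rule alpha_conf_packed[OF assms])
  show "periodic 15 (alpha_conf c)" unfolding periodic_def c alpha_conf_iff
  proof (intro allI)
    fix p :: pt and k j
    have "fst p + k * 15 = fst p + 5 * (3 * k)"
      "fst p + k * 15 + (snd p + j * 15) = (fst p + snd p) + 15 * (k + j)" by simp_all
    thus "fst (fst p + k * 15, snd p + j * 15) mod 5 = i \<and>
      (fst (fst p + k * 15, snd p + j * 15) + snd (fst p + k * 15, snd p + j * 15)) mod 15 = s \<longleftrightarrow>
      fst p mod 5 = i \<and> (fst p + snd p) mod 15 = s"
      by (simp only: fst_conv snd_conv mod_mult_self2)
  qed
  show "15 * 15 \<le> 75 * int (card (alpha_conf c \<inter> grid 15))"
  proof -
    \<comment> \<open>One point in each of the three columns of the 15 by 15 square with first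
      coordinate \<open>i\<close> modulo 5; 15 * 15 = 75 * 3.\<close>
    let ?g = "\<lambda>t::int. (i + 5 * t, (s - i - 5 * t) mod 15)"
    have "card (?g ` {0, 1, 2}) \<le> card (alpha_conf c \<inter> grid 15)"
    proof (rule card_mono)
      show "?g ` {0, 1, 2} \<subseteq> alpha_conf c \<inter> grid 15"
      proof
        fix p assume "p \<in> ?g ` {0, 1, 2}"
        then obtain t where t: "t \<in> {0, 1, 2}" "p = ?g t" by blast
        have "(i + 5 * t + (s - i - 5 * t) mod 15) mod 15 = s"
          using bd by (simp add: mod_simps)
        moreover have "(i + 5 * t) mod 5 = i" using bd by simp
        ultimately show "p \<in> alpha_conf c \<inter> grid 15" using t bd by (auto simp: c alpha_conf_iff grid_def)
      qed
    qed (use finite_grid in blast)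
    moreover have "card (?g ` {0, 1, 2}) = 3" by (subst card_image) (auto simp: inj_on_def)
    ultimately show ?thesis by simp
  qed
qed simp_all

text \<open>The prime 5 is inert in the Eisenstein integers, so a vector of norm 75 is 5 times a
  vector of norm 3. This is why a single sub-lattice occurs.\<close>

lemma norm_75:
  assumes "qf u = 75"
  shows "sub5 u"
proof -
  have "(fst u)\<^sup>2 \<le> 10\<^sup>2" "(snd u)\<^sup>2 \<le> 10\<^sup>2" using qf_coord[of u] assms by simp_all
  hence "\<bar>fst u\<bar> \<le> 10" "\<bar>snd u\<bar> \<le> 10"
    using abs_le_square_iff[of "fst u" 10] abs_le_square_iff[of "snd u" 10] by simp_all
  hence "fst u \<in> set [-10..10]" "snd u \<in> set [-10..10]" by (simp_all only: coord_mem)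
  moreover have "\<forall>x\<in>set [-10..10]. \<forall>y\<in>set [-10..10]. x * x + y * y - x * y = (75 :: int) \<longrightarrow> 5 dvd x \<and> 15 dvd x + y"
    by code_simp
  ultimately show ?thesis using assms unfolding sub5_def qf_def power2_eq_square by blast
qed

text \<open>Heron's formula gives the spanned lattice the determinant 75 up to sign. Any two vectors
  of \<open>sub5\<close> have determinant divisible by 75, so Cramer's rule has integral
  solutions.\<close>

lemma span_75:
  assumes u: "qf u = 75" and v: "qf v = 75" and uv: "qf (u - v) = 75"
  shows "int_span2 (pos u) (pos v) = pos ` {p. sub5 p}"
proof -
  define D where "D = fst u * snd v - snd u * fst v"
  have "3 * D\<^sup>2 = 3 * 75\<^sup>2"
    using heron_det[of u v 0] u v uv qf_minus[of 0 u] by (simp add: det2_def D_def)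
  hence "D\<^sup>2 = 75\<^sup>2" by linarith
  hence D: "D = 75 \<or> D = -75" by (rule power2_eq_iff[THEN iffD1])
  have su: "sub5 u" "sub5 v" using norm_75 u v by auto
  have "(\<exists>m n. p = (m * fst u + n * fst v, m * snd u + n * snd v)) \<longleftrightarrow> sub5 p" for p
  proof
    assume "\<exists>m n. p = (m * fst u + n * fst v, m * snd u + n * snd v)"
    then obtain m n where p: "p = (m * fst u + n * fst v, m * snd u + n * snd v)" by blast
    have "fst p + snd p = m * (fst u + snd u) + n * (fst v + snd v)" by (simp add: p algebra_simps)
    thus "sub5 p" using su unfolding sub5_def by (simp add: p)
  next
    assume "sub5 p"
    have key: "75 dvd fst q * snd q' - snd q * fst q'" if "sub5 q" "sub5 q'" for q q'
    proof -
      have dv: "5 dvd fst q" "15 dvd fst q + snd q" "5 dvd fst q'" "15 dvd fst q' + snd q'"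
        using that by (simp_all only: sub5_def)
      from dv(1) obtain a where a: "fst q = 5 * a" by (rule dvdE)
      from dv(2) obtain b where b: "fst q + snd q = 15 * b" by (rule dvdE)
      from dv(3) obtain a' where a': "fst q' = 5 * a'" by (rule dvdE)
      from dv(4) obtain b' where b': "fst q' + snd q' = 15 * b'" by (rule dvdE)
      have "fst q * snd q' - snd q * fst q' = fst q * (fst q' + snd q') - (fst q + snd q) * fst q'"
        by (simp add: algebra_simps)
      also have "\<dots> = 75 * (a * b' - b * a')" unfolding b b' unfolding a a' by (simp add: algebra_simps)
      finally show ?thesis by simp
    qed
    have "D dvd fst p * snd v - snd p * fst v \<and> D dvd fst u * snd p - snd u * fst p"
      using key[OF \<open>sub5 p\<close> su(2)] key[OF su(1) \<open>sub5 p\<close>] D by auto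
    thus "\<exists>m n. p = (m * fst u + n * fst v, m * snd u + n * snd v)"
      using lattice_iff[of u v D p] D by (auto simp: D_def)
  qed
  thus ?thesis unfolding int_span2_pos by simp
qed

lemma equilateral_sublattice_75:
  "equilateral_sublattice (sqrt 75) L \<longleftrightarrow> L = pos ` {p. sub5 p}"
proof
  have n: "norm (pos u) = sqrt 75 \<longleftrightarrow> qf u = 75" for u
    using pos_dist_sqrt[of 75 u 0] pos_inj by (simp add: dist_norm pos_minus[symmetric])
  have d: "dist (pos u) (pos v) = sqrt 75 \<longleftrightarrow> qf (u - v) = 75" for u v
    using pos_dist_sqrt[of 75 u v] by simp
  show "L = pos ` {p. sub5 p}" if "equilateral_sublattice (sqrt 75) L"
    using that span_75 n d unfolding equilateral_sublattice_def A2_eq by blast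
  assume L: "L = pos ` {p. sub5 p}"
  have q: "qf (5, 10) = 75" "qf (10, 5) = 75" "qf ((5, 10) - (10, 5)) = 75" by (simp_all add: qf_def)
  show "equilateral_sublattice (sqrt 75) L"
    unfolding equilateral_sublattice_def A2_eq
    using n[of "(5, 10)"] n[of "(10, 5)"] d[of "(5, 10)" "(10, 5)"] span_75[OF q] q L by blast
qed

lemma alpha_type_iff: "alpha_type (sqrt 75) \<phi> \<longleftrightarrow> (\<exists>c\<in>alpha_index. \<phi> = pos ` alpha_conf c)"
proof -
  have shift: "(\<lambda>x. x + pos w) ` pos ` {p. sub5 p} = pos ` alpha_conf (fst w mod 5, (fst w + snd w) mod 15)" for w
  proof -
    have "(\<lambda>p. p + w) ` {p. sub5 p} = alpha_conf (fst w mod 5, (fst w + snd w) mod 15)"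
    proof
      show "(\<lambda>p. p + w) ` {p. sub5 p} \<subseteq> alpha_conf (fst w mod 5, (fst w + snd w) mod 15)"
        by (auto simp only: alpha_conf_coset mem_Collect_eq add_diff_cancel_right')
      show "alpha_conf (fst w mod 5, (fst w + snd w) mod 15) \<subseteq> (\<lambda>p. p + w) ` {p. sub5 p}"
      proof
        fix p assume "p \<in> alpha_conf (fst w mod 5, (fst w + snd w) mod 15)"
        hence "sub5 (p - w)" by (simp only: alpha_conf_coset)
        moreover have "p = (p - w) + w" by simp
        ultimately show "p \<in> (\<lambda>p. p + w) ` {p. sub5 p}" by blast
      qed
    qed
    moreover have "(\<lambda>x. x + pos w) ` pos ` {p. sub5 p} = pos ` (\<lambda>p. p + w) ` {p. sub5 p}"
      by (simp only: image_image pos_add)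
    ultimately show ?thesis by simp
  qed
  show ?thesis
  proof
    assume "alpha_type (sqrt 75) \<phi>"
    then obtain w where w: "\<phi> = pos ` alpha_conf (fst w mod 5, (fst w + snd w) mod 15)" "\<phi> \<subseteq> H2"
      unfolding alpha_type_def equilateral_sublattice_75 A2_eq using shift by auto
    have "w \<in> alpha_conf (fst w mod 5, (fst w + snd w) mod 15)" by (simp add: alpha_conf_iff)
    hence "pos w \<in> H2" using w by blast
    hence "hex w" by (simp add: H2_eq image_iff pos_inj)
    hence "(fst w + snd w) mod 15 mod 3 \<noteq> 0" by (simp add: hex_def mod_mod_cancel)
    moreover define s where "s = (fst w + snd w) mod 15"
    have "0 \<le> s" "s < 15" by (simp_all add: s_def)
    moreover have "s \<in> {1, 2, 4, 5, 7, 8, 10, 11, 13, 14}" if "0 \<le> s" "s < 15" "s mod 3 \<noteq> 0" for s :: int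
      using that unfolding insert_iff empty_iff by presburger
    ultimately have "s \<in> {1, 2, 4, 5, 7, 8, 10, 11, 13, 14}" by (simp only: s_def)
    moreover have "fst w mod 5 \<in> {0, 1, 2, 3, 4}" unfolding insert_iff empty_iff by presburger
    ultimately have "(fst w mod 5, s) \<in> alpha_index" by (simp only: alpha_index_def mem_Sigma_iff)
    thus "\<exists>c\<in>alpha_index. \<phi> = pos ` alpha_conf c" using w(1) by (auto simp only: s_def)
  next
    assume "\<exists>c\<in>alpha_index. \<phi> = pos ` alpha_conf c"
    then obtain i s where c: "(i, s) \<in> alpha_index" "\<phi> = pos ` alpha_conf (i, s)" by auto
    have bd: "0 \<le> i" "i < 5" "0 \<le> s" "s < 15" using alpha_index_bounds[OF c(1)] by blast+
    have "\<phi> = (\<lambda>x. x + pos (i, s - i)) ` pos ` {p. sub5 p}"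
      unfolding shift using c bd by simp
    moreover have "\<phi> \<subseteq> H2" using alpha_conf_hex[OF c(1)] unfolding H2_eq c(2) by blast
    ultimately show "alpha_type (sqrt 75) \<phi>"
      unfolding alpha_type_def equilateral_sublattice_75 A2_eq by blast
  qed
qed

lemma alpha_conf_inj:
  assumes "c \<in> alpha_index" "c' \<in> alpha_index" "alpha_conf c = alpha_conf c'"
  shows "c = c'"
proof -
  obtain i s i' s' where c: "c = (i, s)" "c' = (i', s')" by (cases c; cases c') blast
  have bd: "0 \<le> i" "i < 5" "0 \<le> s" "s < 15" using alpha_index_bounds[of i s] assms c by blast+
  have "(i, s - i) \<in> alpha_conf c" using bd by (simp add: c alpha_conf_iff)
  hence "(i, s - i) \<in> alpha_conf c'" using assms by simp
  thus ?thesis using bd by (simp add: c alpha_conf_iff)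
qed

lemma card_alpha: "card {\<phi>. PGS (sqrt 67) \<phi> \<and> alpha_type (sqrt 75) \<phi>} = 50"
proof -
  have "{\<phi>. PGS (sqrt 67) \<phi> \<and> alpha_type (sqrt 75) \<phi>} = (\<lambda>c. pos ` alpha_conf c) ` alpha_index"
    using alpha_conf_PGS by (auto simp: alpha_type_iff)
  moreover have "inj_on (\<lambda>c. pos ` alpha_conf c) alpha_index"
    using alpha_conf_inj by (simp add: inj_on_def inj_image_eq_iff[OF inj_pos])
  moreover have "card alpha_index = 50" by (simp add: alpha_index_def)
  ultimately show ?thesis by (simp add: card_image)
qed

section \<open>Counting the configurations of type beta\<close>

text \<open>A shape \<open>(\<alpha>, \<beta>, \<gamma>, x, y)\<close> encodes the period lattice \<open>{p. 150 dvd \<alpha> * fst p + \<beta> * snd p}\<close>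
  of index 150 and the residue \<open>\<gamma>\<close> of the second orbit; \<open>(x, y)\<close> is a vector of residue 1.\<close>

type_synonym shape = "int \<times> int \<times> int \<times> int \<times> int"

text \<open>The first, fifth and fourth lattices are rotations of each other by multiples of 120
  degrees; the other three are their mirror images under exchange of the coordinates.\<close>

definition shapes :: "shape list" where
  "shapes = [(5, 14, 7, 3, -1), (14, 5, 7, -1, 3), (11, -16, 67, 3, 2), (-16, 11, 67, 2, 3),
     (11, 5, 67, 1, -2), (5, 11, 67, -2, 1)]"

definition beta_conf :: "shape \<times> int \<Rightarrow> pt set" where
  "beta_conf = (\<lambda>((\<alpha>, \<beta>, \<gamma>, x, y), r). {p. 150 dvd \<alpha> * fst p + \<beta> * snd p - r \<or> 150 dvd \<alpha> * fst p + \<beta> * snd p - r - \<gamma>})"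

text \<open>Modulo 3 the linear form is twice the coordinate sum, and \<open>\<gamma>\<close> is 1.
  Thus \<open>r\<close> and \<open>r + \<gamma>\<close> both avoid the removed sub-lattice exactly
  for \<open>r mod 3 = 1\<close>.\<close>

definition beta_index :: "(shape \<times> int) set" where
  "beta_index = set shapes \<times> (\<lambda>k. 3 * k + 1) ` {0..<50}"

definition shape_ok :: "shape \<Rightarrow> bool" where
  "shape_ok = (\<lambda>(\<alpha>, \<beta>, \<gamma>, x, y). \<alpha> mod 3 = 2 \<and> \<beta> mod 3 = 2 \<and> \<gamma> mod 3 = 1 \<and> \<alpha> * x + \<beta> * y = 1 \<and>
     (\<gamma> = 7 \<or> \<gamma> = 67) \<and>
     (\<forall>u\<in>set [-9..9]. \<forall>v\<in>set [-9..9]. 150 dvd \<alpha> * u + \<beta> * v \<or> 150 dvd \<alpha> * u + \<beta> * v - \<gamma> \<or> 150 dvd \<alpha> * u + \<beta> * v + \<gamma> \<longrightarrow>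
        u = 0 \<and> v = 0 \<or> 67 \<le> u * u + v * v - u * v))"

lemma shapes_ok: "\<forall>s\<in>set shapes. shape_ok s"
  by code_simp

lemma beta_conf_iff: "p \<in> beta_conf ((\<alpha>, \<beta>, \<gamma>, x, y), r) \<longleftrightarrow>
    150 dvd \<alpha> * fst p + \<beta> * snd p - r \<or> 150 dvd \<alpha> * fst p + \<beta> * snd p - r - \<gamma>"
  by (simp add: beta_conf_def)

lemma beta_index_iff: "(s, r) \<in> beta_index \<longleftrightarrow> s \<in> set shapes \<and> 0 \<le> r \<and> r < 150 \<and> r mod 3 = 1"
proof -
  have "r \<in> (\<lambda>k. 3 * k + 1) ` {0..<50} \<longleftrightarrow> 0 \<le> r \<and> r < 150 \<and> r mod 3 = 1"
  proof
    assume r: "0 \<le> r \<and> r < 150 \<and> r mod 3 = 1"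
    hence "r = 3 * (r div 3) + 1" using div_mult_mod_eq[of r 3] by simp
    moreover have "r div 3 \<in> {0..<50}" using r by auto
    ultimately show "r \<in> (\<lambda>k. 3 * k + 1) ` {0..<50}" by (rule image_eqI)
  qed auto
  thus ?thesis by (simp add: beta_index_def)
qed

lemma beta_index_shape:
  assumes "((\<alpha>, \<beta>, \<gamma>, x, y), r) \<in> beta_index"
  shows "\<alpha> mod 3 = 2" "\<beta> mod 3 = 2" "\<gamma> mod 3 = 1" "\<alpha> * x + \<beta> * y = 1" "\<gamma> = 7 \<or> \<gamma> = 67"
proof -
  have "(\<alpha>, \<beta>, \<gamma>, x, y) \<in> set shapes" using assms beta_index_iff by blast
  from bspec[OF shapes_ok this] have ok: "shape_ok (\<alpha>, \<beta>, \<gamma>, x, y)" .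
  note ok' = ok[unfolded shape_ok_def prod.case]
  show "\<alpha> mod 3 = 2" by (rule conjunct1[OF ok'])
  show "\<beta> mod 3 = 2" by (rule conjunct1[OF conjunct2[OF ok']])
  show "\<gamma> mod 3 = 1" by (rule conjunct1[OF conjunct2[OF conjunct2[OF ok']]])
  show "\<alpha> * x + \<beta> * y = 1" by (rule conjunct1[OF conjunct2[OF conjunct2[OF conjunct2[OF ok']]]])
  show "\<gamma> = 7 \<or> \<gamma> = 67" by (rule conjunct1[OF conjunct2[OF conjunct2[OF conjunct2[OF conjunct2[OF ok']]]]])
qed

lemma hex_residue:
  assumes "\<alpha> mod 3 = 2" "\<beta> mod 3 = 2" "150 dvd \<alpha> * fst p + \<beta> * snd p - r"
  shows "hex p \<longleftrightarrow> r mod 3 \<noteq> (0 :: int)"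
proof -
  obtain a where a: "\<alpha> = 3 * a + 2" using assms(1) by (metis div_mult_mod_eq mult.commute)
  obtain b where b: "\<beta> = 3 * b + 2" using assms(2) by (metis div_mult_mod_eq mult.commute)
  obtain k where k: "\<alpha> * fst p + \<beta> * snd p - r = 150 * k" using assms(3) by (rule dvdE)
  have "r = 2 * (fst p + snd p) + 3 * (a * fst p + b * snd p - 50 * k)"
    using k unfolding a b by (simp add: algebra_simps)
  thus ?thesis unfolding hex_def by presburger
qed

lemma beta_conf_hex:
  assumes i: "(s, r) \<in> beta_index" and p: "p \<in> beta_conf (s, r)"
  shows "hex p"
proof -
  obtain \<alpha> \<beta> \<gamma> x y where s: "s = (\<alpha>, \<beta>, \<gamma>, x, y)" by (cases s)
  have ok: "\<alpha> mod 3 = 2" "\<beta> mod 3 = 2" "\<gamma> mod 3 = 1"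
    using beta_index_shape[OF i[unfolded s]] by blast+
  have r: "r mod 3 = 1" using i beta_index_iff by blast
  hence "(r + \<gamma>) mod 3 \<noteq> 0" using ok by presburger
  thus ?thesis
    using p hex_residue[OF ok(1,2), of p r] hex_residue[OF ok(1,2), of p "r + \<gamma>"] r
    unfolding s beta_conf_iff by (auto simp: diff_diff_eq)
qed

lemma dvd_two_classes:
  fixes n P Q \<gamma> :: int
  assumes "n dvd P \<or> n dvd P - \<gamma>" "n dvd Q \<or> n dvd Q - \<gamma>"
  shows "n dvd P - Q \<or> n dvd P - Q - \<gamma> \<or> n dvd P - Q + \<gamma>"
proof -
  have "P - Q = (P - \<gamma>) - (Q - \<gamma>)" "P - Q + \<gamma> = P - (Q - \<gamma>)" "P - Q - \<gamma> = (P - \<gamma>) - Q" by simp_all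
  thus ?thesis using assms by (metis dvd_diff)
qed

lemma beta_conf_packed:
  assumes i: "(s, r) \<in> beta_index"
  shows "packed (beta_conf (s, r))"
  unfolding packed_def
proof (intro conjI ballI impI)
  fix p assume "p \<in> beta_conf (s, r)" thus "hex p" using beta_conf_hex[OF i] by blast
next
  obtain \<alpha> \<beta> \<gamma> x y where s: "s = (\<alpha>, \<beta>, \<gamma>, x, y)" by (cases s)
  fix p q assume pq: "p \<in> beta_conf (s, r)" "q \<in> beta_conf (s, r)" "p \<noteq> q"
  define u v where "u = fst p - fst q" and "v = snd p - snd q"
  have "\<alpha> * u + \<beta> * v = (\<alpha> * fst p + \<beta> * snd p - r) - (\<alpha> * fst q + \<beta> * snd q - r)"
    by (simp add: u_def v_def algebra_simps)
  hence d: "150 dvd \<alpha> * u + \<beta> * v \<or> 150 dvd \<alpha> * u + \<beta> * v - \<gamma> \<or> 150 dvd \<alpha> * u + \<beta> * v + \<gamma>"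
    using pq(1,2) unfolding s beta_conf_iff by (metis dvd_two_classes)
  show "67 \<le> qf (p - q)"
  proof (rule ccontr)
    assume n: "\<not> ?thesis"
    hence "\<bar>u\<bar> \<le> 9" "\<bar>v\<bar> \<le> 9" using qf_lt_67[of "p - q"] by (simp_all add: u_def v_def)
    hence uv: "u \<in> set [-9..9]" "v \<in> set [-9..9]" by (simp_all only: coord_mem)
    have "s \<in> set shapes" using i beta_index_iff by blast
    from bspec[OF shapes_ok this] have ok: "shape_ok s" .
    note ok' = ok[unfolded s shape_ok_def prod.case]
    have "u = 0 \<and> v = 0 \<or> 67 \<le> u * u + v * v - u * v"
      by (rule mp[OF bspec[OF bspec[OF conjunct2[OF conjunct2[OF conjunct2[OF conjunct2[OF conjunct2[OF ok']]]]] uv(1)] uv(2)] d])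
    moreover have "qf (p - q) = u * u + v * v - u * v" by (simp add: qf_def u_def v_def power2_eq_square)
    ultimately show False using n pq(3) by (simp add: u_def v_def prod_eq_iff)
  qed
qed

text \<open>Because of \<open>\<alpha> * x + \<beta> * y = 1\<close> the points
  \<open>r * (x, y) + s * (- \<beta>, \<alpha>)\<close> have residue \<open>r\<close> and are
  pairwise incongruent for \<open>N\<close> consecutive values of \<open>s\<close>.\<close>

lemma residue_class_card:
  assumes e: "\<alpha> * x + \<beta> * y = 1" and N: "0 < N"
  shows "N \<le> int (card {p \<in> grid N. N dvd \<alpha> * fst p + \<beta> * snd p - r})"
proof -
  let ?g = "\<lambda>s. red N (r * x - s * \<beta>, r * y + s * \<alpha>)"
  have co: "\<exists>i j. red N p = (fst p - N * i, snd p - N * j)" for p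
    unfolding red_def minus_mult_div_eq_mod[symmetric] by blast
  have "inj_on ?g {0..<N}"
  proof (rule inj_onI)
    fix s t assume st: "s \<in> {0..<N}" "t \<in> {0..<N}" "?g s = ?g t"
    hence dv: "N dvd (r * x - s * \<beta>) - (r * x - t * \<beta>)" "N dvd (r * y + s * \<alpha>) - (r * y + t * \<alpha>)"
      by (simp_all add: red_def mod_eq_dvd_iff)
    have "N dvd x * ((r * y + s * \<alpha>) - (r * y + t * \<alpha>)) - y * ((r * x - s * \<beta>) - (r * x - t * \<beta>))"
      by (rule dvd_diff[OF dvd_mult[OF dv(2)] dvd_mult[OF dv(1)]])
    also have "\<dots> = (s - t) * (\<alpha> * x + \<beta> * y)" by (simp add: algebra_simps)
    finally have "s mod N = t mod N" by (simp add: e mod_eq_dvd_iff)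
    thus "s = t" using st by simp
  qed
  hence "card (?g ` {0..<N}) = nat N" by (simp add: card_image)
  moreover have "card (?g ` {0..<N}) \<le> card {p \<in> grid N. N dvd \<alpha> * fst p + \<beta> * snd p - r}"
  proof (rule card_mono)
    show "?g ` {0..<N} \<subseteq> {p \<in> grid N. N dvd \<alpha> * fst p + \<beta> * snd p - r}"
    proof
      fix p assume "p \<in> ?g ` {0..<N}"
      then obtain s where p: "p = ?g s" by blast
      obtain i j where ij: "p = (r * x - s * \<beta> - N * i, r * y + s * \<alpha> - N * j)" 
        using co[of "(r * x - s * \<beta>, r * y + s * \<alpha>)"] unfolding p fst_conv snd_conv by blast
      have "\<alpha> * fst p + \<beta> * snd p - r = r * (\<alpha> * x + \<beta> * y - 1) + N * (- \<alpha> * i - \<beta> * j)"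
        unfolding ij by (simp add: algebra_simps)
      hence "N dvd \<alpha> * fst p + \<beta> * snd p - r" by (simp add: e)
      moreover have "p \<in> grid N" using p N by (simp add: red_def grid_def)
      ultimately show "p \<in> {p \<in> grid N. N dvd \<alpha> * fst p + \<beta> * snd p - r}" by blast
    qed
  qed (simp add: finite_grid)
  ultimately show ?thesis using N by linarith
qed

lemma beta_conf_PGS:
  assumes i: "(s, r) \<in> beta_index"
  shows "PGS (sqrt 67) (pos ` beta_conf (s, r))"
proof (rule PGS_pos[of 150])
  obtain \<alpha> \<beta> \<gamma> x y where s: "s = (\<alpha>, \<beta>, \<gamma>, x, y)" by (cases s)
  have ok: "\<alpha> * x + \<beta> * y = 1" "\<gamma> = 7 \<or> \<gamma> = 67"
    using beta_index_shape[OF i[unfolded s]] by blast+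
  show "packed (beta_conf (s, r))" by (rule beta_conf_packed[OF i])
  show "periodic 150 (beta_conf (s, r))" unfolding periodic_def s beta_conf_iff
  proof (intro allI)
    fix p :: pt and k j
    have "\<alpha> * (fst p + k * 150) + \<beta> * (snd p + j * 150) = (\<alpha> * fst p + \<beta> * snd p) + 150 * (\<alpha> * k + \<beta> * j)"
      by (simp add: algebra_simps)
    moreover have "150 dvd z + 150 * w - r \<longleftrightarrow> 150 dvd z - r" "150 dvd z + 150 * w - r - \<gamma> \<longleftrightarrow> 150 dvd z - r - \<gamma>" for z w
    proof -
      have "z + 150 * w - r = (z - r) + w * 150" "z + 150 * w - r - \<gamma> = (z - r - \<gamma>) + w * 150" by simp_all
      thus "150 dvd z + 150 * w - r \<longleftrightarrow> 150 dvd z - r" "150 dvd z + 150 * w - r - \<gamma> \<longleftrightarrow> 150 dvd z - r - \<gamma>"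
        by (simp_all only: dvd_add_times_triv_right_iff)
    qed
    ultimately show "(150 dvd \<alpha> * fst (fst p + k * 150, snd p + j * 150) + \<beta> * snd (fst p + k * 150, snd p + j * 150) - r \<or>
      150 dvd \<alpha> * fst (fst p + k * 150, snd p + j * 150) + \<beta> * snd (fst p + k * 150, snd p + j * 150) - r - \<gamma>) \<longleftrightarrow>
      150 dvd \<alpha> * fst p + \<beta> * snd p - r \<or> 150 dvd \<alpha> * fst p + \<beta> * snd p - r - \<gamma>"
      by (simp only: fst_conv snd_conv)
  qed
  \<comment> \<open>Two disjoint residue classes with at least 150 points each.\<close>
  show "150 * 150 \<le> 75 * int (card (beta_conf (s, r) \<inter> grid 150))"
  proof -
    define A where "A r = {p \<in> grid 150. 150 dvd \<alpha> * fst p + \<beta> * snd p - r}" for r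
    have "beta_conf (s, r) \<inter> grid 150 = A r \<union> A (r + \<gamma>)"
      by (auto simp: A_def s beta_conf_iff diff_diff_eq)
    moreover have "A r \<inter> A (r + \<gamma>) = {}"
    proof -
      have "\<not> (150 dvd z - r \<and> 150 dvd z - (r + \<gamma>))" for z
      proof
        assume "150 dvd z - r \<and> 150 dvd z - (r + \<gamma>)"
        hence "150 dvd (z - r) - (z - (r + \<gamma>))" by (blast intro: dvd_diff)
        hence "150 dvd \<gamma>" by simp
        thus False using ok(2) by auto
      qed
      thus ?thesis by (auto simp: A_def)
    qed
    moreover have "finite (A q)" for q using finite_grid by (simp add: A_def)
    ultimately have "card (beta_conf (s, r) \<inter> grid 150) = card (A r) + card (A (r + \<gamma>))"
      by (simp add: card_Un_disjoint)
    moreover have "150 \<le> int (card (A q))" for q unfolding A_def by (rule residue_class_card[OF ok(1)]) simp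
    ultimately show ?thesis using add_mono[of 150 "int (card (A r))" 150 "int (card (A (r + \<gamma>)))"] by simp
  qed
qed simp_all

text \<open>The vector \<open>\<kappa>\<close> is a period of the configuration. If it were no
  period of the second lattice, it would have to exchange the two orbits, which requires
  \<open>150 dvd 2 * \<gamma>'\<close>. Hence the forms are proportional modulo 150 and the shapes
  agree; residues modulo 3 then tell the two orbits apart.\<close>

lemma beta_conf_inj:
  assumes i: "(s, r) \<in> beta_index" "(s', r') \<in> beta_index" and eq: "beta_conf (s, r) = beta_conf (s', r')"
  shows "s = s' \<and> r = r'"
proof -
  obtain \<alpha> \<beta> \<gamma> x y where s: "s = (\<alpha>, \<beta>, \<gamma>, x, y)" by (cases s)
  obtain \<alpha>' \<beta>' \<gamma>' x' y' where s': "s' = (\<alpha>', \<beta>', \<gamma>', x', y')" by (cases s')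
  have ok: "\<alpha> * x + \<beta> * y = 1" "\<gamma> = 7 \<or> \<gamma> = 67"
    using beta_index_shape[OF i(1)[unfolded s]] by blast+
  have ok': "\<alpha>' * x' + \<beta>' * y' = 1" "\<gamma>' = 7 \<or> \<gamma>' = 67"
    using beta_index_shape[OF i(2)[unfolded s']] by blast+
  define f where "f p = \<alpha> * fst p + \<beta> * snd p" for p
  define f' where "f' p = \<alpha>' * fst p + \<beta>' * snd p" for p
  have mem: "p \<in> beta_conf (s, r) \<longleftrightarrow> 150 dvd f p - r \<or> 150 dvd f p - r - \<gamma>" for p
    by (simp add: s beta_conf_iff f_def)
  have mem': "p \<in> beta_conf (s, r) \<longleftrightarrow> 150 dvd f' p - r' \<or> 150 dvd f' p - r' - \<gamma>'" for p
    by (simp add: eq s' beta_conf_iff f'_def)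
  define \<kappa> :: pt where "\<kappa> = (- \<beta>, \<alpha>)"
  have add: "f' (p + \<kappa>) = f' p + f' \<kappa>" "f (p + \<kappa>) = f p" for p
    by (simp_all add: f_def f'_def \<kappa>_def algebra_simps)
  define o1 :: pt where "o1 = (r' * x', r' * y')"
  define o2 :: pt where "o2 = ((r' + \<gamma>') * x', (r' + \<gamma>') * y')"
  have fo: "f' o1 = r'" "f' o2 = r' + \<gamma>'"
  proof -
    have "f' o1 = r' * (\<alpha>' * x' + \<beta>' * y')" by (simp add: f'_def o1_def algebra_simps)
    thus "f' o1 = r'" by (simp add: ok')
    have "f' o2 = (r' + \<gamma>') * (\<alpha>' * x' + \<beta>' * y')" by (simp add: f'_def o2_def algebra_simps)
    thus "f' o2 = r' + \<gamma>'" by (simp add: ok')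
  qed
  have "o1 + \<kappa> \<in> beta_conf (s, r)"
    using mem'[of o1] fo mem[of o1] mem[of "o1 + \<kappa>"] add by simp
  moreover have "o2 + \<kappa> \<in> beta_conf (s, r)"
    using mem'[of o2] fo mem[of o2] mem[of "o2 + \<kappa>"] add by simp
  ultimately have "150 dvd f' \<kappa> \<or> 150 dvd f' \<kappa> - \<gamma>'" "150 dvd \<gamma>' + f' \<kappa> \<or> 150 dvd f' \<kappa>"
    unfolding mem' add fo by (simp_all add: algebra_simps)
  moreover have "\<not> (150 dvd f' \<kappa> - \<gamma>' \<and> 150 dvd \<gamma>' + f' \<kappa>)"
  proof
    assume "150 dvd f' \<kappa> - \<gamma>' \<and> 150 dvd \<gamma>' + f' \<kappa>"
    hence "150 dvd (\<gamma>' + f' \<kappa>) - (f' \<kappa> - \<gamma>')" by (blast intro: dvd_diff)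
    hence "150 dvd 2 * \<gamma>'" by simp
    thus False using ok'(2) by auto
  qed
  ultimately have "150 dvd f' \<kappa>" by blast
  hence dv: "150 dvd \<beta>' * \<alpha> - \<alpha>' * \<beta>" by (simp add: f'_def \<kappa>_def algebra_simps)
  have chk: "\<forall>s\<in>set shapes. \<forall>s'\<in>set shapes. 150 dvd fst (snd s') * fst s - fst s' * fst (snd s) \<longrightarrow> s = s'"
    unfolding shapes_def by simp
  have "s \<in> set shapes" "s' \<in> set shapes" using i beta_index_iff by blast+
  from bspec[OF bspec[OF chk this(1)] this(2)] have ss: "s = s'" using dv by (simp add: s s')
  define o3 :: pt where "o3 = (r * x, r * y)"
  have "f o3 = r * (\<alpha> * x + \<beta> * y)" by (simp add: f_def o3_def algebra_simps)
  hence "f o3 = r" by (simp add: ok)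
  hence "150 dvd r - r' \<or> 150 dvd r - r' - \<gamma>"
    using mem[of o3] mem'[of o3] ss unfolding s s' f_def f'_def by auto
  moreover have b: "0 \<le> r" "r < 150" "r mod 3 = 1" "0 \<le> r'" "r' < 150" "r' mod 3 = 1"
    using i beta_index_iff by blast+
  moreover have "\<not> 150 dvd r - r' - \<gamma>"
  proof
    assume "150 dvd r - r' - \<gamma>"
    hence "3 dvd r - r' - \<gamma>" by (rule dvd_trans[rotated]) simp
    moreover have "\<gamma> mod 3 = 1" by (rule beta_index_shape(3)[OF i(1)[unfolded s]])
    ultimately show False using b(3,6) by presburger
  qed
  ultimately have "r mod 150 = r' mod 150" unfolding mod_eq_dvd_iff by blast
  hence "r = r'" using b by simp
  thus ?thesis using ss by simp
qed

lemma card_beta_index: "card beta_index = 300"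
proof -
  have "card ((\<lambda>k. 3 * k + 1) ` {0..<50::int}) = 50" by (subst card_image) (auto simp: inj_on_def)
  moreover have "card (set shapes) = 6" by (simp add: shapes_def)
  ultimately show ?thesis by (simp add: beta_index_def card_cartesian_product)
qed

text \<open>All possibilities for \<open>(A - O, B - O, C - O)\<close>, each with its shape; the last entry tells
  whether \<open>O\<close> has residue \<open>r + \<gamma>\<close> instead of \<open>r\<close>.\<close>

definition beta_table :: "(pt \<times> pt \<times> pt \<times> shape \<times> bool) list" where
  "beta_table =
    [((-9, -7), (-2, -10), (7, -2), (5, 14, 7, 3, -1), False),
     ((-7, -9), (-10, -2), (-2, 7), (14, 5, 7, -1, 3), False),
     ((9, 2), (2, -8), (-7, -9), (11, -16, 67, 3, 2), False),
     ((2, 9), (-8, 2), (-9, -7), (-16, 11, 67, 2, 3), False),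
     ((7, -2), (10, 8), (2, 9), (11, 5, 67, 1, -2), False),
     ((-2, 7), (8, 10), (9, 2), (5, 11, 67, -2, 1), False),
     ((9, 7), (2, 10), (-7, 2), (5, 14, 7, 3, -1), True),
     ((7, 9), (10, 2), (2, -7), (14, 5, 7, -1, 3), True),
     ((-9, -2), (-2, 8), (7, 9), (11, -16, 67, 3, 2), True),
     ((-2, -9), (8, -2), (9, 7), (-16, 11, 67, 2, 3), True),
     ((-7, 2), (-10, -8), (-2, -9), (11, 5, 67, 1, -2), True),
     ((2, -7), (-8, -10), (-9, -2), (5, 11, 67, -2, 1), True)]"

text \<open>The middle divisibilities say that both Cramer forms of the basis \<open>b\<close>,
  \<open>c - a\<close> are multiples of the form of the shape modulo 150, with explicit multipliers;
  \<open>span_shape\<close> uses them to solve for integer coordinates.\<close>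

definition quad_shape :: "pt \<times> pt \<times> pt \<times> shape \<times> bool \<Rightarrow> bool" where
  "quad_shape = (\<lambda>((a1, a2), (b1, b2), (c1, c2), (\<alpha>, \<beta>, \<gamma>, x, y), \<sigma>).
     (\<alpha>, \<beta>, \<gamma>, x, y) \<in> set shapes \<and>
     150 dvd \<alpha> * b1 + \<beta> * b2 \<and> 150 dvd \<alpha> * (c1 - a1) + \<beta> * (c2 - a2) \<and>
     \<bar>b1 * (c2 - a2) - b2 * (c1 - a1)\<bar> = 150 \<and>
     150 dvd (c2 - a2) - (x * (c2 - a2) - y * (c1 - a1)) * \<alpha> \<and>
     150 dvd (a1 - c1) - (x * (c2 - a2) - y * (c1 - a1)) * \<beta> \<and>
     150 dvd - b2 - (b1 * y - b2 * x) * \<alpha> \<and> 150 dvd b1 - (b1 * y - b2 * x) * \<beta> \<and>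
     150 dvd \<alpha> * c1 + \<beta> * c2 - (if \<sigma> then - \<gamma> else \<gamma>))"

lemma table_shape: "\<forall>q\<in>set beta_table. quad_shape q"
  by code_simp

text \<open>Equal colours of \<open>a\<close> and \<open>c\<close> put A in the honeycomb lattice
  whenever C is. The two linear equations locate the intersection of the diagonals.\<close>

definition quad_metric :: "pt \<times> pt \<times> pt \<times> shape \<times> bool \<Rightarrow> bool" where
  "quad_metric = (\<lambda>(a, b, c, _). qf a = 67 \<and> qf c = 67 \<and> bil a c = -67 \<and> qf b = 84 \<and>
     qf (a - b) = 79 \<and> qf (b - c) = 73 \<and> qf (a - c) = 201 \<and> colour a = colour c \<and>
     150 * fst a + 76 * (fst c - fst a) = 67 * fst b \<and> 150 * snd a + 76 * (snd c - snd a) = 67 * snd b)"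

lemma table_metric: "\<forall>q\<in>set beta_table. quad_metric q"
  by (simp add: beta_table_def quad_metric_def qf_def bil_def)

definition norm67 :: "pt list" where
  "norm67 = [(-9, -7), (-9, -2), (-7, -9), (-7, 2), (-2, -9), (-2, 7), (2, -7), (2, 9), (7, -2), (7, 9), (9, 2), (9, 7)]"

definition norm84 :: "pt list" where
  "norm84 = [(-10, -8), (-10, -2), (-8, -10), (-8, 2), (-2, -10), (-2, 8), (2, -8), (2, 10), (8, -2), (8, 10), (10, 2), (10, 8)]"

lemma coords_10: "qf u \<le> 84 \<Longrightarrow> fst u \<in> set [-10..10] \<and> snd u \<in> set [-10..10]"
proof -
  assume u: "qf u \<le> 84"
  hence "3 * (fst u)\<^sup>2 < 3 * 11\<^sup>2" "3 * (snd u)\<^sup>2 < 3 * 11\<^sup>2" using qf_coord[of u] by simp_all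
  hence "(fst u)\<^sup>2 < 11\<^sup>2" "(snd u)\<^sup>2 < 11\<^sup>2" by simp_all
  hence "\<bar>fst u\<bar> < 11" "\<bar>snd u\<bar> < 11"
    using power2_less_imp_less[of "\<bar>fst u\<bar>" 11] power2_less_imp_less[of "\<bar>snd u\<bar>" 11] by simp_all
  hence "\<bar>fst u\<bar> \<le> 10" "\<bar>snd u\<bar> \<le> 10" by simp_all
  thus ?thesis by (simp only: coord_mem)
qed

lemma norm67: "qf u = 67 \<Longrightarrow> u \<in> set norm67"
proof -
  assume u: "qf u = 67"
  have "\<forall>x\<in>set [-10..10]. \<forall>y\<in>set [-10..10]. x * x + y * y - x * y = (67 :: int) \<longrightarrow> (x, y) \<in> set norm67"
    by code_simp
  moreover have "fst u \<in> set [-10..10]" "snd u \<in> set [-10..10]" using coords_10[of u] u by auto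
  ultimately have "(fst u, snd u) \<in> set norm67" using u unfolding qf_def power2_eq_square by blast
  thus ?thesis by simp
qed

lemma norm84: "qf u = 84 \<Longrightarrow> u \<in> set norm84"
proof -
  assume u: "qf u = 84"
  have "\<forall>x\<in>set [-10..10]. \<forall>y\<in>set [-10..10]. x * x + y * y - x * y = (84 :: int) \<longrightarrow> (x, y) \<in> set norm84"
    by code_simp
  moreover have "fst u \<in> set [-10..10]" "snd u \<in> set [-10..10]" using coords_10[of u] u by auto
  ultimately have "(fst u, snd u) \<in> set norm84" using u unfolding qf_def power2_eq_square by blast
  thus ?thesis by simp
qed

lemma table_complete:
  assumes "qf a = 67" "qf c = 67" "bil a c = -67" "qf b = 84" "qf (a - b) = 79" "qf (b - c) = 73"
  obtains s \<sigma> where "(a, b, c, s, \<sigma>) \<in> set beta_table"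
proof -
  have "\<forall>a\<in>set norm67. \<forall>b\<in>set norm84. qf (fst a - fst b, snd a - snd b) = 79 \<longrightarrow>
      list_all (\<lambda>c. qf (fst b - fst c, snd b - snd c) \<noteq> 73 \<or> bil a c \<noteq> -67 \<or>
        (a, b, c) \<in> set (map (\<lambda>(a, b, c, _). (a, b, c)) beta_table)) norm67"
    by code_simp
  moreover have "(fst a - fst b, snd a - snd b) = a - b" "(fst b - fst c, snd b - snd c) = b - c"
    by (simp_all add: prod_eq_iff)
  ultimately have "(a, b, c) \<in> set (map (\<lambda>(a, b, c, _). (a, b, c)) beta_table)"
    using assms norm67[of a] norm84[of b] norm67[of c] unfolding list_all_iff by metis
  thus ?thesis using that by auto
qed

text \<open>The generators have residue 0, which gives one inclusion. Conversely, points of residue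
  0 make both Cramer numerators divisible by 150, the determinant up to sign.\<close>

lemma span_shape:
  assumes q: "quad_shape (a, b, c, (\<alpha>, \<beta>, \<gamma>, x, y), \<sigma>)"
  shows "int_span2 (pos b) (pos (c - a)) = pos ` {p. 150 dvd \<alpha> * fst p + \<beta> * snd p}"
proof -
  obtain a1 a2 b1 b2 c1 c2 where abc: "a = (a1, a2)" "b = (b1, b2)" "c = (c1, c2)" by (cases a; cases b; cases c) blast
  define v1 v2 where "v1 = c1 - a1" "v2 = c2 - a2"
  define D where "D = b1 * v2 - b2 * v1"
  define k where "k = x * v2 - y * v1"
  define j where "j = b1 * y - b2 * x"
  have f: "150 dvd \<alpha> * b1 + \<beta> * b2" "150 dvd \<alpha> * v1 + \<beta> * v2" "\<bar>D\<bar> = 150"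
    "150 dvd v2 - k * \<alpha>" "150 dvd - v1 - k * \<beta>" "150 dvd - b2 - j * \<alpha>" "150 dvd b1 - j * \<beta>"
    using q unfolding quad_shape_def abc prod.case v1_v2_def D_def k_def j_def by auto
  have v: "c - a = (v1, v2)" by (simp add: abc v1_v2_def)
  have "(\<exists>m n. p = (m * fst b + n * fst (c - a), m * snd b + n * snd (c - a))) \<longleftrightarrow> 150 dvd \<alpha> * fst p + \<beta> * snd p" for p
  proof
    assume "\<exists>m n. p = (m * fst b + n * fst (c - a), m * snd b + n * snd (c - a))"
    then obtain m n where p: "p = (m * b1 + n * v1, m * b2 + n * v2)" by (auto simp: abc v1_v2_def)
    have "\<alpha> * fst p + \<beta> * snd p = m * (\<alpha> * b1 + \<beta> * b2) + n * (\<alpha> * v1 + \<beta> * v2)" by (simp add: p algebra_simps)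
    thus "150 dvd \<alpha> * fst p + \<beta> * snd p" using f(1,2) by simp
  next
    assume p: "150 dvd \<alpha> * fst p + \<beta> * snd p"
    have "fst p * v2 - snd p * v1 = k * (\<alpha> * fst p + \<beta> * snd p) + fst p * (v2 - k * \<alpha>) + snd p * (- v1 - k * \<beta>)"
      "b1 * snd p - b2 * fst p = j * (\<alpha> * fst p + \<beta> * snd p) + fst p * (- b2 - j * \<alpha>) + snd p * (b1 - j * \<beta>)"
      by (simp_all add: algebra_simps)
    moreover have "150 dvd k * (\<alpha> * fst p + \<beta> * snd p) + fst p * (v2 - k * \<alpha>) + snd p * (- v1 - k * \<beta>)"
      "150 dvd j * (\<alpha> * fst p + \<beta> * snd p) + fst p * (- b2 - j * \<alpha>) + snd p * (b1 - j * \<beta>)"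
      by (intro dvd_add dvd_mult p f)+
    ultimately have "150 dvd fst p * v2 - snd p * v1" "150 dvd b1 * snd p - b2 * fst p" by simp_all
    hence "D dvd fst p * v2 - snd p * v1 \<and> D dvd b1 * snd p - b2 * fst p"
      using f(3) by (metis abs_dvd_iff)
    moreover have "D \<noteq> 0" using f(3) by auto
    ultimately show "\<exists>m n. p = (m * fst b + n * fst (c - a), m * snd b + n * snd (c - a))"
      using lattice_iff[of b "c - a" D p] by (simp add: abc v1_v2_def D_def)
  qed
  thus ?thesis unfolding int_span2_pos by simp
qed

lemma two_cosets:
  assumes "int_span2 (pos u) (pos v) = pos ` {p. 150 dvd \<alpha> * fst p + \<beta> * snd p}"
  shows "{p + q | p q. p \<in> {pos o1, pos o2} \<and> q \<in> int_span2 (pos u) (pos v)} =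
    pos ` {p. 150 dvd \<alpha> * fst (p - o1) + \<beta> * snd (p - o1) \<or> 150 dvd \<alpha> * fst (p - o2) + \<beta> * snd (p - o2)}"
    (is "?L = pos ` ?R")
proof
  show "?L \<subseteq> pos ` ?R"
  proof
    fix z assume "z \<in> ?L"
    then obtain w q where w: "w \<in> {o1, o2}" "z = pos w + pos q" "150 dvd \<alpha> * fst q + \<beta> * snd q"
      unfolding assms by blast
    have "z = pos (w + q)" using w by (simp add: pos_add)
    moreover have "(w + q) - w = q" by simp
    hence "w + q \<in> ?R" using w(1,3) by auto
    ultimately show "z \<in> pos ` ?R" by blast
  qed
  show "pos ` ?R \<subseteq> ?L"
  proof
    fix z assume "z \<in> pos ` ?R"
    then obtain p where p: "z = pos p" "p \<in> ?R" by blast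
    then obtain w where w: "w \<in> {o1, o2}" "150 dvd \<alpha> * fst (p - w) + \<beta> * snd (p - w)" by blast
    have "z = pos w + pos (p - w)" by (simp add: p(1) pos_add[symmetric])
    thus "z \<in> ?L" unfolding assms using w by blast
  qed
qed

lemma beta_quad_conf:
  assumes q: "quad_shape (a, b, c, (\<alpha>, \<beta>, \<gamma>, x, y), \<sigma>)"
    and r: "150 dvd \<alpha> * fst w + \<beta> * snd w - r - (if \<sigma> then \<gamma> else 0)"
  shows "{p + q | p q. p \<in> {pos w, pos (w + c)} \<and> q \<in> int_span2 (pos b) (pos (c - a))} =
    pos ` beta_conf ((\<alpha>, \<beta>, \<gamma>, x, y), r)"
proof -
  define f where "f p = \<alpha> * fst p + \<beta> * snd p" for p
  have fc: "150 dvd f c - (if \<sigma> then - \<gamma> else \<gamma>)"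
    using q unfolding quad_shape_def f_def by (cases a; cases b; cases c) auto
  have fw: "150 dvd f w - r - (if \<sigma> then \<gamma> else 0)" using r by (simp add: f_def)
  have shift: "150 dvd A \<longleftrightarrow> 150 dvd B" if "150 dvd A - B" for A B :: int
    using that by (metis diff_add_cancel dvd_add_right_iff)
  have "(150 dvd f (p - w) \<or> 150 dvd f (p - (w + c))) \<longleftrightarrow> (150 dvd f p - r \<or> 150 dvd f p - r - \<gamma>)" for p
  proof (cases \<sigma>)
    case False
    have "(f p - r) - f (p - w) = f w - r" "(f p - r - \<gamma>) - f (p - (w + c)) = (f w - r) + (f c - \<gamma>)"
      by (simp_all add: f_def algebra_simps)
    moreover have "150 dvd f w - r" "150 dvd f c - \<gamma>" using fw fc False by simp_all
    moreover from this have "150 dvd (f w - r) + (f c - \<gamma>)" by (rule dvd_add)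
    ultimately show ?thesis using shift[of "f p - r" "f (p - w)"] shift[of "f p - r - \<gamma>" "f (p - (w + c))"] by metis
  next
    case True
    have "(f p - r - \<gamma>) - f (p - w) = f w - r - \<gamma>" "(f p - r) - f (p - (w + c)) = (f w - r - \<gamma>) + (f c - - \<gamma>)"
      by (simp_all add: f_def algebra_simps)
    moreover have "150 dvd f w - r - \<gamma>" "150 dvd f c - - \<gamma>" using fw fc True by simp_all
    moreover from this have "150 dvd (f w - r - \<gamma>) + (f c - - \<gamma>)" by (rule dvd_add)
    ultimately show ?thesis using shift[of "f p - r - \<gamma>" "f (p - w)"] shift[of "f p - r" "f (p - (w + c))"] by metis
  qed
  hence "{p. 150 dvd f (p - w) \<or> 150 dvd f (p - (w + c))} = beta_conf ((\<alpha>, \<beta>, \<gamma>, x, y), r)"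
    by (auto simp: beta_conf_def f_def)
  thus ?thesis unfolding two_cosets[OF span_shape[OF q]] f_def by simp
qed

text \<open>Since \<open>bil\<close> is twice the scalar product, the required value is 2 * 67 * cos
  (2 pi / 3) = -67.\<close>

lemma pos_vertex_angle:
  assumes "qf (p - q) = 67" "qf (s - q) = 67"
  shows "vertex_angle (pos p) (pos q) (pos s) = 2 * pi / 3 \<longleftrightarrow> bil (p - q) (s - q) = -67"
proof -
  have cos: "cos (2 * pi / 3) = - 1 / 2"
  proof -
    have "2 * pi / 3 = pi - pi / 3" by simp
    thus ?thesis by (simp only: cos_pi_minus cos_60)
  qed
  have n: "norm (pos (p - q)) = sqrt 67" "norm (pos (s - q)) = sqrt 67"
    using pos_norm[of "p - q"] pos_norm[of "s - q"] assms by (metis norm_ge_zero of_int_numeral real_sqrt_unique)+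
  define t where "t = (pos (p - q) \<bullet> pos (s - q)) / 67"
  have va: "vertex_angle (pos p) (pos q) (pos s) = arccos t"
    by (simp add: vertex_angle_def pos_minus[symmetric] n t_def)
  have t: "t = of_int (bil (p - q) (s - q)) / 134" using pos_inner[of "p - q" "s - q"] by (simp add: t_def)
  have "\<bar>pos (p - q) \<bullet> pos (s - q)\<bar> \<le> sqrt 67 * sqrt 67" using Cauchy_Schwarz_ineq2[of "pos (p - q)" "pos (s - q)"] by (simp only: n)
  hence t1: "\<bar>t\<bar> \<le> 1" by (simp add: t_def)
  have "arccos t = 2 * pi / 3 \<longleftrightarrow> t = - 1 / 2"
  proof
    assume a: "arccos t = 2 * pi / 3"
    show "t = - 1 / 2" using cos_arccos_abs[OF t1] unfolding a cos by (rule sym)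
  next
    assume "t = - 1 / 2"
    hence "t = cos (2 * pi / 3)" by (simp only: cos)
    moreover have "2 * pi / 3 \<le> pi" by simp
    ultimately show "arccos t = 2 * pi / 3" using arccos_cos[of "2 * pi / 3"] by simp
  qed
  also have "\<dots> \<longleftrightarrow> bil (p - q) (s - q) = -67"
  proof -
    have "t = - 1 / 2 \<longleftrightarrow> real_of_int (bil (p - q) (s - q)) = real_of_int (- 67)" unfolding t by auto
    thus ?thesis by (simp only: of_int_eq_iff)
  qed
  finally show ?thesis unfolding va .
qed

lemma beta_type_conf:
  assumes "beta_type (sqrt 67) 2 7 \<phi>"
  shows "\<exists>i\<in>beta_index. \<phi> = pos ` beta_conf i"
proof -
  obtain pO pA pB pC where bq: "beta_quadrilateral (sqrt 67) 2 7 pO pA pB pC"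
    and \<phi>: "\<phi> = {p + q | p q. p \<in> {pO, pC} \<and> q \<in> int_span2 (pB - pO) (pC - pA)}"
    using assms unfolding beta_type_def by blast
  have "pO \<in> H2" "pA \<in> H2" "pB \<in> H2" "pC \<in> H2" using bq unfolding beta_quadrilateral_def by blast+
  then obtain w A B C where P: "pO = pos w" "pA = pos A" "pB = pos B" "pC = pos C" and hex: "hex w" "hex C"
    unfolding H2_eq by blast
  define a b c where "a = A - w" and "b = B - w" and "c = C - w"
  have C: "C = w + c" by (simp add: c_def)
  have d: "dist (pos w) (pos A) = sqrt 67" "dist (pos w) (pos C) = sqrt 67"
    "vertex_angle (pos A) (pos w) (pos C) = 2 * pi / 3"
    "(dist (pos A) (pos B))\<^sup>2 = 79" "(dist (pos B) (pos C))\<^sup>2 = 73" "(dist (pos w) (pos B))\<^sup>2 = 84"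
    using bq unfolding beta_quadrilateral_def P by simp_all
  have ac: "qf a = 67" "qf c = 67"
    using d(1,2) pos_dist_sqrt[of 67] qf_minus[of w] by (simp_all add: a_def c_def)
  have "bil a c = -67" using d(3) pos_vertex_angle[of A w C] ac by (simp add: a_def c_def)
  moreover have "qf b = 84" using d(6) unfolding pos_dist b_def by (simp add: qf_minus[of w])
  moreover have "qf (a - b) = 79" using d(4) unfolding pos_dist a_def b_def by simp
  moreover have "qf (b - c) = 73" using d(5) unfolding pos_dist b_def c_def by simp
  ultimately obtain s \<sigma> where e: "(a, b, c, s, \<sigma>) \<in> set beta_table" using table_complete[of a c b] ac by blast
  obtain \<alpha> \<beta> \<gamma> x y where s: "s = (\<alpha>, \<beta>, \<gamma>, x, y)" by (cases s)
  have q: "quad_shape (a, b, c, (\<alpha>, \<beta>, \<gamma>, x, y), \<sigma>)" using bspec[OF table_shape e] unfolding s .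
  define \<delta> where "\<delta> = (if \<sigma> then \<gamma> else 0)"
  define r where "r = (\<alpha> * fst w + \<beta> * snd w - \<delta>) mod 150"
  have r: "150 dvd \<alpha> * fst w + \<beta> * snd w - r - \<delta>"
  proof -
    have "\<alpha> * fst w + \<beta> * snd w - r - \<delta> = 150 * ((\<alpha> * fst w + \<beta> * snd w - \<delta>) div 150)"
      unfolding r_def minus_mod_eq_mult_div[symmetric] by simp
    thus ?thesis by simp
  qed
  have sS: "(\<alpha>, \<beta>, \<gamma>, x, y) \<in> set shapes"
    using q unfolding quad_shape_def by (cases a; cases b; cases c) auto
  \<comment> \<open>The residue 1 is a placeholder that makes the facts about the shape available
    before \<open>r\<close> is known to be admissible.\<close>
  hence "((\<alpha>, \<beta>, \<gamma>, x, y), 1) \<in> beta_index" by (simp add: beta_index_iff)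
  note ok = beta_index_shape[OF this]
  have fc: "150 dvd \<alpha> * fst c + \<beta> * snd c - (if \<sigma> then - \<gamma> else \<gamma>)"
    using q unfolding quad_shape_def by (cases a; cases b; cases c) auto
  have rw: "150 dvd \<alpha> * fst w + \<beta> * snd w - (r + \<delta>)" using r by (simp add: algebra_simps)
  have rC: "150 dvd \<alpha> * fst C + \<beta> * snd C - (r + (\<gamma> - \<delta>))"
  proof -
    have "\<alpha> * fst C + \<beta> * snd C - (r + (\<gamma> - \<delta>)) =
        (\<alpha> * fst w + \<beta> * snd w - (r + \<delta>)) + (\<alpha> * fst c + \<beta> * snd c - (if \<sigma> then - \<gamma> else \<gamma>))"
      by (simp add: C \<delta>_def algebra_simps)
    thus ?thesis using rw fc by (simp only: dvd_add)
  qed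
  have "(r + \<delta>) mod 3 \<noteq> 0" "(r + (\<gamma> - \<delta>)) mod 3 \<noteq> 0"
    using hex_residue[OF ok(1,2) rw] hex_residue[OF ok(1,2) rC] hex by simp_all
  \<comment> \<open>O and C represent the two orbits, in either order, and both lie in the honeycomb
    lattice.\<close>
  hence "r mod 3 \<noteq> 0 \<and> (r + \<gamma>) mod 3 \<noteq> 0" by (auto simp: \<delta>_def split: if_splits)
  hence "r mod 3 = 1" using ok(3) by presburger
  moreover have "0 \<le> r" "r < 150" by (simp_all add: r_def)
  ultimately have i: "((\<alpha>, \<beta>, \<gamma>, x, y), r) \<in> beta_index" using sS by (simp add: beta_index_iff)
  have "pB - pO = pos b" "pC - pA = pos (c - a)" unfolding P by (simp_all add: a_def b_def c_def pos_minus)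
  hence "\<phi> = {p + q | p q. p \<in> {pos w, pos (w + c)} \<and> q \<in> int_span2 (pos b) (pos (c - a))}"
    unfolding \<phi> by (simp add: P C)
  also have "\<dots> = pos ` beta_conf ((\<alpha>, \<beta>, \<gamma>, x, y), r)"
    by (rule beta_quad_conf[OF q]) (use r in \<open>simp add: \<delta>_def\<close>)
  finally show ?thesis using i by blast
qed

text \<open>For the table entries the quadrilateral OABC has determinant 150 and its triangles OAC
  and OAB have 67 and 76 in absolute value; these ratios locate the intersection on OB and on
  AC.\<close>

lemma segments_meet:
  assumes e: "150 * fst a + 76 * (fst c - fst a) = 67 * fst b" "150 * snd a + 76 * (snd c - snd a) = 67 * snd b"
  shows "closed_segment (pos w) (pos (w + b)) \<inter> closed_segment (pos (w + a)) (pos (w + c)) \<noteq> {}"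
proof -
  have r: "150 * real_of_int (fst a) + 76 * (of_int (fst c) - of_int (fst a)) = 67 * of_int (fst b)"
    "150 * real_of_int (snd a) + 76 * (of_int (snd c) - of_int (snd a)) = 67 * of_int (snd b)"
    using arg_cong[OF e(1), of real_of_int] arg_cong[OF e(2), of real_of_int] by simp_all
  have "150 *\<^sub>R pos a + 76 *\<^sub>R (pos c - pos a) = 67 *\<^sub>R pos b"
    unfolding vec_eq_iff forall_2
  proof
    show "(150 *\<^sub>R pos a + 76 *\<^sub>R (pos c - pos a)) $ 1 = (67 *\<^sub>R pos b) $ 1" using r by (simp add: pos_nth algebra_simps)
    have "(150 *\<^sub>R pos a + 76 *\<^sub>R (pos c - pos a)) $ 2 =
      (150 * real_of_int (snd a) + 76 * (of_int (snd c) - of_int (snd a))) * sqrt 3 / 2" by (simp add: pos_nth algebra_simps)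
    thus "(150 *\<^sub>R pos a + 76 *\<^sub>R (pos c - pos a)) $ 2 = (67 *\<^sub>R pos b) $ 2" unfolding r by (simp add: pos_nth)
  qed
  hence "(1 / 150) *\<^sub>R (150 *\<^sub>R pos a + 76 *\<^sub>R (pos c - pos a)) = (1 / 150) *\<^sub>R (67 *\<^sub>R pos b)" by simp
  hence v: "pos a + (76 / 150) *\<^sub>R (pos c - pos a) = (67 / 150) *\<^sub>R pos b" by (simp add: scaleR_add_right)
  define z where "z = pos w + (67 / 150) *\<^sub>R pos b"
  have comb: "(1 - k) *\<^sub>R (u + p) + k *\<^sub>R (u + q) = u + (p + k *\<^sub>R (q - p))" for k :: real and u p q :: "real^2"
    by (simp add: algebra_simps)
  have "z = (1 - 67 / 150) *\<^sub>R pos w + (67 / 150) *\<^sub>R pos (w + b)"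
    using comb[of "67 / 150" "pos w" 0 "pos b"] by (simp only: z_def pos_add) simp
  hence "z \<in> closed_segment (pos w) (pos (w + b))" unfolding in_segment by (intro exI[of _ "67 / 150"]) simp
  moreover have "z = (1 - 76 / 150) *\<^sub>R pos (w + a) + (76 / 150) *\<^sub>R pos (w + c)"
    unfolding z_def v[symmetric] pos_add comb ..
  hence "z \<in> closed_segment (pos (w + a)) (pos (w + c))" unfolding in_segment by (intro exI[of _ "76 / 150"]) simp
  ultimately show ?thesis by blast
qed

lemma beta_conf_type:
  assumes i: "(s, r) \<in> beta_index"
  shows "beta_type (sqrt 67) 2 7 (pos ` beta_conf (s, r))"
proof -
  obtain \<alpha> \<beta> \<gamma> x y where s: "s = (\<alpha>, \<beta>, \<gamma>, x, y)" by (cases s)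
  note i' = i[unfolded s] and ok = beta_index_shape[OF i[unfolded s]]
  have "\<forall>s\<in>set shapes. s \<in> set (map (\<lambda>(a, b, c, s, \<sigma>). s) (filter (\<lambda>(a, b, c, s, \<sigma>). \<not> \<sigma>) beta_table))"
    by code_simp
  moreover have "s \<in> set shapes" using i beta_index_iff by blast
  ultimately have "s \<in> set (map (\<lambda>(a, b, c, s, \<sigma>). s) (filter (\<lambda>(a, b, c, s, \<sigma>). \<not> \<sigma>) beta_table))" by (rule bspec)
  then obtain a b c where e: "(a, b, c, s, False) \<in> set beta_table" by auto
  have q: "quad_shape (a, b, c, (\<alpha>, \<beta>, \<gamma>, x, y), False)" using bspec[OF table_shape e] unfolding s .
  note m = bspec[OF table_metric e, unfolded quad_metric_def prod.case]
  \<comment> \<open>A point of residue exactly \<open>r\<close>, taken as O; the chosen table entry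
    has O in the first orbit.\<close>
  define w :: pt where "w = (r * x, r * y)"
  have "\<alpha> * fst w + \<beta> * snd w = r * (\<alpha> * x + \<beta> * y)" by (simp add: w_def algebra_simps)
  hence fw: "\<alpha> * fst w + \<beta> * snd w = r" by (simp add: ok)
  have fb: "150 dvd \<alpha> * fst b + \<beta> * snd b" and fc: "150 dvd \<alpha> * fst c + \<beta> * snd c - \<gamma>"
    using q unfolding quad_shape_def by (cases a; cases b; cases c; auto)+
  have r1: "r mod 3 = 1" using i beta_index_iff by blast
  hence r2: "(r + \<gamma>) mod 3 \<noteq> 0" using ok(3) by presburger
  have hw: "hex w" using hex_residue[OF ok(1,2), of w r] fw r1 by simp
  have "150 dvd \<alpha> * fst (w + b) + \<beta> * snd (w + b) - r" using fb fw by (simp add: algebra_simps)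
  hence hb: "hex (w + b)" using hex_residue[OF ok(1,2)] r1 by simp
  have "\<alpha> * fst (w + c) + \<beta> * snd (w + c) - (r + \<gamma>) = \<alpha> * fst c + \<beta> * snd c - \<gamma>"
    using fw by (simp add: algebra_simps)
  hence "150 dvd \<alpha> * fst (w + c) + \<beta> * snd (w + c) - (r + \<gamma>)" using fc by (simp only:)
  hence hc: "hex (w + c)" using hex_residue[OF ok(1,2)] r2 by blast
  have "colour (w + a) = colour (w + c)"
  proof -
    have "colour a = colour c" using m by blast
    moreover have "fst (w + a) + snd (w + a) = (fst w + snd w) + (fst a + snd a)"
      "fst (w + c) + snd (w + c) = (fst w + snd w) + (fst c + snd c)" by simp_all
    ultimately show ?thesis by (metis mod_add_right_eq)
  qed
  hence ha: "hex (w + a)" using hc by (simp add: hex_def)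
  have dif: "w - (w + p) = - p" "(w + p) - (w + p') = p - p'" for p p' :: pt by simp_all
  have neg: "qf (- p) = qf p" for p by (simp add: qf_def)
  have "beta_quadrilateral (sqrt 67) 2 7 (pos w) (pos (w + a)) (pos (w + b)) (pos (w + c))"
    unfolding beta_quadrilateral_def
  proof (intro conjI)
    show "pos w \<in> H2" "pos (w + a) \<in> H2" "pos (w + b) \<in> H2" "pos (w + c) \<in> H2"
      unfolding H2_eq using hw ha hb hc by blast+
    show "closed_segment (pos w) (pos (w + b)) \<inter> closed_segment (pos (w + a)) (pos (w + c)) \<noteq> {}"
      by (rule segments_meet) (use m in blast)+
    show "dist (pos w) (pos (w + a)) = sqrt 67" "dist (pos w) (pos (w + c)) = sqrt 67"
      using m by (simp_all add: pos_dist_sqrt dif neg)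
    show "vertex_angle (pos (w + a)) (pos w) (pos (w + c)) = 2 * pi / 3"
      using m pos_vertex_angle[of "w + a" w "w + c"] by simp
    show "(dist (pos (w + a)) (pos (w + b)))\<^sup>2 = (sqrt 67)\<^sup>2 + of_int (2 * 2 + 7 + 1)"
      "(dist (pos (w + b)) (pos (w + c)))\<^sup>2 = (sqrt 67)\<^sup>2 + of_int (- 2 + 7 + 1)"
      "(dist (pos w) (pos (w + b)))\<^sup>2 = (sqrt 67)\<^sup>2 + of_int (2 + 2 * 7 + 1)"
      using m by (simp_all add: pos_dist dif neg)
    have "(dist (pos w) (pos (w + b)))\<^sup>2 < (dist (pos (w + a)) (pos (w + c)))\<^sup>2"
      using m by (simp add: pos_dist dif neg)
    thus "dist (pos w) (pos (w + b)) < dist (pos (w + a)) (pos (w + c))"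
      by (rule power2_less_imp_less) simp
  qed
  moreover have "pos ` beta_conf (s, r) = {p + q | p q. p \<in> {pos w, pos (w + c)} \<and>
      q \<in> int_span2 (pos (w + b) - pos w) (pos (w + c) - pos (w + a))}"
  proof -
    have "pos (w + b) - pos w = pos b" "pos (w + c) - pos (w + a) = pos (c - a)"
      by (simp_all add: pos_add pos_minus)
    thus ?thesis using beta_quad_conf[OF q, of w r] fw unfolding s by simp
  qed
  ultimately show ?thesis unfolding beta_type_def by fastforce
qed

lemma card_beta: "card {\<phi>. PGS (sqrt 67) \<phi> \<and> beta_type (sqrt 67) 2 7 \<phi>} = 300"
proof -
  have "{\<phi>. PGS (sqrt 67) \<phi> \<and> beta_type (sqrt 67) 2 7 \<phi>} = (\<lambda>i. pos ` beta_conf i) ` beta_index" (is "?L = ?R")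
  proof
    show "?L \<subseteq> ?R" using beta_type_conf by blast
    show "?R \<subseteq> ?L"
    proof
      fix \<phi> assume "\<phi> \<in> ?R"
      then obtain s r where "(s, r) \<in> beta_index" "\<phi> = pos ` beta_conf (s, r)" by auto
      thus "\<phi> \<in> ?L" using beta_conf_PGS beta_conf_type by simp
    qed
  qed
  moreover have "inj_on (\<lambda>i. pos ` beta_conf i) beta_index"
  proof (rule inj_onI)
    fix i j assume ij: "i \<in> beta_index" "j \<in> beta_index" "pos ` beta_conf i = pos ` beta_conf j"
    hence "beta_conf i = beta_conf j" by (simp add: inj_image_eq_iff[OF inj_pos])
    thus "i = j" using ij beta_conf_inj[of "fst i" "snd i" "fst j" "snd j"] by (simp add: prod_eq_iff)
  qed
  ultimately show ?thesis by (simp add: card_image card_beta_index)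
qed

theorem theorem13:
  shows "card {\<phi>. PGS (sqrt 67) \<phi> \<and> beta_type (sqrt 67) 2 7 \<phi>} = 300 \<and>
         card {\<phi>. PGS (sqrt 67) \<phi> \<and> alpha_type (sqrt 75) \<phi>} = 50"
  using card_beta card_alpha by blast

end
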